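(* Let $k$ be a field of characteristic $p>0$. Let $X$ be a compact connected CW-complex with $\Gamma$ as fundamental group. Let $(\Gamma_i)_{i\ge 0}$ be a residual $p$-chain of $\Gamma$, and denote the finite cover of $X$ associated to $\Gamma_i$ by $X_i$. Then, for any $n\ge 0$, the sequence of normalized Betti numbers with $k$-coefficients $$\Bigl(\frac{b_n(X_i;k)}{[\Gamma:\Gamma_i]}\Bigr)_{i\ge 0}$$ is monotone decreasing and converges as $i\to\infty$.
   Context: A residual $p$-chain of $\Gamma$ is a descending sequence $\Gamma=\Gamma_0\supseteq\Gamma_1\supseteq\Gamma_2\supseteq\cdots$ of subgroups, each normal in $\Gamma$ and of finite $p$-power index, with $\bigcap_{i\ge0}\Gamma_i=\{1\}$. $b_n(X_i;k)=\dim_k H_n(X_i;k)$. "Monotone decreasing" means non-increasing. *)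

theory Defs
  imports
    "HOL-Analysis.Analysis"
    "HOL-Homology.Homology"
    "Jordan_Normal_Form.VS_Connect"
begin

section \<open>CW complexes\<close>

definition disc :: "nat \<Rightarrow> (nat \<Rightarrow> real) topology" where
  "disc n = subtopology (Euclidean_space n) {x. (\<Sum>i<n. (x i)\<^sup>2) \<le> 1}"

definition open_disc :: "nat \<Rightarrow> (nat \<Rightarrow> real) topology" where
  "open_disc n = subtopology (Euclidean_space n) {x. (\<Sum>i<n. (x i)\<^sup>2) < 1}"

definition boundary_sphere :: "nat \<Rightarrow> (nat \<Rightarrow> real) set" where
  "boundary_sphere n = topspace (disc n) - topspace (open_disc n)"

text \<open>
  Whitehead's definition. The members of \<open>E\<close> are the open cells, as subsets of the space;
  \<open>d e\<close> is the dimension and \<open>\<Phi> e\<close> the characteristic map of the cell \<open>e\<close>.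
  The last two conjuncts are closure-finiteness and the weak topology.
\<close>

definition CW_structure ::
    "'a topology \<Rightarrow> 'a set set \<Rightarrow> ('a set \<Rightarrow> nat) \<Rightarrow> ('a set \<Rightarrow> (nat \<Rightarrow> real) \<Rightarrow> 'a) \<Rightarrow> bool" where
  "CW_structure X E d \<Phi> \<longleftrightarrow>
     \<Union>E = topspace X \<and> pairwise disjnt E \<and>
     (\<forall>e\<in>E. continuous_map (disc (d e)) X (\<Phi> e) \<and>
            homeomorphic_map (open_disc (d e)) (subtopology X e) (\<Phi> e)) \<and>
     (\<forall>e\<in>E. \<exists>F\<subseteq>E. finite F \<and> (\<forall>c\<in>F. d c < d e) \<and> \<Phi> e ` boundary_sphere (d e) \<subseteq> \<Union>F) \<and>
     (\<forall>A\<subseteq>topspace X. (\<forall>e\<in>E. closedin X (A \<inter> (closure_of) X e)) \<longrightarrow> closedin X A)"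

definition CW_complex :: "'a topology \<Rightarrow> bool" where
  "CW_complex X \<longleftrightarrow> Hausdorff_space X \<and> (\<exists>E d \<Phi>. CW_structure X E d \<Phi>)"


section \<open>The fundamental group\<close>

definition loops_at :: "'a topology \<Rightarrow> 'a \<Rightarrow> (real \<Rightarrow> 'a) set" where
  "loops_at X x = {g. pathin X g \<and> g 0 = x \<and> g 1 = x}"

definition path_homotopic :: "'a topology \<Rightarrow> (real \<Rightarrow> 'a) \<Rightarrow> (real \<Rightarrow> 'a) \<Rightarrow> bool" where
  "path_homotopic X f g \<longleftrightarrow>
     homotopic_with (\<lambda>r. r 0 = f 0 \<and> r 1 = f 1) (top_of_set {0..1}) X f g"

definition loop_class :: "'a topology \<Rightarrow> 'a \<Rightarrow> (real \<Rightarrow> 'a) \<Rightarrow> (real \<Rightarrow> 'a) set" where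
  "loop_class X x f = {g \<in> loops_at X x. path_homotopic X f g}"

text \<open>Concatenation as in \<^const>\<open>joinpaths\<close>, which requires a type of class
  \<^class>\<open>topological_space\<close>.\<close>

definition path_join :: "(real \<Rightarrow> 'a) \<Rightarrow> (real \<Rightarrow> 'a) \<Rightarrow> real \<Rightarrow> 'a" where
  "path_join f g = (\<lambda>t. if t \<le> 1/2 then f (2 * t) else g (2 * t - 1))"

text \<open>The unions below, and in the induced homomorphism, range over equal classes.\<close>

definition fundamental_group :: "'a topology \<Rightarrow> 'a \<Rightarrow> (real \<Rightarrow> 'a) set monoid" where
  "fundamental_group X x =
     \<lparr> carrier = loop_class X x ` loops_at X x,
       mult = (\<lambda>A B. \<Union>f\<in>A. \<Union>g\<in>B. loop_class X x (path_join f g)),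
       one = loop_class X x (\<lambda>t. x) \<rparr>"

definition induced_hom ::
    "'a topology \<Rightarrow> 'a \<Rightarrow> ('b \<Rightarrow> 'a) \<Rightarrow> (real \<Rightarrow> 'b) set \<Rightarrow> (real \<Rightarrow> 'a) set" where
  "induced_hom X x q C = (\<Union>f\<in>C. loop_class X x (q \<circ> f))"


section \<open>Covering spaces\<close>

text \<open>The analogue of \<^const>\<open>covering_space\<close> for abstract topologies.\<close>

definition covering_map :: "'b topology \<Rightarrow> 'a topology \<Rightarrow> ('b \<Rightarrow> 'a) \<Rightarrow> bool" where
  "covering_map Y X q \<longleftrightarrow>
     continuous_map Y X q \<and> q ` topspace Y = topspace X \<and>
     (\<forall>x\<in>topspace X. \<exists>T. x \<in> T \<and> openin X T \<and>
        (\<exists>V. \<Union>V = {y \<in> topspace Y. q y \<in> T} \<and>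
             (\<forall>U\<in>V. openin Y U) \<and>
             pairwise disjnt V \<and>
             (\<forall>U\<in>V. homeomorphic_map (subtopology Y U) (subtopology X T) q)))"

definition cover_associated_to ::
    "'a topology \<Rightarrow> 'a \<Rightarrow> (real \<Rightarrow> 'a) set set \<Rightarrow> 'b topology \<Rightarrow> ('b \<Rightarrow> 'a) \<Rightarrow> bool" where
  "cover_associated_to X x H Y q \<longleftrightarrow>
     covering_map Y X q \<and> connected_space Y \<and>
     (\<exists>y\<in>topspace Y. q y = x \<and> induced_hom X x q ` carrier (fundamental_group Y y) = H)"


section \<open>Residual chains\<close>

definition group_index :: "('g, 'm) monoid_scheme \<Rightarrow> 'g set \<Rightarrow> nat" where
  "group_index G H = card (rcosets\<^bsub>G\<^esub> H)"

text \<open>A prime power is positive, whereas \<^const>\<open>card\<close> is \<open>0\<close> on infinite sets, so for \<open>p > 0\<close> the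
  condition on the index includes its finiteness.\<close>

definition residual_p_chain ::
    "nat \<Rightarrow> ('g, 'm) monoid_scheme \<Rightarrow> (nat \<Rightarrow> 'g set) \<Rightarrow> bool" where
  "residual_p_chain p G N \<longleftrightarrow>
     N 0 = carrier G \<and>
     (\<forall>i. N (Suc i) \<subseteq> N i) \<and>
     (\<forall>i. N i \<lhd> G \<and> (\<exists>m. group_index G (N i) = p ^ m)) \<and>
     (\<Inter>i. N i) = {\<one>\<^bsub>G\<^esub>}"


section \<open>Singular homology with coefficients in a field\<close>

type_synonym ('a, 'k) coeff_chain = "((nat \<Rightarrow> real) \<Rightarrow> 'a) \<Rightarrow>\<^sub>0 'k"

definition coeff_boundary :: "nat \<Rightarrow> ('a, 'k::field) coeff_chain \<Rightarrow> ('a, 'k) coeff_chain" where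
  "coeff_boundary n c =
     (if n = 0 then 0
      else \<Sum>f\<in>Poly_Mapping.keys c. \<Sum>j\<le>n.
             Poly_Mapping.single (singular_face n j f) ((-1) ^ j * Poly_Mapping.lookup c f))"

text \<open>The multiplicative fields of a module record are irrelevant.\<close>

definition coeff_chain_module :: "nat \<Rightarrow> 'a topology \<Rightarrow> ('k::field, ('a, 'k) coeff_chain) module" where
  "coeff_chain_module n X =
     \<lparr> carrier = {c. Poly_Mapping.keys c \<subseteq> singular_simplex_set n X},
       mult = undefined, one = undefined,
       zero = 0, add = (+), smult = (\<lambda>a. Poly_Mapping.map ((*) a)) \<rparr>"

definition coeff_cycles :: "nat \<Rightarrow> 'a topology \<Rightarrow> ('a, 'k::field) coeff_chain set" where
  "coeff_cycles n X = {c \<in> carrier (coeff_chain_module n X). coeff_boundary n c = 0}"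

definition coeff_boundaries :: "nat \<Rightarrow> 'a topology \<Rightarrow> ('a, 'k::field) coeff_chain set" where
  "coeff_boundaries n X = coeff_boundary (Suc n) ` carrier (coeff_chain_module (Suc n) X)"

definition quotient_module :: "('k, 'v) module \<Rightarrow> 'v set \<Rightarrow> ('k, 'v set) module" where
  "quotient_module M N =
     \<lparr> carrier = a_rcosets\<^bsub>M\<^esub> N,
       mult = undefined, one = undefined,
       zero = N, add = set_add M, smult = (\<lambda>a C. \<Union>c\<in>C. N +>\<^bsub>M\<^esub> (a \<odot>\<^bsub>M\<^esub> c)) \<rparr>"

definition homology_module :: "nat \<Rightarrow> 'a topology \<Rightarrow> ('k::field, ('a, 'k) coeff_chain set) module" where
  "homology_module n X =
     quotient_module ((coeff_chain_module n X)\<lparr>carrier := coeff_cycles n X\<rparr>) (coeff_boundaries n X)"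

text \<open>\<^const>\<open>vectorspace.dim\<close> is unspecified on infinite-dimensional spaces; finite covers of compact
  CW complexes have finite-dimensional homology.\<close>

definition betti_number :: "'k::field itself \<Rightarrow> nat \<Rightarrow> 'a topology \<Rightarrow> nat" where
  "betti_number _ n X =
     vectorspace.dim (class_ring :: 'k ring) (homology_module n X :: ('k, ('a, 'k) coeff_chain set) module)"

end

theory Submission
  imports Defs "HOL-Algebra.Sylow"
begin

text \<open>
  A singular simplex of the cover belonging to a normal subgroup \<open>N\<close> is a singular simplex of \<open>X\<close>
  together with a coset of \<open>N\<close>, so for \<open>N \<subseteq> M\<close> the cover of \<open>N\<close> is a free \<open>M/N\<close>-complex over the
  cover of \<open>M\<close>. Along the chain \<open>M/N\<close> is a finite \<open>p\<close>-group, hence an iterated extension by cyclic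
  groups of order \<open>p\<close>. For such a cyclic group, generated by \<open>z\<close>, the group ring is
  \<open>k[z]/(z-1)\<^sup>p\<close>, and the powers of \<open>z - 1\<close> filter the chains of the cover into \<open>p\<close> copies of the chains
  of the base. Therefore \<open>b\<^sub>n\<close> grows at most by the factor \<open>[M : N]\<close>, which is monotonicity; convergence
  follows because the normalized Betti numbers are nonnegative. Since the dimension of an
  infinite-dimensional space is unspecified, one also needs finiteness of the homology of a compact
  CW complex, obtained by attaching its finitely many cells one at a time.
\<close>

section \<open>Lifting through covering maps\<close>

text \<open>Two obstacles shape the proof: no dimension may be assumed finite in advance, and the
  covers are given only as spaces with a prescribed image of the fundamental group. Hence an upper
  bound for homology is a finite set of cycles that spans modulo boundaries; it can be moved along
  isomorphisms and filtrations before any dimension is known. The filtration gives only an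
  inequality, because its j-th piece sees just those cycles of the base that lift to chains whose
  multiple by (z - 1)^j is closed. Two facts about the free action carry the argument. If (z - 1)^j
  c = 0 with j < p, then c vanishes in the quotient, since (z - 1)^(p-1) is the norm element 1 + z +
  ... + z^(p-1). And a chain vanishing in the quotient is a multiple of z - 1. Finiteness is proved
  for integral homology, in the form that all subgroups are finitely generated, which is stable
  under exact sequences; an argument of universal coefficient type then leads to coefficients in
  k.\<close>

lemma covering_map_continuous: "covering_map Y X q \<Longrightarrow> continuous_map Y X q"
  by (simp add: covering_map_def)

lemma covering_map_surj: "covering_map Y X q \<Longrightarrow> q ` topspace Y = topspace X"
  by (simp add: covering_map_def)

lemma covering_map_sheets:
  assumes "covering_map Y X q" "x \<in> topspace X"
  obtains T V where "x \<in> T" "openin X T" "\<Union>V = {y \<in> topspace Y. q y \<in> T}"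
    "\<And>U. U \<in> V \<Longrightarrow> openin Y U" "pairwise disjnt V"
    "\<And>U. U \<in> V \<Longrightarrow> homeomorphic_map (subtopology Y U) (subtopology X T) q"
proof -
  have "\<exists>T. x \<in> T \<and> openin X T \<and> (\<exists>V. \<Union>V = {y \<in> topspace Y. q y \<in> T} \<and> (\<forall>U\<in>V. openin Y U) \<and>
      pairwise disjnt V \<and> (\<forall>U\<in>V. homeomorphic_map (subtopology Y U) (subtopology X T) q))"
    by (rule bspec[OF assms(1)[unfolded covering_map_def, THEN conjunct2, THEN conjunct2] assms(2)])
  then obtain T V where "x \<in> T" "openin X T" "\<Union>V = {y \<in> topspace Y. q y \<in> T}" "\<forall>U\<in>V. openin Y U"
      "pairwise disjnt V" "\<forall>U\<in>V. homeomorphic_map (subtopology Y U) (subtopology X T) q"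
    by (elim exE conjE)
  then show thesis by (intro that[of T V]) simp_all
qed

text \<open>Over an evenly covered neighbourhood of \<open>q (g t)\<close> each lift stays, near
  \<open>t\<close>, in a single sheet. In a common sheet injectivity of \<open>q\<close> forces
  equality, and different sheets are disjoint.\<close>

lemma lifts_locally_agree_or_differ:
  assumes cov: "covering_map Y X q"
    and g: "continuous_map D Y g" and h: "continuous_map D Y h"
    and qq: "\<And>t. t \<in> topspace D \<Longrightarrow> q (g t) = q (h t)" and t: "t \<in> topspace D"
  shows "\<exists>W. openin D W \<and> t \<in> W \<and> ((\<forall>s\<in>W. g s = h s) \<or> (\<forall>s\<in>W. g s \<noteq> h s))"
proof -
  have gY: "g s \<in> topspace Y" "h s \<in> topspace Y" if "s \<in> topspace D" for s
    using that g h by (auto simp: continuous_map_def)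
  have "q (g t) \<in> topspace X"
    using covering_map_continuous[OF cov] gY(1)[OF t] by (auto simp: continuous_map_def)
  then obtain T V where TV: "q (g t) \<in> T" "\<Union>V = {y \<in> topspace Y. q y \<in> T}"
    "\<And>U. U \<in> V \<Longrightarrow> openin Y U" "pairwise disjnt V"
    "\<And>U. U \<in> V \<Longrightarrow> homeomorphic_map (subtopology Y U) (subtopology X T) q"
    by (rule covering_map_sheets[OF cov]) blast
  have "g t \<in> \<Union>V" "h t \<in> \<Union>V" using TV(1,2) gY[OF t] qq[OF t] by auto
  then obtain U U' where U: "U \<in> V" "g t \<in> U" and U': "U' \<in> V" "h t \<in> U'" by auto
  define W where "W = {s \<in> topspace D. g s \<in> U} \<inter> {s \<in> topspace D. h s \<in> U'}"
  have W: "openin D W" "t \<in> W"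
    using openin_continuous_map_preimage[OF g TV(3)[OF U(1)]]
      openin_continuous_map_preimage[OF h TV(3)[OF U'(1)]] t U U'
    by (auto simp: W_def)
  show ?thesis
  proof (cases "U = U'")
    case True
    have "inj_on q U"
      using homeomorphic_imp_injective_map[OF TV(5)[OF U(1)]] openin_subset[OF TV(3)[OF U(1)]]
      by (simp add: Int_absorb1)
    then have "\<forall>s\<in>W. g s = h s" using True qq by (auto simp: W_def inj_on_def)
    then show ?thesis using W by blast
  next
    case False
    then have "disjnt U U'" using TV(4) U U' by (meson pairwiseD)
    then have "\<forall>s\<in>W. g s \<noteq> h s" by (auto simp: W_def disjnt_iff)
    then show ?thesis using W by blast
  qed
qed

text \<open>The local dichotomy makes the set of agreement both open and closed in a connected
  domain.\<close>

lemma lifts_agree: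
  assumes cov: "covering_map Y X q" and D: "connected_space D"
    and g: "continuous_map D Y g" and h: "continuous_map D Y h"
    and qq: "\<And>t. t \<in> topspace D \<Longrightarrow> q (g t) = q (h t)"
    and t0: "t0 \<in> topspace D" "g t0 = h t0" and t: "t \<in> topspace D"
  shows "g t = h t"
proof -
  define S where "S = {s \<in> topspace D. g s = h s}"
  note loc = lifts_locally_agree_or_differ[OF cov g h qq]
  have "openin D S"
    unfolding openin_subopen[of _ S]
  proof
    fix s assume s: "s \<in> S"
    then have "s \<in> topspace D" by (simp add: S_def)
    from loc[OF _ this] obtain W where W: "openin D W" "s \<in> W"
      "(\<forall>s\<in>W. g s = h s) \<or> (\<forall>s\<in>W. g s \<noteq> h s)" by blast
    then show "\<exists>T. openin D T \<and> s \<in> T \<and> T \<subseteq> S"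
      using s openin_subset[OF W(1)] by (intro exI[of _ W]) (auto simp: S_def)
  qed
  moreover have "openin D (topspace D - S)"
    unfolding openin_subopen[of _ "topspace D - S"]
  proof
    fix s assume s: "s \<in> topspace D - S"
    then have "s \<in> topspace D" by simp
    from loc[OF _ this] obtain W where W: "openin D W" "s \<in> W"
      "(\<forall>s\<in>W. g s = h s) \<or> (\<forall>s\<in>W. g s \<noteq> h s)" by blast
    then show "\<exists>T. openin D T \<and> s \<in> T \<and> T \<subseteq> topspace D - S"
      using s openin_subset[OF W(1)] by (intro exI[of _ W]) (auto simp: S_def)
  qed
  then have "closedin D S" by (auto simp: closedin_def S_def)
  ultimately have "S = {} \<or> S = topspace D"
    using D by (auto simp: connected_space_clopen_in)
  then show ?thesis using t0 t by (auto simp: S_def)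
qed

text \<open>The start may be any \<open>t0\<close> in \<open>S\<close> and any point over it. Gluing
  needs this freedom, because the lift on one piece dictates where the lift on the next has to pass.
  For empty \<open>S\<close> the condition holds vacuously.\<close>

definition lifts_on ::
    "'b topology \<Rightarrow> ('b \<Rightarrow> 'a) \<Rightarrow> 'd topology \<Rightarrow> ('d \<Rightarrow> 'a) \<Rightarrow> 'd set \<Rightarrow> bool" where
  "lifts_on Y q D f S \<longleftrightarrow> (\<forall>t0\<in>S. \<forall>y\<in>topspace Y. q y = f t0 \<longrightarrow>
     (\<exists>g. continuous_map (subtopology D S) Y g \<and> (\<forall>t\<in>S. q (g t) = f t) \<and> g t0 = y))"

lemma lifts_onE:
  assumes "lifts_on Y q D f S" "t0 \<in> S" "y \<in> topspace Y" "q y = f t0"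
  obtains g where "continuous_map (subtopology D S) Y g" "\<And>t. t \<in> S \<Longrightarrow> q (g t) = f t" "g t0 = y"
proof -
  have "\<exists>g. continuous_map (subtopology D S) Y g \<and> (\<forall>t\<in>S. q (g t) = f t) \<and> g t0 = y"
    using assms(1)[unfolded lifts_on_def, rule_format, OF assms(2,3,4)] .
  then obtain g where "continuous_map (subtopology D S) Y g" "\<forall>t\<in>S. q (g t) = f t" "g t0 = y"
    by (elim exE conjE)
  then show thesis by (intro that[of g]) simp_all
qed

lemma continuous_map_glue_closed:
  assumes "closedin D S1" "closedin D S2"
    and g1: "continuous_map (subtopology D S1) Y g1" and g2: "continuous_map (subtopology D S2) Y g2"
    and eq: "\<And>t. t \<in> S1 \<inter> S2 \<Longrightarrow> g1 t = g2 t"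
  shows "continuous_map (subtopology D (S1 \<union> S2)) Y (\<lambda>t. if t \<in> S1 then g1 t else g2 t)"
  unfolding continuous_map_closedin
proof (intro conjI allI impI)
  have sub: "S1 \<subseteq> topspace D" "S2 \<subseteq> topspace D" using assms closedin_subset by auto
  have T1: "topspace (subtopology D S1) = S1" "topspace (subtopology D S2) = S2"
    using sub by auto
  show "(\<lambda>t. if t \<in> S1 then g1 t else g2 t) \<in> topspace (subtopology D (S1 \<union> S2)) \<rightarrow> topspace Y"
    using g1 g2 T1 by (auto simp: continuous_map_def Pi_iff)
  fix C assume C: "closedin Y C"
  have "closedin (subtopology D S1) {t \<in> S1. g1 t \<in> C}" "closedin (subtopology D S2) {t \<in> S2. g2 t \<in> C}"
    using closedin_continuous_map_preimage[OF g1 C] closedin_continuous_map_preimage[OF g2 C]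
    by (simp_all only: T1)
  then have "closedin D ({t \<in> S1. g1 t \<in> C} \<union> {t \<in> S2. g2 t \<in> C})"
    using assms closedin_trans_full by blast
  moreover have "{t \<in> topspace (subtopology D (S1 \<union> S2)). (if t \<in> S1 then g1 t else g2 t) \<in> C}
      = {t \<in> S1. g1 t \<in> C} \<union> {t \<in> S2. g2 t \<in> C}"
    using sub eq by auto
  moreover have "{t \<in> S1. g1 t \<in> C} \<union> {t \<in> S2. g2 t \<in> C} \<subseteq> S1 \<union> S2" by auto
  ultimately show "closedin (subtopology D (S1 \<union> S2))
      {t \<in> topspace (subtopology D (S1 \<union> S2)). (if t \<in> S1 then g1 t else g2 t) \<in> C}"
    by (metis closedin_subset_topspace)
qed

text \<open>The lift on \<open>S2\<close> is made to pass through a point of the overlap already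
  reached by the lift on \<open>S1\<close>; connectedness of the overlap makes the two agree on all
  of it. With an empty overlap any lift on \<open>S2\<close> will do.\<close>

lemma lifts_on_Un_aux:
  assumes cov: "covering_map Y X q" and f: "continuous_map D X f"
    and cl: "closedin D S1" "closedin D S2"
    and conn: "connectedin D (S1 \<inter> S2)" and L: "lifts_on Y q D f S1" "lifts_on Y q D f S2"
    and t0: "t0 \<in> S1" and y: "y \<in> topspace Y" "q y = f t0"
  shows "\<exists>g. continuous_map (subtopology D (S1 \<union> S2)) Y g \<and> (\<forall>t\<in>S1 \<union> S2. q (g t) = f t) \<and> g t0 = y"
proof -
  have sub: "S1 \<subseteq> topspace D" "S2 \<subseteq> topspace D" using cl closedin_subset by auto
  obtain g1 where g1: "continuous_map (subtopology D S1) Y g1" "\<forall>t\<in>S1. q (g1 t) = f t" "g1 t0 = y"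
    using L(1) t0 y unfolding lifts_on_def by metis
  have g1Y: "g1 w \<in> topspace Y" if "w \<in> S1" for w
    using g1(1) that sub by (auto simp: continuous_map_def Pi_iff)
  have "\<exists>g2. continuous_map (subtopology D S2) Y g2 \<and> (\<forall>t\<in>S2. q (g2 t) = f t) \<and> (\<forall>t\<in>S1 \<inter> S2. g1 t = g2 t)"
  proof (cases "S1 \<inter> S2 = {}")
    case True
    show ?thesis
    proof (cases "S2 = {}")
      case True
      then show ?thesis using g1 by (intro exI[of _ g1]) (auto simp: continuous_map_def Pi_iff)
    next
      case False
      then obtain w where w: "w \<in> S2" by auto
      then have "f w \<in> topspace X" using f sub by (auto simp: continuous_map_def Pi_iff)
      then obtain y' where y': "y' \<in> topspace Y" "q y' = f w"
        using covering_map_surj[OF cov] by (metis imageE)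
      then obtain g2 where "continuous_map (subtopology D S2) Y g2" "\<forall>t\<in>S2. q (g2 t) = f t"
        using L(2) w unfolding lifts_on_def by meson
      then show ?thesis using True by blast
    qed
  next
    case False
    then obtain w where w: "w \<in> S1" "w \<in> S2" by auto
    have "q (g1 w) = f w" using g1 w by auto
    then obtain g2 where g2: "continuous_map (subtopology D S2) Y g2" "\<forall>t\<in>S2. q (g2 t) = f t" "g2 w = g1 w"
      using L(2) w g1Y unfolding lifts_on_def by metis
    have "g1 t = g2 t" if "t \<in> S1 \<inter> S2" for t
    proof (rule lifts_agree[OF cov, of "subtopology D (S1 \<inter> S2)" _ _ w])
      show "connected_space (subtopology D (S1 \<inter> S2))" using conn by (simp add: connectedin_def)
      show "continuous_map (subtopology D (S1 \<inter> S2)) Y g1" "continuous_map (subtopology D (S1 \<inter> S2)) Y g2"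
        by (rule continuous_map_from_subtopology_mono[OF g1(1)] continuous_map_from_subtopology_mono[OF g2(1)], simp)+
      show "q (g1 t) = q (g2 t)" if "t \<in> topspace (subtopology D (S1 \<inter> S2))" for t
        using that g1 g2 by auto
    qed (use w sub g2 that in auto)
    then show ?thesis using g2 by blast
  qed
  then obtain g2 where g2: "continuous_map (subtopology D S2) Y g2" "\<forall>t\<in>S2. q (g2 t) = f t" "\<And>t. t\<in>S1 \<inter> S2 \<Longrightarrow> g1 t = g2 t"
    by blast
  show ?thesis
    using continuous_map_glue_closed[OF cl g1(1) g2(1) g2(3)] g1 g2 t0
    by (intro exI[of _ "\<lambda>t. if t \<in> S1 then g1 t else g2 t"]) auto
qed

lemma lifts_on_Un:
  assumes cov: "covering_map Y X q" and f: "continuous_map D X f"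
    and cl: "closedin D S1" "closedin D S2"
    and conn: "connectedin D (S1 \<inter> S2)" and L: "lifts_on Y q D f S1" "lifts_on Y q D f S2"
  shows "lifts_on Y q D f (S1 \<union> S2)"
  unfolding lifts_on_def
proof (intro ballI impI)
  fix t0 y assume t: "t0 \<in> S1 \<union> S2" and y: "y \<in> topspace Y" "q y = f t0"
  have conn': "connectedin D (S2 \<inter> S1)" using conn by (simp add: Int_commute)
  show "\<exists>g. continuous_map (subtopology D (S1 \<union> S2)) Y g \<and> (\<forall>t\<in>S1 \<union> S2. q (g t) = f t) \<and> g t0 = y"
  proof (cases "t0 \<in> S1")
    case True
    then show ?thesis using lifts_on_Un_aux[OF cov f cl conn L _ y] by blast
  next
    case False
    then have "t0 \<in> S2" using t by blast
    from lifts_on_Un_aux[OF cov f cl(2,1) conn' L(2,1) this y] show ?thesis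
      by (simp only: Un_commute[of S1 S2])
  qed
qed

text \<open>On the preimage of an evenly covered set, \<open>f\<close> followed by the inverse of
  \<open>q\<close> on a sheet is a lift through the prescribed point. The same formula works on
  every subset, so one neighbourhood serves for all of them.\<close>

lemma lifts_on_small:
  assumes cov: "covering_map Y X q" and f: "continuous_map D X f" and c: "c \<in> topspace D"
  obtains W where "openin D W" "c \<in> W" "\<And>S. S \<subseteq> W \<Longrightarrow> lifts_on Y q D f S"
proof -
  have "f c \<in> topspace X" using f c by (auto simp: continuous_map_def Pi_iff)
  then obtain T V where TV: "f c \<in> T" "openin X T" "\<Union>V = {y \<in> topspace Y. q y \<in> T}"
    "\<And>U. U \<in> V \<Longrightarrow> openin Y U" 
    "\<And>U. U \<in> V \<Longrightarrow> homeomorphic_map (subtopology Y U) (subtopology X T) q"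
    by (rule covering_map_sheets[OF cov]) blast
  define W where "W = {s \<in> topspace D. f s \<in> T}"
  show thesis
  proof
    show "openin D W" "c \<in> W"
      using openin_continuous_map_preimage[OF f TV(2)] c TV(1) by (auto simp: W_def)
    fix S assume S: "S \<subseteq> W"
    show "lifts_on Y q D f S"
      unfolding lifts_on_def
    proof (intro ballI impI)
      fix t0 y assume t: "t0 \<in> S" and y: "y \<in> topspace Y" "q y = f t0"
      then have "y \<in> \<Union>V" using S TV(3) by (auto simp: W_def)
      then obtain U where U: "U \<in> V" "y \<in> U" by auto
      obtain r where r: "homeomorphic_maps (subtopology Y U) (subtopology X T) q r"
        using TV(5)[OF U(1)] homeomorphic_map_maps by blast
      have TX: "T \<subseteq> topspace X" "U \<subseteq> topspace Y" using TV(2) TV(4)[OF U(1)] openin_subset by auto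
      have rc: "continuous_map (subtopology X T) Y r"
        and qr: "\<And>x. x \<in> topspace X \<inter> T \<Longrightarrow> q (r x) = x" and rq: "\<And>y. y \<in> topspace Y \<inter> U \<Longrightarrow> r (q y) = y"
        using r by (auto simp: homeomorphic_maps_def continuous_map_in_subtopology)
      have fT: "f t \<in> topspace X \<inter> T" if "t \<in> S" for t
        using that S TX(1) unfolding W_def by blast
      have "continuous_map (subtopology D S) (subtopology X T) f"
        using f fT by (auto simp: continuous_map_in_subtopology continuous_map_from_subtopology)
      then have 1: "continuous_map (subtopology D S) Y (r \<circ> f)"
        using rc continuous_map_compose by blast
      have 2: "\<forall>t\<in>S. q ((r \<circ> f) t) = f t" using qr[OF fT] by simp
      have 3: "(r \<circ> f) t0 = y" using rq[of y] U(2) y by simp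
      show "\<exists>g. continuous_map (subtopology D S) Y g \<and> (\<forall>t\<in>S. q (g t) = f t) \<and> g t0 = y"
        by (intro exI[of _ "r \<circ> f"] conjI 1 2 3)
    qed
  qed
qed

section \<open>Lifting over compact convex sets by bisection\<close>

text \<open>\<^const>\<open>convex\<close> requires a type of class \<^class>\<open>real_vector\<close>, which \<open>'i \<Rightarrow> real\<close> is not.\<close>

definition segment_convex :: "('i \<Rightarrow> real) set \<Rightarrow> bool" where
  "segment_convex K \<longleftrightarrow> (\<forall>x\<in>K. \<forall>y\<in>K. \<forall>u. 0 \<le> u \<and> u \<le> 1 \<longrightarrow> (\<lambda>i. (1 - u) * x i + u * y i) \<in> K)"

lemma segment_convex_Int: "segment_convex A \<Longrightarrow> segment_convex B \<Longrightarrow> segment_convex (A \<inter> B)"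
  by (auto simp: segment_convex_def)

lemma segment_convex_box: "segment_convex {x. \<forall>i\<in>I. a i \<le> x i \<and> x i \<le> b i}"
proof -
  have "a i \<le> (1 - u) * x i + u * y i \<and> (1 - u) * x i + u * y i \<le> b i"
    if "a i \<le> x i \<and> x i \<le> b i" "a i \<le> y i \<and> y i \<le> b i" "0 \<le> u" "u \<le> 1" for x y :: "'a \<Rightarrow> real" and u i
    using convex_bound_le[of "x i" "b i" "y i" "1 - u" u] 
      convex_bound_le[of "- x i" "- a i" "- y i" "1 - u" u] that by auto
  then show ?thesis by (auto simp: segment_convex_def)
qed

lemma path_connectedin_segment_convex:
  assumes "segment_convex S"
  shows "path_connectedin (powertop_real UNIV) S"
proof -
  define g where "g \<equiv> \<lambda>x y::'a\<Rightarrow>real. \<lambda>u i. (1 - u) * x i + u * y i"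
  have "continuous_map (subtopology euclideanreal {0..1}) (powertop_real UNIV) (g x y)" for x y
    unfolding g_def continuous_map_componentwise
    by (force intro: continuous_intros)
  moreover
  have "g x y \<in> {0..1} \<rightarrow> S" "g x y 0 = x" "g x y 1 = y" if "x \<in> S" "y \<in> S" for x y
    using that assms by (auto simp: segment_convex_def g_def)
  ultimately
  show ?thesis
    unfolding path_connectedin_def path_connected_space_def pathin_def
    by (metis continuous_map_in_subtopology euclidean_product_topology top_greatest topspace_euclidean topspace_euclidean_subtopology)
qed

lemma connectedin_segment_convex:
  "segment_convex S \<Longrightarrow> connectedin (powertop_real UNIV) S"
  by (simp add: path_connectedin_imp_connectedin path_connectedin_segment_convex)

lemma segment_convex_standard_simplex: "segment_convex (standard_simplex n)"
  by (simp add: segment_convex_def convex_standard_simplex)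

lemma powertop_real_basic_neighbourhood:
  assumes "openin (powertop_real UNIV) W" "c \<in> W"
  obtains F e where "finite F" "e > 0" "\<And>x. (\<forall>i\<in>F. \<bar>x i - c i\<bar> < e) \<Longrightarrow> x \<in> W"
proof -
  obtain U where U: "finite {i. U i \<noteq> UNIV}" "\<And>i. open (U i)" "c \<in> Pi\<^sub>E UNIV U" "Pi\<^sub>E UNIV U \<subseteq> W"
    using assms unfolding openin_product_topology_alt by (auto; metis)
  let ?F = "{i. U i \<noteq> UNIV}"
  have "\<forall>i. \<exists>e>0. \<forall>t. \<bar>t - c i\<bar> < e \<longrightarrow> t \<in> U i"
    using U(2,3) by (auto simp: open_dist dist_real_def PiE_iff)
  then obtain e where e: "\<And>i. e i > 0" "\<And>i t. \<bar>t - c i\<bar> < e i \<Longrightarrow> t \<in> U i" by metis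
  \<comment> \<open>The inserted 1 keeps the minimum meaningful when no coordinate is
    constrained.\<close>
  define d where "d = Min (insert 1 (e ` ?F))"
  have "d > 0" "\<And>i. i \<in> ?F \<Longrightarrow> d \<le> e i" using U(1) e(1) by (auto simp: d_def)
  show thesis
  proof (rule that[OF U(1) \<open>d > 0\<close>])
    fix x assume x: "\<forall>i\<in>?F. \<bar>x i - c i\<bar> < d"
    have "x i \<in> U i" for i
      using x e(2)[of "x i" i] \<open>\<And>i. i \<in> ?F \<Longrightarrow> d \<le> e i\<close>[of i] by (cases "i \<in> ?F") force+
    then show "x \<in> W" using U(4) by (auto simp: PiE_iff)
  qed
qed

text \<open>If lifting failed over a box, it would fail over ever smaller boxes shrinking to a point, hence
  inside an evenly covered neighbourhood.\<close>

lemma bisect_not_lifting: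
  fixes K :: "(nat \<Rightarrow> real) set"
  assumes cov: "covering_map Y X q"
    and f: "continuous_map (subtopology (powertop_real UNIV) K) X f"
    and K: "segment_convex K"
    and bad: "\<not> lifts_on Y q (subtopology (powertop_real UNIV) K) f (K \<inter> {x. \<forall>i<m. a i \<le> x i \<and> x i \<le> b i})"
    and k: "k \<le> m"
  shows "\<exists>a' b'. (\<forall>i. a i \<le> a' i \<and> b' i \<le> b i) \<and> (\<forall>i<k. b' i - a' i = (b i - a i) / 2) \<and>
    (\<forall>i\<ge>k. a' i = a i \<and> b' i = b i) \<and>
    \<not> lifts_on Y q (subtopology (powertop_real UNIV) K) f (K \<inter> {x. \<forall>i<m. a' i \<le> x i \<and> x i \<le> b' i})"
  using k
proof (induction k)
  case 0
  then show ?case using bad by (intro exI[of _ a] exI[of _ b]) auto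
next
  case (Suc k)
  let ?D = "subtopology (powertop_real UNIV) K"
  let ?B = "\<lambda>a b. K \<inter> {x. \<forall>i<m. a i \<le> x i \<and> x i \<le> b i}"
  obtain a' b' where ab: "\<forall>i. a i \<le> a' i \<and> b' i \<le> b i" "\<forall>i<k. b' i - a' i = (b i - a i) / 2"
    "\<forall>i\<ge>k. a' i = a i \<and> b' i = b i" "\<not> lifts_on Y q ?D f (?B a' b')"
    using Suc by auto
  \<comment> \<open>Over an empty set lifting holds vacuously, so a bad box meets \<open>K\<close>;
    this yields \<open>a k \<le> b k\<close>.\<close>
  have ne: "?B a' b' \<noteq> {}" using ab(4) by (auto simp: lifts_on_def)
  then obtain x where "\<forall>i<m. a' i \<le> x i \<and> x i \<le> b' i" by auto
  then have "a' k \<le> x k" "x k \<le> b' k" using Suc.prems by auto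
  then have "a k \<le> b k" using ab(3) by force
  define c where "c = (a k + b k) / 2"
  have c: "a k \<le> c" "c \<le> b k" "c - a k = (b k - a k) / 2" "b k - c = (b k - a k) / 2"
    using \<open>a k \<le> b k\<close> by (auto simp: c_def field_simps)
  have cl: "closedin ?D (?B a b)" for a b
  proof -
    have "closedin ?D (K \<inter> {x. \<forall>i\<in>{..<m}. a i \<le> x i \<and> x i \<le> b i})"
    proof -
      have "closedin (powertop_real UNIV) {x :: nat \<Rightarrow> real. x i \<in> {a i..b i}}" for i
        using closedin_continuous_map_preimage[OF continuous_map_product_projection[of i UNIV "\<lambda>_. euclideanreal"], of "{a i..b i}"]
        by simp
      then have "closedin (powertop_real UNIV) (\<Inter>i\<in>{..<m} . {x :: nat \<Rightarrow> real. x i \<in> {a i..b i}})" if "m > 0"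
        using that by (intro closedin_Inter) auto
      moreover have "(\<Inter>i\<in>{..<m} . {x :: nat \<Rightarrow> real. x i \<in> {a i..b i}}) = {x. \<forall>i\<in>{..<m}. a i \<le> x i \<and> x i \<le> b i}"
        by auto
      ultimately have "closedin (powertop_real UNIV) {x :: nat \<Rightarrow> real. \<forall>i\<in>{..<m}. a i \<le> x i \<and> x i \<le> b i}"
        using closedin_topspace[of "powertop_real (UNIV::nat set)"] by (cases "m > 0") auto
      then show ?thesis by (simp add: closedin_subtopology_Int_closed)
    qed
    then show ?thesis by (simp add: lessThan_def)
  qed
  \<comment> \<open>Boxes cut out of the convex set \<open>K\<close> overlap in a convex, hence
    connected, set, as gluing requires.\<close>
  have conn: "connectedin ?D (?B a b \<inter> ?B a2 b2)" for a b a2 b2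
  proof -
    have "segment_convex (K \<inter> {x. \<forall>i\<in>{..<m}. a i \<le> x i \<and> x i \<le> b i} \<inter> (K \<inter> {x. \<forall>i\<in>{..<m}. a2 i \<le> x i \<and> x i \<le> b2 i}))"
      by (intro segment_convex_Int K segment_convex_box)
    then show ?thesis
      by (auto simp: connectedin_subtopology connectedin_segment_convex lessThan_def)
  qed
  have split: "?B a' b' = ?B a' (b'(k := c)) \<union> ?B (a'(k := c)) b'"
    using c ab(3) by (auto split: if_splits)
  have "\<not> lifts_on Y q ?D f (?B a' (b'(k := c))) \<or> \<not> lifts_on Y q ?D f (?B (a'(k := c)) b')"
    using lifts_on_Un[OF cov f cl cl conn] ab(4) unfolding split by blast
  then show ?case
  proof
    assume "\<not> lifts_on Y q ?D f (?B a' (b'(k := c)))"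
    moreover have "\<forall>i. a i \<le> a' i \<and> (b'(k := c)) i \<le> b i" using ab(1) c by auto
    moreover have "\<forall>i<Suc k. (b'(k := c)) i - a' i = (b i - a i) / 2" using ab(2,3) c by (auto simp: less_Suc_eq)
    moreover have "\<forall>i\<ge>Suc k. a' i = a i \<and> (b'(k := c)) i = b i" using ab(3) by auto
    ultimately show ?thesis by blast
  next
    assume "\<not> lifts_on Y q ?D f (?B (a'(k := c)) b')"
    moreover have "\<forall>i. a i \<le> (a'(k := c)) i \<and> b' i \<le> b i" using ab(1) c by auto
    moreover have "\<forall>i<Suc k. b' i - (a'(k := c)) i = (b i - a i) / 2" using ab(2,3) c by (auto simp: less_Suc_eq)
    moreover have "\<forall>i\<ge>Suc k. (a'(k := c)) i = a i \<and> b' i = b i" using ab(3) by auto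
    ultimately show ?thesis by blast
  qed
qed

definition lifting_domain :: "'d topology \<Rightarrow> 'b topology \<Rightarrow> 'a topology \<Rightarrow> ('b \<Rightarrow> 'a) \<Rightarrow> bool" where
  "lifting_domain D Y X q \<longleftrightarrow> (\<forall>f. continuous_map D X f \<longrightarrow> lifts_on Y q D f (topspace D))"

text \<open>Only the first \<open>m\<close> coordinates vary on \<open>K\<close>, so halving all of
  them makes the nested boxes shrink to one point even in the infinite product. Closedness of
  \<open>K\<close> puts that point into \<open>K\<close>.\<close>

lemma lifting_domain_convex:
  fixes K :: "(nat \<Rightarrow> real) set"
  assumes cov: "covering_map Y X q"
    and K: "segment_convex K" "closedin (powertop_real UNIV) K"
    and bd: "\<And>x i. x \<in> K \<Longrightarrow> i < m \<Longrightarrow> a i \<le> x i \<and> x i \<le> b i" and z: "\<And>x i. x \<in> K \<Longrightarrow> i \<ge> m \<Longrightarrow> x i = 0"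
  shows "lifting_domain (subtopology (powertop_real UNIV) K) Y X q"
  unfolding lifting_domain_def
proof (intro allI impI, rule ccontr)
  let ?D = "subtopology (powertop_real UNIV) K"
  let ?B = "\<lambda>a b. K \<inter> {x. \<forall>i<m. a i \<le> x i \<and> x i \<le> b i}"
  fix f assume f: "continuous_map ?D X f" and "\<not> lifts_on Y q ?D f (topspace ?D)"
  moreover have "topspace ?D = ?B a b" using bd by auto
  ultimately have bad0: "\<not> lifts_on Y q ?D f (?B a b)" by simp
  define P where "P = (\<lambda>(n::nat) s. case s of (a', b') \<Rightarrow> (\<forall>i<m. b' i - a' i = (b i - a i) / 2 ^ n) \<and> \<not> lifts_on Y q ?D f (?B a' b'))"
  define Q where "Q = (\<lambda>(n::nat) (s::(nat\<Rightarrow>real)\<times>(nat\<Rightarrow>real)) t. case s of (a1, b1) \<Rightarrow> case t of (a2,b2) \<Rightarrow> (\<forall>i. a1 i \<le> a2 i \<and> b2 i \<le> b1 i))"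
  have "\<exists>s. \<forall>n. P n (s n) \<and> Q n (s n) (s (Suc n))"
  proof (rule dependent_nat_choice)
    show "\<exists>x. P 0 x" using bad0 by (intro exI[of _ "(a, b)"]) (auto simp: P_def)
    fix s n assume s: "P n s"
    obtain a1 b1 where ab: "s = (a1, b1)" by (cases s)
    have bad: "\<not> lifts_on Y q ?D f (?B a1 b1)" using s ab by (auto simp: P_def)
    obtain a2 b2 where "\<forall>i. a1 i \<le> a2 i \<and> b2 i \<le> b1 i" "\<forall>i<m. b2 i - a2 i = (b1 i - a1 i) / 2"
      "\<not> lifts_on Y q ?D f (?B a2 b2)"
      using bisect_not_lifting[OF cov f K(1) bad order_refl] by blast
    then show "\<exists>t. P (Suc n) t \<and> Q n s t"
      using s ab by (intro exI[of _ "(a2, b2)"]) (auto simp: P_def Q_def)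
  qed
  then obtain s where s: "\<And>n. P n (s n)" "\<And>n. Q n (s n) (s (Suc n))" by blast
  define A B where "A n = fst (s n)" and "B n = snd (s n)" for n
  have AB: "i < m \<Longrightarrow> B n i - A n i = (b i - a i) / 2 ^ n" "\<not> lifts_on Y q ?D f (?B (A n) (B n))" for n i
    using s(1)[of n] by (auto simp: P_def A_def B_def split: prod.splits)
  have mono: "A n i \<le> A (Suc n) i" "B (Suc n) i \<le> B n i" for n i
    using s(2)[of n] by (auto simp: Q_def A_def B_def split: prod.splits)
  have monoA: "n \<le> k \<Longrightarrow> A n i \<le> A k i" and monoB: "n \<le> k \<Longrightarrow> B k i \<le> B n i" for n k i
    using lift_Suc_mono_le[of "\<lambda>n. A n i"] lift_Suc_antimono_le[of "\<lambda>n. B n i"] mono by auto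
  have "\<exists>x. x \<in> ?B (A n) (B n)" for n
    using AB(2)[of n] by (auto simp: lifts_on_def)
  then have "\<forall>n. \<exists>x. x \<in> ?B (A n) (B n)" by blast
  from choice[OF this] obtain x where x: "\<And>n. x n \<in> ?B (A n) (B n)" by blast
  have AleB: "A n i \<le> B k i" if "i < m" for n k i
  proof -
    have "A n i \<le> A (max n k) i" "B (max n k) i \<le> B k i" using monoA monoB by auto
    moreover have "A (max n k) i \<le> B (max n k) i" using x[of "max n k"] that by force
    ultimately show ?thesis by linarith
  qed
  \<comment> \<open>By nesting, every lower corner lies below every upper corner, so the suprema of
    the lower corners define a point in all boxes.\<close>
  define c where "c i = (if i < m then (SUP n. A n i) else 0)" for i
  have cA: "A n i \<le> c i" and cB: "c i \<le> B n i" if "i < m" for n i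
    using that AleB[OF that, of _ n] AleB[OF that, of _ 0] 
    by (auto simp: c_def intro!: cSUP_upper cSUP_least bdd_aboveI2)
  have near: "\<bar>y i - c i\<bar> \<le> (b i - a i) / 2 ^ n" if "y \<in> ?B (A n) (B n)" "i < m" for y n i
  proof -
    have "A n i \<le> y i" "y i \<le> B n i" using that by auto
    then show ?thesis using cA[OF that(2), of n] cB[OF that(2), of n] AB(1)[OF that(2), of n] by linarith
  qed
  \<comment> \<open>A basic neighbourhood constrains finitely many coordinates, so a single
    \<open>n\<close> works for all of them at once.\<close>
  have ev: "\<exists>n. \<forall>y\<in>?B (A n) (B n). \<forall>i\<in>F. \<bar>y i - c i\<bar> < e" if "finite F" "e > 0" for F e
  proof -
    have "\<forall>i\<in>F. \<exists>n. \<forall>k\<ge>n. (b i - a i) / 2 ^ k < e"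
    proof
      fix i
      have "(\<lambda>k. (b i - a i) / 2 ^ k) \<longlonglongrightarrow> 0" by real_asymp
      then show "\<exists>n. \<forall>k\<ge>n. (b i - a i) / 2 ^ k < e"
        using order_tendstoD(2)[of _ 0 sequentially, OF _ \<open>e > 0\<close>] by (auto simp: eventually_sequentially)
    qed
    then obtain N where N: "\<And>i k. i \<in> F \<Longrightarrow> k \<ge> N i \<Longrightarrow> (b i - a i) / 2 ^ k < e" by metis
    define n where "n = Max (insert 0 (N ` F))"
    have nN: "i \<in> F \<Longrightarrow> n \<ge> N i" for i using \<open>finite F\<close> by (auto simp: n_def)
    have "\<bar>y i - c i\<bar> < e" if "y \<in> ?B (A n) (B n)" "i \<in> F" for y i
    proof (cases "i < m")
      case True
      then show ?thesis using near[OF that(1) True] N[OF that(2) nN[OF that(2)]] by linarith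
    next
      case False
      then show ?thesis using z[of y i] that \<open>e > 0\<close> by (simp add: c_def)
    qed
    then show ?thesis by blast
  qed
  have "c \<in> K"
  proof (rule ccontr)
    assume "c \<notin> K"
    then have "openin (powertop_real UNIV) (UNIV - K)" "c \<in> UNIV - K" using K(2) by (auto simp: closedin_def)
    then obtain F e where F: "finite F" "e > 0" "\<And>x. (\<forall>i\<in>F. \<bar>x i - c i\<bar> < e) \<Longrightarrow> x \<in> UNIV - K"
      by (rule powertop_real_basic_neighbourhood) blast
    from ev[OF F(1,2)] obtain n where "\<forall>y\<in>?B (A n) (B n). \<forall>i\<in>F. \<bar>y i - c i\<bar> < e" ..
    then show False using F(3)[of "x n"] x[of n] by blast
  qed
  then have "c \<in> topspace ?D" by simp
  from lifts_on_small[OF cov f this] obtain W where W: "openin ?D W" "c \<in> W" "\<And>S. S \<subseteq> W \<Longrightarrow> lifts_on Y q ?D f S" by blast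
  obtain W' where W': "openin (powertop_real UNIV) W'" "W = W' \<inter> K" using W(1) by (auto simp: openin_subtopology)
  have "c \<in> W'" using W' W by auto
  with W'(1) obtain F e where F: "finite F" "e > 0" "\<And>x. (\<forall>i\<in>F. \<bar>x i - c i\<bar> < e) \<Longrightarrow> x \<in> W'"
    by (rule powertop_real_basic_neighbourhood) blast
  from ev[OF F(1,2)] obtain n where "\<forall>y\<in>?B (A n) (B n). \<forall>i\<in>F. \<bar>y i - c i\<bar> < e" ..
  then have "?B (A n) (B n) \<subseteq> W" using F(3) W' by blast
  then show False using W(3) AB(2) by blast
qed

text \<open>A map out of the retract \<open>D\<close> is extended over \<open>E\<close> by
  \<open>r\<close>, lifted there, and the lift is restricted along \<open>s\<close>. In this way
  cubes of sequences provide the interval and the square.\<close>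

lemma lifting_domain_retract:
  assumes E: "lifting_domain E Y X q" and r: "continuous_map E D r" and s: "continuous_map D E s"
    and rs: "\<And>t. t \<in> topspace D \<Longrightarrow> r (s t) = t"
  shows "lifting_domain D Y X q"
  unfolding lifting_domain_def lifts_on_def
proof (intro allI impI ballI)
  fix f t0 y assume f: "continuous_map D X f" and t0: "t0 \<in> topspace D" and y: "y \<in> topspace Y" "q y = f t0"
  have sE: "s t \<in> topspace E" if "t \<in> topspace D" for t using s that by (auto simp: continuous_map_def Pi_iff)
  have L: "lifts_on Y q E (f \<circ> r) (topspace E)"
    using E continuous_map_compose[OF r f] by (auto simp: lifting_domain_def)
  have "q y = (f \<circ> r) (s t0)" using y rs t0 by simp
  then obtain g where g: "continuous_map (subtopology E (topspace E)) Y g" "\<And>t. t\<in>topspace E \<Longrightarrow> q (g t) = (f \<circ> r) t" "g (s t0) = y"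
    using lifts_onE[OF L, OF sE[OF t0] y(1)] by metis
  have "continuous_map D Y (g \<circ> s)" using continuous_map_compose[OF s] g(1) unfolding subtopology_topspace .
  then show "\<exists>g. continuous_map (subtopology D (topspace D)) Y g \<and> (\<forall>t\<in>topspace D. q (g t) = f t) \<and> g t0 = y"
    using g sE rs by (intro exI[of _ "g \<circ> s"]) auto
qed

lemma lifting_domain_cube:
  assumes cov: "covering_map Y X q"
  shows "lifting_domain (subtopology (powertop_real UNIV) {x. (\<forall>i<m. 0 \<le> x i \<and> x i \<le> 1) \<and> (\<forall>i::nat. i \<ge> m \<longrightarrow> x i = 0)}) Y X q"
    (is "lifting_domain (subtopology _ ?K) _ _ _")
proof (rule lifting_domain_convex[OF cov, of _ m "\<lambda>_. 0" "\<lambda>_. 1"])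
  \<comment> \<open>Side length 0 beyond \<open>m\<close> turns the cube into a box in all
    coordinates, so convexity and closedness come from a product of closed intervals.\<close>
  define b where "b = (\<lambda>i. if i < m then 1 else 0 :: real)"
  have b: "i < m \<Longrightarrow> b i = 1" "i \<ge> m \<Longrightarrow> b i = 0" for i by (auto simp: b_def)
  have mem: "x \<in> ?K \<longleftrightarrow> (\<forall>i. 0 \<le> x i \<and> x i \<le> b i)" for x
  proof
    assume "x \<in> ?K"
    then show "\<forall>i. 0 \<le> x i \<and> x i \<le> b i" by (auto simp: b_def)
  next
    assume h: "\<forall>i. 0 \<le> x i \<and> x i \<le> b i"
    have "0 \<le> x i \<and> x i \<le> 1" if "i < m" for i using h[rule_format, of i] b(1)[OF that] by simp
    moreover have "x i = 0" if "i \<ge> m" for i using h[rule_format, of i] b(2)[OF that] by simp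
    ultimately show "x \<in> ?K" by simp
  qed
  have K: "?K = {x. \<forall>i\<in>UNIV. 0 \<le> x i \<and> x i \<le> b i}" using mem by auto
  show "segment_convex ?K" unfolding K by (rule segment_convex_box)
  have "closedin (powertop_real UNIV) (Pi\<^sub>E UNIV (\<lambda>i::nat. {0..b i}))"
    by (simp add: closedin_product_topology)
  moreover have "Pi\<^sub>E UNIV (\<lambda>i::nat. {0..b i}) = ?K"
    unfolding K by (auto simp: PiE_iff)
  ultimately show "closedin (powertop_real UNIV) ?K" by simp
qed auto

lemma lifting_domain_interval:
  assumes cov: "covering_map Y X q"
  shows "lifting_domain (top_of_set {0..1::real}) Y X q"
proof (rule lifting_domain_retract[OF lifting_domain_cube[OF cov, of 1], of _ "\<lambda>x. x 0" "\<lambda>t i. if i = 0 then t else 0"])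
  show "continuous_map (subtopology (powertop_real UNIV) {x. (\<forall>i<1. 0 \<le> x i \<and> x i \<le> 1) \<and> (\<forall>i::nat. i \<ge> 1 \<longrightarrow> x i = 0)})
     (top_of_set {0..1}) (\<lambda>x. x 0)"
    by (auto simp: continuous_map_in_subtopology intro!: continuous_map_from_subtopology continuous_map_product_projection)
  show "continuous_map (top_of_set {0..1})
     (subtopology (powertop_real UNIV) {x. (\<forall>i<1. 0 \<le> x i \<and> x i \<le> 1) \<and> (\<forall>i::nat. i \<ge> 1 \<longrightarrow> x i = 0)}) (\<lambda>t i. if i = 0 then t else 0)"
    by (auto simp: continuous_map_in_subtopology continuous_map_componentwise_UNIV)
qed auto

lemma lifting_domain_square:
  assumes cov: "covering_map Y X q"
  shows "lifting_domain (prod_topology (top_of_set {0..1::real}) (top_of_set {0..1::real})) Y X q"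
proof (rule lifting_domain_retract[OF lifting_domain_cube[OF cov, of 2], of _ "\<lambda>x. (x 0, x 1)"
    "\<lambda>t i. if i = 0 then fst t else if i = 1 then snd t else 0"])
  show "continuous_map (subtopology (powertop_real UNIV) {x. (\<forall>i<2. 0 \<le> x i \<and> x i \<le> 1) \<and> (\<forall>i::nat. i \<ge> 2 \<longrightarrow> x i = 0)})
     (prod_topology (top_of_set {0..1}) (top_of_set {0..1})) (\<lambda>x. (x 0, x 1))"
    unfolding continuous_map_pairwise o_def fst_conv snd_conv
    by (auto simp: continuous_map_in_subtopology
        intro!: continuous_map_from_subtopology continuous_map_product_projection)
  have "continuous_on A (\<lambda>x. if k = Suc 0 then snd x else 0)" for A :: "(real \<times> real) set" and k
    by (cases "k = Suc 0") (auto intro: continuous_intros)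
  moreover have "continuous_map (prod_topology (top_of_set {0..1::real}) (top_of_set {0..1::real})) euclideanreal fst"
    "continuous_map (prod_topology (top_of_set {0..1::real}) (top_of_set {0..1::real})) euclideanreal snd"
    using continuous_map_into_fulltopology[OF continuous_map_fst] continuous_map_into_fulltopology[OF continuous_map_snd] by blast+
  ultimately show "continuous_map (prod_topology (top_of_set {0..1}) (top_of_set {0..1}))
     (subtopology (powertop_real UNIV) {x. (\<forall>i<2. 0 \<le> x i \<and> x i \<le> 1) \<and> (\<forall>i::nat. i \<ge> 2 \<longrightarrow> x i = 0)})
     (\<lambda>t i. if i = 0 then fst t else if i = 1 then snd t else 0)"
    by (auto simp: continuous_map_in_subtopology continuous_map_componentwise_UNIV)
qed auto

lemma lifting_domain_standard_simplex:
  assumes cov: "covering_map Y X q"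
  shows "lifting_domain (subtopology (powertop_real UNIV) (standard_simplex n)) Y X q"
  by (rule lifting_domain_convex[OF cov segment_convex_standard_simplex closedin_standard_simplex,
      where m = "Suc n" and a = "\<lambda>_. 0" and b = "\<lambda>_. 1"])
    (auto simp: standard_simplex_def)

section \<open>Lifts of paths, homotopies and simplices\<close>

lemma pathin_path_join:
  assumes f: "pathin X f" and g: "pathin X g" and fg: "f 1 = g 0"
  shows "pathin X (path_join f g)"
proof -
  let ?I = "top_of_set {0..1::real}"
  have c1: "continuous_map (subtopology ?I {0..1/2}) ?I (\<lambda>t. 2 * t)"
    by (auto simp: continuous_map_in_subtopology subtopology_subtopology intro!: continuous_intros)
  have c2: "continuous_map (subtopology ?I {1/2..1}) ?I (\<lambda>t. 2 * t - 1)"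
    by (auto simp: continuous_map_in_subtopology subtopology_subtopology intro!: continuous_intros)
  have "continuous_map (subtopology ?I ({0..1/2} \<union> {1/2..1})) X
      (\<lambda>t. if t \<in> {0..1/2} then (f \<circ> (\<lambda>t. 2 * t)) t else (g \<circ> (\<lambda>t. 2 * t - 1)) t)"
  proof (rule continuous_map_glue_closed)
    show "closedin ?I {0..1/2::real}" "closedin ?I {1/2..1::real}"
      by (auto simp: closedin_closed_eq intro!: closed_subset)
  next
    show "continuous_map (subtopology ?I {0..1/2}) X (f \<circ> (\<lambda>t. 2 * t))"
      "continuous_map (subtopology ?I {1/2..1}) X (g \<circ> (\<lambda>t. 2 * t - 1))"
      using continuous_map_compose[OF c1] continuous_map_compose[OF c2] f g by (auto simp: pathin_def)
  next
    fix t :: real assume "t \<in> {0..1/2} \<inter> {1/2..1}"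
    then have "t = 1/2" by auto
    show "(f \<circ> (\<lambda>t. 2 * t)) t = (g \<circ> (\<lambda>t. 2 * t - 1)) t" unfolding \<open>t = 1/2\<close> using fg by simp
  qed
  moreover have "{0..1/2} \<union> {1/2..1} = {0..1::real}" by auto
  ultimately have "continuous_map ?I X (\<lambda>t. if t \<in> {0..1/2} then (f \<circ> (\<lambda>t. 2 * t)) t else (g \<circ> (\<lambda>t. 2 * t - 1)) t)"
    by (simp add: subtopology_subtopology)
  then show ?thesis unfolding pathin_def
    by (rule continuous_map_eq) (auto simp: path_join_def)
qed

lemma path_join_0 [simp]: "path_join f g 0 = f 0" and path_join_1 [simp]: "path_join f g 1 = g 1"
  by (auto simp: path_join_def)

lemma pathin_reverse: "pathin X g \<Longrightarrow> pathin X (\<lambda>t. g (1 - t))"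
proof -
  assume g: "pathin X g"
  have "continuous_map (top_of_set {0..1::real}) (top_of_set {0..1}) (\<lambda>t. 1 - t)"
    by (auto simp: continuous_map_in_subtopology intro!: continuous_intros)
  from continuous_map_compose[OF this, of X g] show ?thesis using g by (simp add: pathin_def o_def)
qed

definition path_lift :: "'b topology \<Rightarrow> ('b \<Rightarrow> 'a) \<Rightarrow> 'b \<Rightarrow> (real \<Rightarrow> 'a) \<Rightarrow> (real \<Rightarrow> 'b) \<Rightarrow> bool" where
  "path_lift Y q y g h \<longleftrightarrow> pathin Y h \<and> (\<forall>t\<in>{0..1}. q (h t) = g t) \<and> h 0 = y"

text \<open>A path is a function on all of \<open>real\<close> that matters only on the unit
  interval, so its lift is unique only there. The end point does not depend on the choice.\<close>

definition lift_end :: "'b topology \<Rightarrow> ('b \<Rightarrow> 'a) \<Rightarrow> 'b \<Rightarrow> (real \<Rightarrow> 'a) \<Rightarrow> 'b" where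
  "lift_end Y q y g = (SOME h. path_lift Y q y g h) 1"

locale covering =
  fixes Y :: "'b topology" and X :: "'a topology" and q :: "'b \<Rightarrow> 'a"
  assumes cov: "covering_map Y X q"
begin

lemma path_lift_exists:
  assumes "pathin X g" "y \<in> topspace Y" "q y = g 0"
  shows "\<exists>h. path_lift Y q y g h"
proof -
  have "lifts_on Y q (top_of_set {0..1}) g {0..1}"
    using lifting_domain_interval[OF cov] assms by (auto simp: lifting_domain_def pathin_def)
  from lifts_onE[OF this, of 0 y] obtain h where "continuous_map (subtopology (top_of_set {0..1}) {0..1}) Y h"
    "\<And>t. t \<in> {0..1} \<Longrightarrow> q (h t) = g t" "h 0 = y" using assms(2,3) by auto
  then have "path_lift Y q y g h"
    by (simp add: path_lift_def pathin_def subtopology_subtopology)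
  then show ?thesis by blast
qed

lemma path_lift_unique_at:
  assumes "path_lift Y q y g h" "path_lift Y q y' g h'" "s \<in> {0..1}" "h s = h' s" "t \<in> {0..1}"
  shows "h t = h' t"
proof -
  have conn: "connected_space (top_of_set {0..1::real})"
    using is_interval_connected_1 by (metis connectedin_def connectedin_iff_connected is_interval_cc)
  have h: "continuous_map (top_of_set {0..1}) Y h" "\<And>t. t \<in> {0..1} \<Longrightarrow> q (h t) = g t"
    using assms(1) by (auto simp: path_lift_def pathin_def)
  have h': "continuous_map (top_of_set {0..1}) Y h'" "\<And>t. t \<in> {0..1} \<Longrightarrow> q (h' t) = g t"
    using assms(2) by (auto simp: path_lift_def pathin_def)
  show ?thesis
  proof (rule lifts_agree[OF cov conn h(1) h'(1)])
    show "s \<in> topspace (top_of_set {0..1})" "t \<in> topspace (top_of_set {0..1})" using assms(3,5) by simp_all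
    show "q (h u) = q (h' u)" if "u \<in> topspace (top_of_set {0..1})" for u
      using h(2)[of u] h'(2)[of u] that by simp
  qed (rule assms(4))
qed

lemma lift_end_eq:
  assumes "path_lift Y q y g h"
  shows "lift_end Y q y g = h 1"
proof -
  have *: "path_lift Y q y g (SOME h. path_lift Y q y g h)" using assms by (rule someI[of "path_lift Y q y g"])
  then have "(SOME h. path_lift Y q y g h) 0 = h 0" using assms by (simp add: path_lift_def)
  from path_lift_unique_at[OF * assms _ this, of 1] show ?thesis by (simp add: lift_end_def)
qed

lemma lift_end_props:
  assumes "pathin X g" "y \<in> topspace Y" "q y = g 0"
  shows "lift_end Y q y g \<in> topspace Y" "q (lift_end Y q y g) = g 1"
proof -
  obtain h where h: "path_lift Y q y g h" using path_lift_exists assms by blast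
  then show "lift_end Y q y g \<in> topspace Y" "q (lift_end Y q y g) = g 1"
    using lift_end_eq[OF h] by (auto simp: path_lift_def pathin_def continuous_map_def Pi_iff)
qed

lemma lift_end_join:
  assumes "pathin X f" "pathin X g" "f 1 = g 0" "y \<in> topspace Y" "q y = f 0"
  shows "lift_end Y q y (path_join f g) = lift_end Y q (lift_end Y q y f) g"
proof -
  obtain h where h: "path_lift Y q y f h" using path_lift_exists assms by blast
  have "lift_end Y q y f = h 1" using lift_end_eq[OF h] .
  moreover obtain k where k: "path_lift Y q (h 1) g k"
    using path_lift_exists[of g "h 1"] lift_end_props[of f y] assms calculation by auto
  moreover have "path_lift Y q y (path_join f g) (path_join h k)"
    using h k pathin_path_join[of Y h k] by (auto simp: path_lift_def path_join_def)
  ultimately show ?thesis using lift_end_eq[OF k] lift_end_eq[of y "path_join f g" "path_join h k"] by simp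
qed

text \<open>Uniqueness of lifts may be applied at parameter 1 instead of 0, so transport along a
  path is injective on fibres.\<close>

lemma lift_end_inj:
  assumes "pathin X g" "y \<in> topspace Y" "q y = g 0" "y' \<in> topspace Y" "q y' = g 0"
    and "lift_end Y q y g = lift_end Y q y' g"
  shows "y = y'"
proof -
  obtain h where h: "path_lift Y q y g h" using path_lift_exists assms by blast
  obtain h' where h': "path_lift Y q y' g h'" using path_lift_exists assms by blast
  have "h 1 = h' 1" using lift_end_eq[OF h] lift_end_eq[OF h'] assms by simp
  then have "h 0 = h' 0" using path_lift_unique_at[OF h h', of 1 0] by simp
  then show ?thesis using h h' by (simp add: path_lift_def)
qed

lemma lift_end_reverse:
  assumes "pathin X g" "y \<in> topspace Y" "q y = g 0"
  shows "lift_end Y q (lift_end Y q y g) (\<lambda>t. g (1 - t)) = y"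
proof -
  obtain h where h: "path_lift Y q y g h" using path_lift_exists assms by blast
  then have "path_lift Y q (h 1) (\<lambda>t. g (1 - t)) (\<lambda>t. h (1 - t))"
    using pathin_reverse[of Y h] by (auto simp: path_lift_def)
  from lift_end_eq[OF this] lift_end_eq[OF h] h show ?thesis by (simp add: path_lift_def)
qed

text \<open>The homotopy is lifted to the square. The two edges with path parameter 0 and 1 lie over
  single points and are constant by uniqueness of lifts; the other two edges then lift
  \<open>f\<close> and \<open>g\<close> from \<open>y\<close> and share their end.\<close>

lemma lift_end_homotopic:
  assumes hom: "path_homotopic X f g" and y: "y \<in> topspace Y" "q y = f 0"
  shows "lift_end Y q y f = lift_end Y q y g"
proof -
  let ?I = "top_of_set {0..1::real}"
  obtain h where h: "continuous_map (prod_topology ?I ?I) X h" "\<And>s. h (0, s) = f s" "\<And>s. h (1, s) = g s"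
    "\<And>t. t \<in> {0..1} \<Longrightarrow> h (t, 0) = f 0 \<and> h (t, 1) = f 1"
    using hom unfolding path_homotopic_def homotopic_with_def by auto
  have L: "lifts_on Y q (prod_topology ?I ?I) h (topspace (prod_topology ?I ?I))"
    using lifting_domain_square[OF cov] h(1) by (auto simp: lifting_domain_def)
  have 00: "(0, 0) \<in> topspace (prod_topology ?I ?I)" by simp
  have "q y = h (0, 0)" using y h by simp
  then obtain H where H: "continuous_map (subtopology (prod_topology ?I ?I) (topspace (prod_topology ?I ?I))) Y H"
    "\<And>t. t\<in>topspace (prod_topology ?I ?I) \<Longrightarrow> q (H t) = h t" "H (0, 0) = y"
    using lifts_onE[OF L, OF 00 y(1)] by metis
  have Hc: "continuous_map (prod_topology ?I ?I) Y H" using H(1) unfolding subtopology_topspace .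
  have Hq: "q (H (t, s)) = h (t, s)" if "t \<in> {0..1}" "s \<in> {0..1}" for t s using H(2) that by auto
  have row: "pathin Y (\<lambda>s. H (t, s))" if "t \<in> {0..1}" for t
  proof -
    have "continuous_map ?I (prod_topology ?I ?I) (\<lambda>s. (t, s))"
      using that unfolding continuous_map_pairwise o_def by simp
    from continuous_map_compose[OF this Hc] show ?thesis by (simp add: pathin_def o_def)
  qed
  have col: "pathin Y (\<lambda>t. H (t, s))" if "s \<in> {0..1}" for s
  proof -
    have "continuous_map ?I (prod_topology ?I ?I) (\<lambda>t. (t, s))"
      using that unfolding continuous_map_pairwise o_def by simp
    from continuous_map_compose[OF this Hc] show ?thesis by (simp add: pathin_def o_def)
  qed
  have HY: "H (t, s) \<in> topspace Y" if "t \<in> {0..1}" "s \<in> {0..1}" for t s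
    using Hc that by (auto simp: continuous_map_def Pi_iff)
  have const: "H (0, s) = H (1, s)" if "s \<in> {0, 1}" for s
  proof -
    have 1: "path_lift Y q (H (0, s)) (\<lambda>t. h (0, s)) (\<lambda>t. H (t, s))"
      using col[of s] that Hq[of _ s] h by (auto simp: path_lift_def)
    have 2: "path_lift Y q (H (0, s)) (\<lambda>t. h (0, s)) (\<lambda>t. H (0, s))"
      using that Hq[of 0 s] HY[of 0 s] by (auto simp: path_lift_def pathin_const)
    from path_lift_unique_at[OF 1 2, of 0 1] show ?thesis by simp
  qed
  have 1: "path_lift Y q y f (\<lambda>s. H (0, s))" using row[of 0] Hq[of 0] H(3) h by (auto simp: path_lift_def)
  have 2: "path_lift Y q y g (\<lambda>s. H (1, s))"
    using row[of 1] Hq[of 1] H(3) h const[of 0] by (auto simp: path_lift_def)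
  show ?thesis using lift_end_eq[OF 1] lift_end_eq[OF 2] const[of 1] by simp
qed

lemma simplex_lift_exists:
  assumes s: "singular_simplex n X \<sigma>" and v: "v \<in> standard_simplex n" and y: "y \<in> topspace Y" "q y = \<sigma> v"
  shows "\<exists>\<tau>. singular_simplex n Y \<tau> \<and> (\<forall>t\<in>standard_simplex n. q (\<tau> t) = \<sigma> t) \<and> \<tau> v = y"
proof -
  let ?D = "subtopology (powertop_real UNIV) (standard_simplex n)"
  have L: "lifts_on Y q ?D \<sigma> (topspace ?D)"
    using lifting_domain_standard_simplex[OF cov] s by (auto simp: lifting_domain_def singular_simplex_def)
  have v': "v \<in> topspace ?D" using v by simp
  then obtain g where g: "continuous_map (subtopology ?D (topspace ?D)) Y g" "\<And>t. t\<in>topspace ?D \<Longrightarrow> q (g t) = \<sigma> t" "g v = y"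
    using lifts_onE[OF L, OF v' y] by metis
  \<comment> \<open>Singular simplices are extensional functions, so the lift is cut down to the
    standard simplex.\<close>
  have "continuous_map ?D Y (restrict g (standard_simplex n))"
    using g(1) unfolding subtopology_topspace by (rule continuous_map_eq) simp
  then show ?thesis using g v
    by (intro exI[of _ "restrict g (standard_simplex n)"]) (auto simp: singular_simplex_def)
qed

lemma simplex_lift_unique:
  assumes "singular_simplex n Y \<tau>" "singular_simplex n Y \<tau>'"
    and "\<And>t. t \<in> standard_simplex n \<Longrightarrow> q (\<tau> t) = q (\<tau>' t)" and "v \<in> standard_simplex n" "\<tau> v = \<tau>' v"
  shows "\<tau> = \<tau>'"
proof (rule extensionalityI[of _ "standard_simplex n"])
  let ?D = "subtopology (powertop_real UNIV) (standard_simplex n)"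
  have D: "connected_space ?D" "topspace ?D = standard_simplex n"
    using connectedin_standard_simplex[of n] by (auto simp: connectedin_def)
  have c: "continuous_map ?D Y \<tau>" "continuous_map ?D Y \<tau>'" using assms(1,2) by (auto simp: singular_simplex_def)
  fix t assume t: "t \<in> standard_simplex n"
  show "\<tau> t = \<tau>' t"
    by (rule lifts_agree[OF cov D(1) c]) (use assms(3,4,5) t D(2) in auto)
qed (use assms(1,2) in \<open>auto simp: singular_simplex_def\<close>)

end

section \<open>Singular simplices of a based cover\<close>

lemma path_homotopic_refl: "pathin X f \<Longrightarrow> path_homotopic X f f"
  by (simp add: path_homotopic_def pathin_def)

lemma path_homotopic_ends: "path_homotopic X f g \<Longrightarrow> g 0 = f 0 \<and> g 1 = f 1"
  unfolding path_homotopic_def by (drule homotopic_with_imp_property) simp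

lemma path_homotopic_sym:
  assumes "path_homotopic X f g" shows "path_homotopic X g f"
proof -
  have "homotopic_with (\<lambda>r. r 0 = g 0 \<and> r 1 = g 1) (top_of_set {0..1}) X f g"
    using assms path_homotopic_ends[OF assms] by (simp add: path_homotopic_def)
  from homotopic_with_symD[OF this] show ?thesis by (simp add: path_homotopic_def)
qed

lemma path_homotopic_trans:
  assumes "path_homotopic X f g" "path_homotopic X g h" shows "path_homotopic X f h"
proof -
  have "homotopic_with (\<lambda>r. r 0 = f 0 \<and> r 1 = f 1) (top_of_set {0..1}) X g h"
    using assms path_homotopic_ends[OF assms(1)] by (simp add: path_homotopic_def)
  from homotopic_with_trans[OF assms(1)[unfolded path_homotopic_def] this] show ?thesis
    by (simp add: path_homotopic_def)
qed

lemma path_homotopic_cong: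
  assumes "pathin X f" "\<And>t. t \<in> {0..1} \<Longrightarrow> f t = g t" shows "path_homotopic X f g"
  unfolding path_homotopic_def
  using assms by (intro homotopic_with_equal) (auto simp: pathin_def)

lemma path_homotopic_compose:
  assumes "path_homotopic Y f g" "continuous_map Y X q" shows "path_homotopic X (q \<circ> f) (q \<circ> g)"
  unfolding path_homotopic_def
  by (rule homotopic_with_compose_continuous_map_left[OF assms(1)[unfolded path_homotopic_def] assms(2)]) auto

lemma loop_class_iff: "g \<in> loop_class X x f \<longleftrightarrow> g \<in> loops_at X x \<and> path_homotopic X f g"
  by (simp add: loop_class_def)

lemma loop_class_eq:
  assumes "path_homotopic X f g" shows "loop_class X x f = loop_class X x g"
proof (rule Set.set_eqI)
  fix h
  show "h \<in> loop_class X x f \<longleftrightarrow> h \<in> loop_class X x g"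
    unfolding loop_class_iff
    using path_homotopic_trans[OF assms, of h] path_homotopic_trans[OF path_homotopic_sym[OF assms], of h] by blast
qed

lemma loop_class_self: "f \<in> loops_at X x \<Longrightarrow> f \<in> loop_class X x f"
  by (simp add: loop_class_def loops_at_def path_homotopic_refl)

lemma carrier_fundamental_group: "carrier (fundamental_group X x) = loop_class X x ` loops_at X x"
  and mult_fundamental_group: "A \<otimes>\<^bsub>fundamental_group X x\<^esub> B = (\<Union>f\<in>A. \<Union>g\<in>B. loop_class X x (path_join f g))"
  by (simp_all add: fundamental_group_def)

lemma fundamental_groupE:
  assumes "\<gamma> \<in> carrier (fundamental_group X x)"
  obtains f where "f \<in> loops_at X x" "\<gamma> = loop_class X x f" "f \<in> \<gamma>"
proof -
  obtain f where "f \<in> loops_at X x" "\<gamma> = loop_class X x f"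
    using assms unfolding carrier_fundamental_group by (rule imageE)
  then show thesis using that[of f] loop_class_self[of f X x] by simp
qed

lemma loop_class_in_carrier: "f \<in> loops_at X x \<Longrightarrow> loop_class X x f \<in> carrier (fundamental_group X x)"
  by (simp add: carrier_fundamental_group)

lemma fundamental_group_elementD:
  assumes "\<gamma> \<in> carrier (fundamental_group X x)" "f \<in> \<gamma>"
  shows "f \<in> loops_at X x" "\<gamma> = loop_class X x f"
proof -
  obtain g where g: "\<gamma> = loop_class X x g" using assms(1) by (rule fundamental_groupE)
  have f: "f \<in> loops_at X x" "path_homotopic X g f" using assms(2) unfolding g loop_class_iff by simp_all
  show "f \<in> loops_at X x" by (rule f(1))
  show "\<gamma> = loop_class X x f" unfolding g by (rule loop_class_eq[OF f(2)])
qed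

lemma fundamental_group_homotopic:
  assumes "\<gamma> \<in> carrier (fundamental_group X x)" "f \<in> \<gamma>" "g \<in> \<gamma>"
  shows "path_homotopic X f g"
  using fundamental_group_elementD(2)[OF assms(1,2)] assms(3) loop_class_iff[of g X x f] by simp

definition base_paths :: "'a topology \<Rightarrow> 'a \<Rightarrow> ('a \<Rightarrow> real \<Rightarrow> 'a) \<Rightarrow> bool" where
  "base_paths X x\<^sub>0 \<alpha> \<longleftrightarrow> (\<forall>x\<in>topspace X. pathin X (\<alpha> x) \<and> \<alpha> x 0 = x\<^sub>0 \<and> \<alpha> x 1 = x)"

definition std_vertex :: "nat \<Rightarrow> nat \<Rightarrow> real" where
  "std_vertex i = (\<lambda>j. if j = i then 1 else 0)"

lemma std_vertex_in [simp]: "std_vertex i \<in> standard_simplex n \<longleftrightarrow> i \<le> n"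
  unfolding std_vertex_def by (rule basis_in_standard_simplex)

definition first_edge :: "((nat \<Rightarrow> real) \<Rightarrow> 'a) \<Rightarrow> real \<Rightarrow> 'a" where
  "first_edge \<sigma> = (\<lambda>t. \<sigma> (\<lambda>i. (1 - t) * std_vertex 0 i + t * std_vertex 1 i))"

text \<open>The chosen paths identify every fibre with the one over the base point. In these
  identifications this loop is the transport along the first edge; the classes of such loops are the
  classical cocycle that describes covers.\<close>

definition edge_loop :: "('a \<Rightarrow> real \<Rightarrow> 'a) \<Rightarrow> ((nat \<Rightarrow> real) \<Rightarrow> 'a) \<Rightarrow> real \<Rightarrow> 'a" where
  "edge_loop \<alpha> \<sigma> = path_join (path_join (\<alpha> (\<sigma> (std_vertex 0))) (first_edge \<sigma>)) (\<lambda>t. \<alpha> (\<sigma> (std_vertex 1)) (1 - t))"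

text \<open>A simplex of the cover is recorded by its image and by the sheet of its vertex \<open>0\<close>, carried
  back to the base point along \<open>\<alpha>\<close>. Only the face opposite to vertex \<open>0\<close> has another initial vertex.\<close>

definition face_label ::
    "'a topology \<Rightarrow> 'a \<Rightarrow> ('a \<Rightarrow> real \<Rightarrow> 'a) \<Rightarrow> nat \<Rightarrow> ((nat \<Rightarrow> real) \<Rightarrow> 'a) \<Rightarrow> (real \<Rightarrow> 'a) set" where
  "face_label X x\<^sub>0 \<alpha> j \<sigma> = (if j = 0 then loop_class X x\<^sub>0 (edge_loop \<alpha> \<sigma>) else \<one>\<^bsub>fundamental_group X x\<^sub>0\<^esub>)"

lemma first_edge_0 [simp]: "first_edge \<sigma> 0 = \<sigma> (std_vertex 0)" and first_edge_1 [simp]: "first_edge \<sigma> 1 = \<sigma> (std_vertex 1)"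
  by (simp_all add: first_edge_def)

lemma pathin_first_edge:
  assumes "singular_simplex n X \<sigma>" "n \<ge> 1"
  shows "pathin X (first_edge \<sigma>)"
proof -
  have "continuous_map (top_of_set {0..1}) (subtopology (powertop_real UNIV) (standard_simplex n))
      (\<lambda>t i. (1 - t) * std_vertex 0 i + t * std_vertex 1 i)"
    unfolding continuous_map_in_subtopology continuous_map_componentwise_UNIV
    using assms(2) by (auto intro!: continuous_intros convex_standard_simplex)
  from continuous_map_compose[OF this, of X \<sigma>] show ?thesis
    using assms(1) by (simp add: pathin_def first_edge_def singular_simplex_def o_def)
qed

lemma singular_simplex_in_topspace:
  "singular_simplex n X \<sigma> \<Longrightarrow> t \<in> standard_simplex n \<Longrightarrow> \<sigma> t \<in> topspace X"
  by (auto simp: singular_simplex_def continuous_map_def Pi_iff)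

lemma edge_loop_in_loops_at:
  assumes "base_paths X x\<^sub>0 \<alpha>" "singular_simplex n X \<sigma>" "n \<ge> 1"
  shows "edge_loop \<alpha> \<sigma> \<in> loops_at X x\<^sub>0"
proof -
  have "\<sigma> (std_vertex 0) \<in> topspace X" "\<sigma> (std_vertex 1) \<in> topspace X"
    using singular_simplex_in_topspace[OF assms(2)] assms(3) by auto
  then show ?thesis
    using assms pathin_first_edge[OF assms(2,3)] unfolding edge_loop_def loops_at_def base_paths_def
    by (auto intro!: pathin_path_join pathin_reverse)
qed

lemma singular_face_apply:
  "t \<in> standard_simplex (n - 1) \<Longrightarrow> singular_face n j \<rho> t = \<rho> (simplical_face j t)"
  by (simp add: singular_face_def)

text \<open>That the loop classes form a group is an assumption here; in the application it comes
  with the normality of the subgroups in the chain.\<close>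

locale based_cover = covering Y X q for Y :: "'b topology" and X :: "'a topology" and q +
  fixes x\<^sub>0 :: 'a and y\<^sub>0 :: 'b and N :: "(real \<Rightarrow> 'a) set set" and \<alpha> :: "'a \<Rightarrow> real \<Rightarrow> 'a"
  assumes y0: "y\<^sub>0 \<in> topspace Y" "q y\<^sub>0 = x\<^sub>0"
    and N_image: "induced_hom X x\<^sub>0 q ` carrier (fundamental_group Y y\<^sub>0) = N"
    and path_conn: "path_connected_space Y"
    and group_N: "subgroup N (fundamental_group X x\<^sub>0)" "group (fundamental_group X x\<^sub>0)"
    and \<alpha>: "base_paths X x\<^sub>0 \<alpha>"
begin

abbreviation "\<Gamma> \<equiv> fundamental_group X x\<^sub>0"

text \<open>Names the points of the fibre over \<open>x\<^sub>0\<close>, and thereby the sheets, by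
  loop classes; every representative gives the same point.\<close>

definition monodromy :: "(real \<Rightarrow> 'a) set \<Rightarrow> 'b" where
  "monodromy \<gamma> = lift_end Y q y\<^sub>0 (SOME f. f \<in> \<gamma>)"

lemma lift_end_loop:
  assumes "f \<in> loops_at X x\<^sub>0" "y \<in> topspace Y" "q y = x\<^sub>0"
  shows "lift_end Y q y f \<in> topspace Y" "q (lift_end Y q y f) = x\<^sub>0"
  using lift_end_props[of f y] assms by (auto simp: loops_at_def)

lemma monodromy_eq:
  assumes "\<gamma> \<in> carrier \<Gamma>" "f \<in> \<gamma>"
  shows "monodromy \<gamma> = lift_end Y q y\<^sub>0 f"
proof -
  let ?g = "SOME f. f \<in> \<gamma>"
  have g: "?g \<in> \<gamma>" using assms(2) by (rule someI[of "\<lambda>f. f \<in> \<gamma>"])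
  have "path_homotopic X ?g f" by (rule fundamental_group_homotopic[OF assms(1) g assms(2)])
  moreover have "q y\<^sub>0 = ?g 0" using fundamental_group_elementD(1)[OF assms(1) g] y0 by (simp add: loops_at_def)
  ultimately show ?thesis
    unfolding monodromy_def by (intro lift_end_homotopic y0(1))
qed

lemma monodromy_in_fibre:
  assumes "\<gamma> \<in> carrier \<Gamma>" shows "monodromy \<gamma> \<in> topspace Y" "q (monodromy \<gamma>) = x\<^sub>0"
proof -
  obtain f where "f \<in> loops_at X x\<^sub>0" "f \<in> \<gamma>" using assms by (rule fundamental_groupE)
  then show "monodromy \<gamma> \<in> topspace Y" "q (monodromy \<gamma>) = x\<^sub>0"
    using monodromy_eq[OF assms, of f] lift_end_loop[of f y\<^sub>0] y0 by simp_all
qed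

text \<open>A concatenation is lifted piecewise, so multiplication on the right continues the lift
  from where it ended. This is why sheets correspond to right cosets of \<open>N\<close>.\<close>

lemma monodromy_mult:
  assumes "\<gamma> \<in> carrier \<Gamma>" "\<delta> \<in> carrier \<Gamma>" "g \<in> \<delta>"
  shows "monodromy (\<gamma> \<otimes>\<^bsub>\<Gamma>\<^esub> \<delta>) = lift_end Y q (monodromy \<gamma>) g"
proof -
  have "\<gamma> \<otimes>\<^bsub>\<Gamma>\<^esub> \<delta> \<in> carrier \<Gamma>" using assms group_N(2) by (simp add: group.is_monoid monoid.m_closed)
  then obtain h where h: "h \<in> \<gamma> \<otimes>\<^bsub>\<Gamma>\<^esub> \<delta>" by (rule fundamental_groupE)
  have mh: "monodromy (\<gamma> \<otimes>\<^bsub>\<Gamma>\<^esub> \<delta>) = lift_end Y q y\<^sub>0 h" by (rule monodromy_eq[OF \<open>\<gamma> \<otimes>\<^bsub>\<Gamma>\<^esub> \<delta> \<in> carrier \<Gamma>\<close> h])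
  obtain f g' where fg: "f \<in> \<gamma>" "g' \<in> \<delta>" "h \<in> loop_class X x\<^sub>0 (path_join f g')"
    using h unfolding mult_fundamental_group by (elim UN_E)
  have f: "f \<in> loops_at X x\<^sub>0" and g': "g' \<in> loops_at X x\<^sub>0"
    using fundamental_group_elementD(1)[OF assms(1) fg(1)] fundamental_group_elementD(1)[OF assms(2) fg(2)] by simp_all
  have "path_homotopic X (path_join f g') h" using fg by (simp add: loop_class_def)
  then have "lift_end Y q y\<^sub>0 h = lift_end Y q y\<^sub>0 (path_join f g')"
    using lift_end_homotopic[of "path_join f g'" h y\<^sub>0] y0 f by (simp add: loops_at_def)
  also have "\<dots> = lift_end Y q (lift_end Y q y\<^sub>0 f) g'"
    using f g' y0 by (intro lift_end_join) (auto simp: loops_at_def)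
  also have "lift_end Y q y\<^sub>0 f = monodromy \<gamma>" using monodromy_eq[OF assms(1) fg(1)] by simp
  also have "lift_end Y q (monodromy \<gamma>) g' = lift_end Y q (monodromy \<gamma>) g"
  proof (rule lift_end_homotopic)
    show "path_homotopic X g' g" by (rule fundamental_group_homotopic[OF assms(2) fg(2) assms(3)])
  qed (use monodromy_in_fibre[OF assms(1)] g' in \<open>auto simp: loops_at_def\<close>)
  finally show ?thesis using mh by simp
qed

text \<open>If the lift of a representative closes up, it is a loop of the cover that maps to this
  representative. Conversely, a loop of the cover is the lift of its own image.\<close>

lemma monodromy_base_iff:
  assumes \<gamma>: "\<gamma> \<in> carrier \<Gamma>"
  shows "monodromy \<gamma> = y\<^sub>0 \<longleftrightarrow> \<gamma> \<in> N"
proof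
  obtain f where fX: "f \<in> loops_at X x\<^sub>0" "\<gamma> = loop_class X x\<^sub>0 f" and f: "f \<in> \<gamma>" using \<gamma> by (rule fundamental_groupE)
  assume "monodromy \<gamma> = y\<^sub>0"
  then have *: "lift_end Y q y\<^sub>0 f = y\<^sub>0" using monodromy_eq[OF \<gamma> f] by simp
  obtain h where h: "path_lift Y q y\<^sub>0 f h"
    using path_lift_exists[of f y\<^sub>0] fX(1) y0 unfolding loops_at_def by auto
  have "h 1 = y\<^sub>0" using * lift_end_eq[OF h] by simp
  then have hY: "h \<in> loops_at Y y\<^sub>0" using h by (simp add: loops_at_def path_lift_def)
  have c: "continuous_map Y X q" by (rule covering_map_continuous[OF cov])
  let ?C = "loop_class Y y\<^sub>0 h"
  have fh: "path_homotopic X f (q \<circ> h)"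
    using h fX(1) by (intro path_homotopic_cong) (auto simp: path_lift_def loops_at_def)
  have "loop_class X x\<^sub>0 (q \<circ> k) = \<gamma>" if "k \<in> ?C" for k
  proof -
    have "path_homotopic X (q \<circ> h) (q \<circ> k)"
      using that path_homotopic_compose[OF _ c] by (simp add: loop_class_iff)
    from loop_class_eq[OF path_homotopic_trans[OF fh this]] show ?thesis using fX(2) by simp
  qed
  then have "induced_hom X x\<^sub>0 q ?C = (\<Union>k\<in>?C. \<gamma>)" unfolding induced_hom_def by simp
  also have "\<dots> = \<gamma>" using loop_class_self[OF hY] by auto
  finally have "\<gamma> = induced_hom X x\<^sub>0 q ?C" by simp
  then show "\<gamma> \<in> N" unfolding N_image[symmetric] using loop_class_in_carrier[OF hY] by (rule image_eqI)
next
  assume "\<gamma> \<in> N"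
  then obtain C where C: "\<gamma> = induced_hom X x\<^sub>0 q C" "C \<in> carrier (fundamental_group Y y\<^sub>0)"
    unfolding N_image[symmetric] by (rule imageE)
  obtain h where h: "h \<in> C" "h \<in> loops_at Y y\<^sub>0" using C(2) by (rule fundamental_groupE)
  note hY = h(2)
  have c: "continuous_map Y X q" by (rule covering_map_continuous[OF cov])
  have p: "pathin X (q \<circ> h)" using hY c pathin_compose[of Y h X q] by (simp add: loops_at_def)
  then have "q \<circ> h \<in> loops_at X x\<^sub>0" using hY y0 by (simp add: loops_at_def)
  then have "q \<circ> h \<in> \<gamma>" unfolding C(1) induced_hom_def using h(1) by (intro UN_I[of h] loop_class_self)
  then have "monodromy \<gamma> = lift_end Y q y\<^sub>0 (q \<circ> h)" by (rule monodromy_eq[OF \<gamma>])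
  also have "\<dots> = h 1" using hY by (intro lift_end_eq) (simp add: path_lift_def loops_at_def)
  finally show "monodromy \<gamma> = y\<^sub>0" using hY by (simp add: loops_at_def)
qed

text \<open>With \<eta> the quotient of \<gamma> by \<delta>, both points arise by transport along
  \<delta>, one from \<open>monodromy \<eta>\<close> and one from \<open>y\<^sub>0\<close>.
  Transport is injective, which leaves the question whether \<eta> lies in \<open>N\<close>.\<close>

lemma monodromy_eq_iff:
  assumes \<gamma>: "\<gamma> \<in> carrier \<Gamma>" and \<delta>: "\<delta> \<in> carrier \<Gamma>"
  shows "monodromy \<gamma> = monodromy \<delta> \<longleftrightarrow> N #>\<^bsub>\<Gamma>\<^esub> \<gamma> = N #>\<^bsub>\<Gamma>\<^esub> \<delta>"
proof -
  interpret G: group \<Gamma> by (rule group_N(2))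
  define \<eta> where "\<eta> = \<gamma> \<otimes>\<^bsub>\<Gamma>\<^esub> inv\<^bsub>\<Gamma>\<^esub> \<delta>"
  have \<eta>: "\<eta> \<in> carrier \<Gamma>" "\<gamma> = \<eta> \<otimes>\<^bsub>\<Gamma>\<^esub> \<delta>" using \<gamma> \<delta> by (auto simp: \<eta>_def G.m_assoc)
  obtain d where d0: "d \<in> loops_at X x\<^sub>0" and d: "d \<in> \<delta>" using \<delta> by (rule fundamental_groupE)
  have dX: "pathin X d" "d 0 = x\<^sub>0" using d0 by (simp_all add: loops_at_def)
  have 1: "monodromy \<gamma> = lift_end Y q (monodromy \<eta>) d" using monodromy_mult[OF \<eta>(1) \<delta> d] \<eta>(2) by simp
  have 2: "monodromy \<delta> = lift_end Y q y\<^sub>0 d" by (rule monodromy_eq[OF \<delta> d])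
  have "monodromy \<gamma> = monodromy \<delta> \<longleftrightarrow> monodromy \<eta> = y\<^sub>0"
    using 1 2 lift_end_inj[OF dX(1), of "monodromy \<eta>" y\<^sub>0] monodromy_in_fibre[OF \<eta>(1)] y0 dX by auto
  also have "\<dots> \<longleftrightarrow> \<eta> \<in> N" by (rule monodromy_base_iff[OF \<eta>(1)])
  also have "\<dots> \<longleftrightarrow> N #>\<^bsub>\<Gamma>\<^esub> \<gamma> = N #>\<^bsub>\<Gamma>\<^esub> \<delta>"
  proof
    assume "\<eta> \<in> N"
    have "N #>\<^bsub>\<Gamma>\<^esub> \<eta> = N" using \<open>\<eta> \<in> N\<close> \<eta>(1) group_N(1) by (simp add: G.coset_join2)
    then show "N #>\<^bsub>\<Gamma>\<^esub> \<gamma> = N #>\<^bsub>\<Gamma>\<^esub> \<delta>"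
      using \<eta>(2) \<delta> group_N(1) by (metis G.coset_join2 G.coset_mult_assoc \<eta>(1) subgroup.subset)
  next
    assume "N #>\<^bsub>\<Gamma>\<^esub> \<gamma> = N #>\<^bsub>\<Gamma>\<^esub> \<delta>"
    then have "\<gamma> \<in> N #>\<^bsub>\<Gamma>\<^esub> \<delta>" using G.rcos_self[OF \<gamma> group_N(1)] by simp
    then obtain n where n: "n \<in> N" "\<gamma> = n \<otimes>\<^bsub>\<Gamma>\<^esub> \<delta>" by (auto simp: r_coset_def)
    then have "n \<in> carrier \<Gamma>" using subgroup.subset[OF group_N(1)] by blast
    then have "\<eta> = n" unfolding \<eta>_def n(2) using \<delta> by (simp add: G.m_assoc)
    then show "\<eta> \<in> N" using n by simp
  qed
  finally show ?thesis .
qed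

text \<open>The sheet is fixed at vertex 0: first \<gamma> is lifted from \<open>y\<^sub>0\<close>,
  then the chosen path to that vertex.\<close>

definition simplex_of :: "nat \<Rightarrow> ((nat \<Rightarrow> real) \<Rightarrow> 'a) \<times> (real \<Rightarrow> 'a) set \<Rightarrow> (nat \<Rightarrow> real) \<Rightarrow> 'b" where
  "simplex_of n s = (SOME \<tau>. singular_simplex n Y \<tau> \<and> (\<forall>t\<in>standard_simplex n. q (\<tau> t) = fst s t) \<and>
     \<tau> (std_vertex 0) = lift_end Y q (monodromy (snd s)) (\<alpha> (fst s (std_vertex 0))))"

lemma alpha:
  assumes "x \<in> topspace X" shows "pathin X (\<alpha> x)" "\<alpha> x 0 = x\<^sub>0" "\<alpha> x 1 = x"
  using \<alpha> assms by (auto simp: base_paths_def)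

lemma simplex_of:
  assumes \<sigma>: "singular_simplex n X \<sigma>" and \<gamma>: "\<gamma> \<in> carrier \<Gamma>"
  shows "singular_simplex n Y (simplex_of n (\<sigma>, \<gamma>))"
    and "\<And>t. t \<in> standard_simplex n \<Longrightarrow> q (simplex_of n (\<sigma>, \<gamma>) t) = \<sigma> t"
    and "simplex_of n (\<sigma>, \<gamma>) (std_vertex 0) = lift_end Y q (monodromy \<gamma>) (\<alpha> (\<sigma> (std_vertex 0)))"
proof -
  let ?x = "\<sigma> (std_vertex 0)"
  have x: "?x \<in> topspace X" using singular_simplex_in_topspace[OF \<sigma>] by simp
  let ?y = "lift_end Y q (monodromy \<gamma>) (\<alpha> ?x)"
  have y: "?y \<in> topspace Y" "q ?y = ?x"
    using lift_end_props[of "\<alpha> ?x" "monodromy \<gamma>"] alpha[OF x] monodromy_in_fibre[OF \<gamma>] by auto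
  have "\<exists>\<tau>. singular_simplex n Y \<tau> \<and> (\<forall>t\<in>standard_simplex n. q (\<tau> t) = fst (\<sigma>, \<gamma>) t) \<and>
     \<tau> (std_vertex 0) = lift_end Y q (monodromy (snd (\<sigma>, \<gamma>))) (\<alpha> (fst (\<sigma>, \<gamma>) (std_vertex 0)))"
    using simplex_lift_exists[OF \<sigma> _ y] by simp
  from someI_ex[OF this]
  show "singular_simplex n Y (simplex_of n (\<sigma>, \<gamma>))"
    and "\<And>t. t \<in> standard_simplex n \<Longrightarrow> q (simplex_of n (\<sigma>, \<gamma>) t) = \<sigma> t"
    and "simplex_of n (\<sigma>, \<gamma>) (std_vertex 0) = lift_end Y q (monodromy \<gamma>) (\<alpha> (\<sigma> (std_vertex 0)))"
    unfolding simplex_of_def by auto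
qed

lemma simplex_of_eqI:
  assumes \<sigma>: "singular_simplex n X \<sigma>" and \<gamma>: "\<gamma> \<in> carrier \<Gamma>" and \<tau>: "singular_simplex n Y \<tau>"
    and "\<And>t. t \<in> standard_simplex n \<Longrightarrow> q (\<tau> t) = \<sigma> t"
    and "\<tau> (std_vertex 0) = lift_end Y q (monodromy \<gamma>) (\<alpha> (\<sigma> (std_vertex 0)))"
  shows "simplex_of n (\<sigma>, \<gamma>) = \<tau>"
  by (rule simplex_lift_unique[OF simplex_of(1)[OF \<sigma> \<gamma>] \<tau>, where v = "std_vertex 0"])
    (use simplex_of(2,3)[OF \<sigma> \<gamma>] assms(4,5) in auto)

lemma simplex_of_eq_iff:
  assumes \<sigma>: "singular_simplex n X \<sigma>" and \<gamma>: "\<gamma> \<in> carrier \<Gamma>"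
    and \<sigma>': "singular_simplex n X \<sigma>'" and \<gamma>': "\<gamma>' \<in> carrier \<Gamma>"
  shows "simplex_of n (\<sigma>, \<gamma>) = simplex_of n (\<sigma>', \<gamma>') \<longleftrightarrow> \<sigma> = \<sigma>' \<and> N #>\<^bsub>\<Gamma>\<^esub> \<gamma> = N #>\<^bsub>\<Gamma>\<^esub> \<gamma>'"
proof
  assume eq: "simplex_of n (\<sigma>, \<gamma>) = simplex_of n (\<sigma>', \<gamma>')"
  have "\<sigma> = \<sigma>'"
  proof (rule extensionalityI[of _ "standard_simplex n"])
    show "\<sigma> t = \<sigma>' t" if "t \<in> standard_simplex n" for t
      using simplex_of(2)[OF \<sigma> \<gamma> that] simplex_of(2)[OF \<sigma>' \<gamma>' that] eq by simp
  qed (use \<sigma> \<sigma>' in \<open>auto simp: singular_simplex_def\<close>)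
  have x: "\<sigma> (std_vertex 0) \<in> topspace X" using singular_simplex_in_topspace[OF \<sigma>] by simp
  have "lift_end Y q (monodromy \<gamma>) (\<alpha> (\<sigma> (std_vertex 0))) = lift_end Y q (monodromy \<gamma>') (\<alpha> (\<sigma> (std_vertex 0)))"
    using simplex_of(3)[OF \<sigma> \<gamma>] simplex_of(3)[OF \<sigma>' \<gamma>'] eq \<open>\<sigma> = \<sigma>'\<close> by simp
  then have "monodromy \<gamma> = monodromy \<gamma>'"
    using lift_end_inj[OF alpha(1)[OF x]] alpha(2)[OF x] monodromy_in_fibre[OF \<gamma>] monodromy_in_fibre[OF \<gamma>'] by auto
  then show "\<sigma> = \<sigma>' \<and> N #>\<^bsub>\<Gamma>\<^esub> \<gamma> = N #>\<^bsub>\<Gamma>\<^esub> \<gamma>'" using \<open>\<sigma> = \<sigma>'\<close> monodromy_eq_iff[OF \<gamma> \<gamma>'] by simp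
next
  assume h: "\<sigma> = \<sigma>' \<and> N #>\<^bsub>\<Gamma>\<^esub> \<gamma> = N #>\<^bsub>\<Gamma>\<^esub> \<gamma>'"
  then have "monodromy \<gamma> = monodromy \<gamma>'" using monodromy_eq_iff[OF \<gamma> \<gamma>'] by simp
  then show "simplex_of n (\<sigma>, \<gamma>) = simplex_of n (\<sigma>', \<gamma>')"
    using h by (simp add: simplex_of_def)
qed

lemma simplex_of_surj:
  assumes \<tau>: "singular_simplex n Y \<tau>"
  shows "\<exists>\<sigma> \<gamma>. singular_simplex n X \<sigma> \<and> \<gamma> \<in> carrier \<Gamma> \<and> simplex_of n (\<sigma>, \<gamma>) = \<tau>"
proof -
  have c: "continuous_map Y X q" by (rule covering_map_continuous[OF cov])
  define \<sigma> where "\<sigma> = simplex_map n q \<tau>"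
  have \<sigma>: "singular_simplex n X \<sigma>" unfolding \<sigma>_def by (rule singular_simplex_simplex_map[OF \<tau> c])
  have \<sigma>t: "q (\<tau> t) = \<sigma> t" if "t \<in> standard_simplex n" for t using that by (simp add: \<sigma>_def simplex_map_def)
  let ?y = "\<tau> (std_vertex 0)" and ?x = "\<sigma> (std_vertex 0)"
  have y: "?y \<in> topspace Y" "q ?y = ?x" using singular_simplex_in_topspace[OF \<tau>] \<sigma>t by auto
  have x: "?x \<in> topspace X" using singular_simplex_in_topspace[OF \<sigma>] by simp
  \<comment> \<open>A path from \<open>y\<^sub>0\<close> to vertex 0 of \<tau>, projected and closed
    up by the reversed base path, is the loop that names the sheet of \<tau>. Path-connectedness of
    the cover makes every simplex reachable.\<close>
  obtain h where h: "pathin Y h" "h 0 = y\<^sub>0" "h 1 = ?y"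
    using path_conn y0(1) y(1) unfolding path_connected_space_def by blast
  have qh: "pathin X (q \<circ> h)" using h c pathin_compose[of Y h X q] by simp
  have r: "pathin X (\<lambda>t. \<alpha> ?x (1 - t))" using alpha[OF x] pathin_reverse by blast
  define f where "f = path_join (q \<circ> h) (\<lambda>t. \<alpha> ?x (1 - t))"
  have f: "f \<in> loops_at X x\<^sub>0"
    using qh r h y y0 alpha[OF x] by (auto simp: f_def loops_at_def intro!: pathin_path_join)
  define \<gamma> where "\<gamma> = loop_class X x\<^sub>0 f"
  have \<gamma>: "\<gamma> \<in> carrier \<Gamma>" "f \<in> \<gamma>" using f loop_class_self by (auto simp: \<gamma>_def carrier_fundamental_group)
  have "monodromy \<gamma> = lift_end Y q y\<^sub>0 f" by (rule monodromy_eq[OF \<gamma>])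
  also have "\<dots> = lift_end Y q (lift_end Y q y\<^sub>0 (q \<circ> h)) (\<lambda>t. \<alpha> ?x (1 - t))"
    unfolding f_def using qh r h y y0 alpha[OF x] by (intro lift_end_join) auto
  also have "lift_end Y q y\<^sub>0 (q \<circ> h) = ?y"
    using lift_end_eq[of y\<^sub>0 "q \<circ> h" h] h by (simp add: path_lift_def)
  finally have "monodromy \<gamma> = lift_end Y q ?y (\<lambda>t. \<alpha> ?x (1 - t))" .
  moreover have "lift_end Y q (lift_end Y q ?y (\<lambda>t. \<alpha> ?x (1 - t))) (\<alpha> ?x) = ?y"
    using lift_end_reverse[OF r y(1)] y(2) alpha[OF x] by simp
  ultimately have "simplex_of n (\<sigma>, \<gamma>) = \<tau>"
    using \<sigma>t by (intro simplex_of_eqI[OF \<sigma> \<gamma>(1) \<tau>]) auto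
  then show ?thesis using \<sigma> \<gamma> by blast
qed

text \<open>Faces with j > 0 keep vertex 0 and therefore the sheet. For j = 0 the new initial vertex
  is reached by lifting the base path and then the first edge; the return leg of the edge loop
  cancels against the base path of the new vertex.\<close>

lemma singular_face_simplex_of:
  assumes \<sigma>: "singular_simplex n X \<sigma>" and \<gamma>: "\<gamma> \<in> carrier \<Gamma>" and n: "n \<ge> 1" "j \<le> n"
  shows "singular_face n j (simplex_of n (\<sigma>, \<gamma>)) =
    simplex_of (n - 1) (singular_face n j \<sigma>, \<gamma> \<otimes>\<^bsub>\<Gamma>\<^esub> face_label X x\<^sub>0 \<alpha> j \<sigma>)"
proof -
  interpret G: group \<Gamma> by (rule group_N(2))
  let ?\<tau> = "simplex_of n (\<sigma>, \<gamma>)"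
  note \<tau> = simplex_of[OF \<sigma> \<gamma>]
  have lab: "face_label X x\<^sub>0 \<alpha> j \<sigma> \<in> carrier \<Gamma>"
    using loop_class_in_carrier[OF edge_loop_in_loops_at[OF \<alpha> \<sigma> n(1)]] by (simp add: face_label_def)
  then have \<gamma>': "\<gamma> \<otimes>\<^bsub>\<Gamma>\<^esub> face_label X x\<^sub>0 \<alpha> j \<sigma> \<in> carrier \<Gamma>" using \<gamma> by simp
  have fs: "singular_simplex (n - 1) X (singular_face n j \<sigma>)" "singular_simplex (n - 1) Y (singular_face n j ?\<tau>)"
    using singular_simplex_singular_face[OF \<sigma> n] singular_simplex_singular_face[OF \<tau>(1) n] by simp_all
  have sf: "simplical_face j t \<in> standard_simplex n" if "t \<in> standard_simplex (n - 1)" for t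
    using simplical_face_in_standard_simplex[OF n, of t] that by simp
  note face = singular_face_apply[where n = n and j = j]
  \<comment> \<open>\<open>simplical_face j\<close> inserts a 0 at position \<open>j\<close>, so it
    moves vertex 0 only for j = 0.\<close>
  have v: "simplical_face j (std_vertex 0) = std_vertex (if j = 0 then 1 else 0)"
    by (auto simp: simplical_face_def std_vertex_def fun_eq_iff)
  have "singular_face n j ?\<tau> (std_vertex 0) =
     lift_end Y q (monodromy (\<gamma> \<otimes>\<^bsub>\<Gamma>\<^esub> face_label X x\<^sub>0 \<alpha> j \<sigma>)) (\<alpha> (singular_face n j \<sigma> (std_vertex 0)))"
  proof (cases "j = 0")
    case False
    then show ?thesis using \<tau>(3) \<gamma> by (simp add: face v face_label_def)
  next
    case True
    let ?x = "\<sigma> (std_vertex 0)" and ?x' = "\<sigma> (std_vertex 1)" and ?e = "first_edge \<sigma>"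
    let ?r = "\<lambda>t. \<alpha> ?x' (1 - t)"
    have x: "?x \<in> topspace X" "?x' \<in> topspace X" using singular_simplex_in_topspace[OF \<sigma>] n by auto
    note a = alpha[OF x(1)] and a' = alpha[OF x(2)]
    have e: "pathin X ?e" by (rule pathin_first_edge[OF \<sigma> n(1)])
    have r: "pathin X ?r" using a' pathin_reverse by blast
    note m = monodromy_in_fibre[OF \<gamma>]
    let ?y = "lift_end Y q (monodromy \<gamma>) (\<alpha> ?x)"
    have y: "?y \<in> topspace Y" "q ?y = ?x" using lift_end_props[OF a(1) m(1)] m(2) a by auto
    let ?y' = "lift_end Y q ?y ?e"
    have y': "?y' \<in> topspace Y" "q ?y' = ?x'" using lift_end_props[OF e y(1)] y(2) by auto
    have "monodromy (\<gamma> \<otimes>\<^bsub>\<Gamma>\<^esub> face_label X x\<^sub>0 \<alpha> j \<sigma>) = lift_end Y q (monodromy \<gamma>) (edge_loop \<alpha> \<sigma>)"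
      using True edge_loop_in_loops_at[OF \<alpha> \<sigma> n(1)] loop_class_self
      by (intro monodromy_mult[OF \<gamma> lab]) (auto simp: face_label_def)
    also have "\<dots> = lift_end Y q (lift_end Y q (monodromy \<gamma>) (path_join (\<alpha> ?x) ?e)) ?r"
      unfolding edge_loop_def using a a' e r m by (intro lift_end_join pathin_path_join) auto
    also have "lift_end Y q (monodromy \<gamma>) (path_join (\<alpha> ?x) ?e) = ?y'"
      using a e m by (intro lift_end_join) auto
    finally have "lift_end Y q (monodromy (\<gamma> \<otimes>\<^bsub>\<Gamma>\<^esub> face_label X x\<^sub>0 \<alpha> j \<sigma>)) (\<alpha> ?x') = ?y'"
      using lift_end_reverse[OF r y'(1)] y'(2) a' by simp
    moreover have "?y' = ?\<tau> (std_vertex 1)"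
    proof -
      have "path_lift Y q ?y ?e (first_edge ?\<tau>)"
        using pathin_first_edge[OF \<tau>(1) n(1)] \<tau>(2,3) n(1)
        by (auto simp: path_lift_def first_edge_def intro!: \<tau>(2) convex_standard_simplex)
      from lift_end_eq[OF this] show ?thesis by simp
    qed
    moreover have "std_vertex 0 \<in> standard_simplex (n - 1)" by simp
    note face[OF this, of ?\<tau>] face[OF this, of \<sigma>]
    moreover have "simplical_face 0 (std_vertex 0) = std_vertex 1" using v True by simp
    ultimately show ?thesis using True by simp
  qed
  moreover have "q (singular_face n j ?\<tau> t) = singular_face n j \<sigma> t" if "t \<in> standard_simplex (n - 1)" for t
    using that \<tau>(2)[OF sf[OF that]] by (simp add: face)
  ultimately show ?thesis
    using simplex_of_eqI[OF fs(1) \<gamma>' fs(2)] by simp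
qed

end

section \<open>Complexes of simplices with coefficients in a field\<close>

abbreviation psmul :: "'k::field \<Rightarrow> ('s \<Rightarrow>\<^sub>0 'k) \<Rightarrow> ('s \<Rightarrow>\<^sub>0 'k)" where
  "psmul a \<equiv> Poly_Mapping.map ((*) a)"

lemma lookup_psmul [simp]: "Poly_Mapping.lookup (psmul a c) s = a * Poly_Mapping.lookup c s"
  by (simp add: Poly_Mapping.map.rep_eq when_def)

interpretation pm: vector_space psmul
  by unfold_locales (auto intro!: poly_mapping_eqI simp: lookup_add algebra_simps)

definition plin :: "(('s \<Rightarrow>\<^sub>0 'k::field) \<Rightarrow> ('t \<Rightarrow>\<^sub>0 'k)) \<Rightarrow> bool" where
  "plin F \<longleftrightarrow> (\<forall>a b. F (a + b) = F a + F b) \<and> (\<forall>r a. F (psmul r a) = psmul r (F a))"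

lemma plinD:
  assumes "plin F"
  shows plin_add: "F (a + b) = F a + F b" and plin_smul: "F (psmul r a) = psmul r (F a)"
  using assms by (auto simp: plin_def)

lemma plin_0: "plin F \<Longrightarrow> F 0 = 0"
  using plin_add[of F 0 0] by simp

lemma plin_diff: "plin F \<Longrightarrow> F (a - b) = F a - F b"
  using plin_add[of F "a - b" b] by simp

lemma plin_sum: "plin F \<Longrightarrow> F (sum f I) = (\<Sum>i\<in>I. F (f i))"
  by (induction I rule: infinite_finite_induct) (auto simp: plin_0 plin_add)

lemma plin_compose: "plin F \<Longrightarrow> plin G \<Longrightarrow> plin (\<lambda>c. F (G c))"
  by (simp add: plin_def)

lemma plin_sum_fun: "(\<And>i. plin (F i)) \<Longrightarrow> plin (\<lambda>c. \<Sum>i\<in>I. F i c)"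
  by (simp add: plin_def sum.distrib pm.scale_sum_right)

lemma plin_ident: "plin (\<lambda>c. c)"
  by (simp add: plin_def)

lemma plin_minus: "plin F \<Longrightarrow> plin G \<Longrightarrow> plin (\<lambda>c. F c - G c)"
  by (simp add: plin_def pm.scale_right_diff_distrib)

lemma plin_funpow:
  fixes F :: "('s \<Rightarrow>\<^sub>0 'k::field) \<Rightarrow> ('s \<Rightarrow>\<^sub>0 'k)"
  shows "plin F \<Longrightarrow> plin (F ^^ j)"
  by (induction j) (auto simp: plin_def)

lemma plin_span:
  assumes F: "plin F" and x: "x \<in> pm.span A"
  shows "F x \<in> pm.span (F ` A)"
  using x
proof (induction rule: pm.span_induct_alt)
  case base
  then show ?case by (simp add: plin_0[OF F] pm.span_zero)
next
  case (step c x y)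
  then show ?case by (simp add: plin_add[OF F] plin_smul[OF F] pm.span_add pm.span_scale pm.span_base)
qed

lemma plin_subspace_image: "plin F \<Longrightarrow> pm.subspace A \<Longrightarrow> pm.subspace (F ` A)"
  unfolding pm.subspace_def using plin_0[of F] plin_add[of F] plin_smul[of F]
  by (auto simp: image_iff) metis+

lemma plin_subspace_vimage: "plin F \<Longrightarrow> pm.subspace A \<Longrightarrow> pm.subspace {c. F c \<in> A}"
  by (auto simp: pm.subspace_def plin_0 plin_add plin_smul)

lemma plin_subspace_kernel: "plin F \<Longrightarrow> pm.subspace {c. F c = 0}"
  by (auto simp: pm.subspace_def plin_0 plin_add plin_smul)

definition lin :: "('s \<Rightarrow> 't \<Rightarrow>\<^sub>0 'k::field) \<Rightarrow> ('s \<Rightarrow>\<^sub>0 'k) \<Rightarrow> ('t \<Rightarrow>\<^sub>0 'k)" where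
  "lin \<phi> c = (\<Sum>s\<in>Poly_Mapping.keys c. psmul (Poly_Mapping.lookup c s) (\<phi> s))"

lemma lin_superset:
  assumes "finite A" "Poly_Mapping.keys c \<subseteq> A"
  shows "lin \<phi> c = (\<Sum>s\<in>A. psmul (Poly_Mapping.lookup c s) (\<phi> s))"
  unfolding lin_def using assms
  by (intro sum.mono_neutral_left) (auto simp: in_keys_iff)

lemma plin_lin: "plin (lin \<phi>)"
  unfolding plin_def
proof (intro conjI allI)
  fix a b :: "'a \<Rightarrow>\<^sub>0 'b"
  let ?A = "Poly_Mapping.keys a \<union> Poly_Mapping.keys b"
  have "Poly_Mapping.keys (a + b) \<subseteq> ?A" by (rule keys_add)
  then show "lin \<phi> (a + b) = lin \<phi> a + lin \<phi> b"
    by (simp add: lin_superset[of ?A] lookup_add pm.scale_left_distrib sum.distrib)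
next
  fix r and a :: "'a \<Rightarrow>\<^sub>0 'b"
  have "Poly_Mapping.keys (psmul r a) \<subseteq> Poly_Mapping.keys a" by (auto simp: in_keys_iff)
  then show "lin \<phi> (psmul r a) = psmul r (lin \<phi> a)"
    by (simp add: lin_superset[of "Poly_Mapping.keys a"] pm.scale_sum_right)
qed

lemma lin_single [simp]: "lin \<phi> (Poly_Mapping.single s 1) = \<phi> s"
  by (simp add: lin_def)

definition chains_on :: "'s set \<Rightarrow> ('s \<Rightarrow>\<^sub>0 'k::field) set" where
  "chains_on A = {c. Poly_Mapping.keys c \<subseteq> A}"

lemma poly_mapping_expand: "c = (\<Sum>s\<in>Poly_Mapping.keys c. psmul (Poly_Mapping.lookup c s) (Poly_Mapping.single s 1))"
proof (rule poly_mapping_eqI)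
  fix t
  show "Poly_Mapping.lookup c t = Poly_Mapping.lookup (\<Sum>s\<in>Poly_Mapping.keys c. psmul (Poly_Mapping.lookup c s) (Poly_Mapping.single s 1)) t"
    by (simp add: lookup_sum lookup_single when_def if_distrib in_keys_iff cong: if_cong)
qed

lemma plin_expand:
  assumes F: "plin F"
  shows "F c = (\<Sum>s\<in>Poly_Mapping.keys c. psmul (Poly_Mapping.lookup c s) (F (Poly_Mapping.single s 1)))"
proof -
  have "F c = F (\<Sum>s\<in>Poly_Mapping.keys c. psmul (Poly_Mapping.lookup c s) (Poly_Mapping.single s 1))"
    by (rule arg_cong[OF poly_mapping_expand])
  then show ?thesis by (simp only: plin_sum[OF F] plin_smul[OF F])
qed

lemma plin_eqI:
  assumes F: "plin F" and G: "plin G" and eq: "\<And>s. s \<in> Poly_Mapping.keys c \<Longrightarrow> F (Poly_Mapping.single s 1) = G (Poly_Mapping.single s 1)"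
  shows "F c = G c"
  unfolding plin_expand[OF F, of c] plin_expand[OF G, of c] using eq by simp

lemma subspace_chains: "pm.subspace (chains_on A)"
  unfolding pm.subspace_def chains_on_def
  by (auto simp: subset_iff in_keys_iff lookup_add) (metis add.right_neutral)

lemma chains_single [simp]: "s \<in> A \<Longrightarrow> Poly_Mapping.single s a \<in> chains_on A"
  by (simp add: chains_on_def)

lemma plin_in_subspace:
  assumes F: "plin F" and B: "pm.subspace B" and "\<And>s. s \<in> A \<Longrightarrow> F (Poly_Mapping.single s 1) \<in> B" and "c \<in> chains_on A"
  shows "F c \<in> B"
proof -
  have "F c = (\<Sum>s\<in>Poly_Mapping.keys c. psmul (Poly_Mapping.lookup c s) (F (Poly_Mapping.single s 1)))"
    by (rule plin_expand[OF F])
  also have "\<dots> \<in> B"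
    using assms(3,4) by (intro pm.subspace_sum[OF B] pm.subspace_scale[OF B]) (auto simp: chains_on_def)
  finally show ?thesis .
qed

text \<open>Expresses that the image of \<open>Z\<close> in the quotient by the span of
  \<open>B\<close> has dimension at most \<open>m\<close>, also when \<open>Z\<close> and
  \<open>B\<close> are infinite-dimensional.\<close>

definition spans_mod :: "('s \<Rightarrow>\<^sub>0 'k::field) set \<Rightarrow> ('s \<Rightarrow>\<^sub>0 'k) set \<Rightarrow> nat \<Rightarrow> bool" where
  "spans_mod Z B m \<longleftrightarrow> (\<exists>T. finite T \<and> card T \<le> m \<and> T \<subseteq> Z \<and> Z \<subseteq> pm.span (T \<union> B))"

text \<open>The exchange lemma compares finite sets, while \<open>B\<close> and \<open>W\<close> may
  be infinite-dimensional. A basis \<open>b\<close> of \<open>B\<close> is extended to a basis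
  \<open>w\<close> of \<open>W\<close>; modulo \<open>T\<close>, finitely many elements of
  \<open>w - b\<close> involve only a finite part \<open>b1\<close> of \<open>b\<close>. Adjoining
  \<open>b1\<close> to both sides of the comparison bounds their number by that of
  \<open>T\<close>.\<close>

lemma spans_mod_subspace:
  assumes Z: "spans_mod Z B m" and W: "pm.subspace W" and B: "pm.subspace B" "B \<subseteq> W" "W \<subseteq> Z"
  shows "spans_mod W B m"
proof -
  obtain T where T: "finite T" "card T \<le> m" "Z \<subseteq> pm.span (T \<union> B)" using Z by (auto simp: spans_mod_def)
  obtain b where b: "b \<subseteq> B" "pm.independent b" "B \<subseteq> pm.span b"
    using pm.basis_exists[of B] by metis
  then obtain w where w: "b \<subseteq> w" "w \<subseteq> W" "pm.independent w" "W \<subseteq> pm.span w"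
    using pm.maximal_independent_subset_extend[of b W] B(2) by (metis subset_trans)
  have span_b: "pm.span (T \<union> b) = pm.span (T \<union> B)"
  proof
    show "pm.span (T \<union> b) \<subseteq> pm.span (T \<union> B)" using b(1) by (intro pm.span_mono) auto
    have "T \<union> B \<subseteq> pm.span (T \<union> b)"
      using b(3) pm.span_mono[of b "T \<union> b"] pm.span_superset[of "T \<union> b"] by auto
    then show "pm.span (T \<union> B) \<subseteq> pm.span (T \<union> b)" by (simp add: pm.span_minimal)
  qed
  have bound: "card F \<le> m" if F: "F \<subseteq> w - b" "finite F" for F
  proof -
    have "\<exists>b1. finite b1 \<and> b1 \<subseteq> b \<and> x \<in> pm.span (T \<union> b1)" if "x \<in> F" for x
    proof -
      have "x \<in> pm.span (T \<union> b)" using that F w(2) B(3) T(3) span_b by auto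
      then obtain t r where t: "finite t" "t \<subseteq> T \<union> b" and x: "x = (\<Sum>a\<in>t. psmul (r a) a)"
        unfolding pm.span_explicit by blast
      have "x \<in> pm.span t" unfolding x by (intro pm.span_sum pm.span_scale pm.span_base)
      have "t \<subseteq> T \<union> (t \<inter> b)" using t(2) by auto
      then have "x \<in> pm.span (T \<union> (t \<inter> b))" using \<open>x \<in> pm.span t\<close> by (rule subsetD[OF pm.span_mono])
      then show ?thesis using t(1) by (intro exI[of _ "t \<inter> b"]) auto
    qed
    then obtain g where g: "\<And>x. x \<in> F \<Longrightarrow> finite (g x) \<and> g x \<subseteq> b \<and> x \<in> pm.span (T \<union> g x)" by metis
    define b1 where "b1 = \<Union>(g ` F)"
    have b1: "finite b1" "b1 \<subseteq> b" using g F(2) by (auto simp: b1_def)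
    have "F \<union> b1 \<subseteq> pm.span (T \<union> b1)"
    proof
      fix x assume "x \<in> F \<union> b1"
      then show "x \<in> pm.span (T \<union> b1)"
      proof
        assume x: "x \<in> F"
        have "T \<union> g x \<subseteq> T \<union> b1" using x by (auto simp: b1_def)
        from pm.span_mono[OF this] show ?thesis using g[OF x] by (simp add: subset_iff)
      qed (simp add: pm.span_base)
    qed
    moreover have "pm.independent (F \<union> b1)"
      by (rule pm.independent_mono[OF w(3)]) (use w(1) F(1) b1(2) in blast)
    ultimately have "card (F \<union> b1) \<le> card (T \<union> b1)"
      using pm.independent_span_bound[of "T \<union> b1" "F \<union> b1"] T(1) b1(1) by auto
    also have "\<dots> \<le> card T + card b1" by (rule card_Un_le)
    finally have "card (F \<union> b1) \<le> m + card b1" using T(2) by linarith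
    moreover have "card (F \<union> b1) = card F + card b1"
      using F b1 by (intro card_Un_disjoint) auto
    ultimately show ?thesis by linarith
  qed
  have fin: "finite (w - b)"
  proof (rule ccontr)
    assume "infinite (w - b)"
    then obtain F where "F \<subseteq> w - b" "finite F" "card F = Suc m" using infinite_arbitrarily_large[of "w - b" "Suc m"] by blast
    then show False using bound[of F] by simp
  qed
  have "W \<subseteq> pm.span ((w - b) \<union> B)"
  proof -
    have "w \<subseteq> (w - b) \<union> B" using b(1) by auto
    then show ?thesis using w(4) pm.span_mono by blast
  qed
  then show ?thesis
    using fin bound[OF subset_refl fin] w(2) unfolding spans_mod_def
    by (intro exI[of _ "w - b"]) auto
qed

section \<open>Complexes given by graded sets with face operators\<close>

definition bdry :: "(nat \<Rightarrow> nat \<Rightarrow> 's \<Rightarrow> 's) \<Rightarrow> nat \<Rightarrow> ('s \<Rightarrow>\<^sub>0 'k::field) \<Rightarrow> ('s \<Rightarrow>\<^sub>0 'k)" where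
  "bdry d n c = (if n = 0 then 0 else lin (\<lambda>s. \<Sum>j\<le>n. Poly_Mapping.single (d n j s) ((-1) ^ j)) c)"

lemma plin_bdry: "plin (bdry d n)"
  by (cases "n = 0") (simp_all add: bdry_def[abs_def] plin_lin, simp add: plin_def)

definition cycles :: "(nat \<Rightarrow> 's set) \<Rightarrow> (nat \<Rightarrow> nat \<Rightarrow> 's \<Rightarrow> 's) \<Rightarrow> nat \<Rightarrow> ('s \<Rightarrow>\<^sub>0 'k::field) set" where
  "cycles S d n = {c \<in> chains_on (S n). bdry d n c = 0}"

definition bounds :: "(nat \<Rightarrow> 's set) \<Rightarrow> (nat \<Rightarrow> nat \<Rightarrow> 's \<Rightarrow> 's) \<Rightarrow> nat \<Rightarrow> ('s \<Rightarrow>\<^sub>0 'k::field) set" where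
  "bounds S d n = bdry d (Suc n) ` chains_on (S (Suc n))"

text \<open>Bounding homology by the size of a spanning set presupposes no finiteness of dimensions.\<close>

definition hom_le :: "'k::field itself \<Rightarrow> (nat \<Rightarrow> 's set) \<Rightarrow> (nat \<Rightarrow> nat \<Rightarrow> 's \<Rightarrow> 's) \<Rightarrow> nat \<Rightarrow> nat \<Rightarrow> bool" where
  "hom_le _ S d n m \<longleftrightarrow> spans_mod (cycles S d n :: ('s \<Rightarrow>\<^sub>0 'k) set) (bounds S d n) m"

lemma cycles_eq: "cycles S d n = chains_on (S n) \<inter> {c. bdry d n c = 0}"
  by (auto simp: cycles_def)

lemma subspace_cycles: "pm.subspace (cycles S d n)"
  unfolding cycles_eq by (rule pm.subspace_inter[OF subspace_chains plin_subspace_kernel[OF plin_bdry]])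

lemma subspace_bounds: "pm.subspace (bounds S d n)"
  unfolding bounds_def by (intro plin_subspace_image plin_bdry subspace_chains)

definition face_closed :: "(nat \<Rightarrow> 's set) \<Rightarrow> (nat \<Rightarrow> nat \<Rightarrow> 's \<Rightarrow> 's) \<Rightarrow> bool" where
  "face_closed S d \<longleftrightarrow> (\<forall>n j s. s \<in> S (Suc n) \<longrightarrow> j \<le> Suc n \<longrightarrow> d (Suc n) j s \<in> S n)"

lemma bdry_chains:
  assumes "face_closed S d" "c \<in> chains_on (S (Suc n))"
  shows "bdry d (Suc n) c \<in> chains_on (S n)"
proof (rule plin_in_subspace[OF plin_bdry subspace_chains _ assms(2)])
  fix s assume "s \<in> S (Suc n)"
  then show "bdry d (Suc n) (Poly_Mapping.single s 1) \<in> chains_on (S n)"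
    using assms(1) by (auto simp: bdry_def face_closed_def intro!: pm.subspace_sum[OF subspace_chains] simp del: sum.atMost_Suc)
qed

text \<open>That the boundary squares to zero is demanded directly, not through simplicial
  identities of the faces. In this form it passes along surjective face maps, to orbit complexes in
  particular.\<close>

definition chain_complex :: "'k::field itself \<Rightarrow> (nat \<Rightarrow> 's set) \<Rightarrow> (nat \<Rightarrow> nat \<Rightarrow> 's \<Rightarrow> 's) \<Rightarrow> bool" where
  "chain_complex _ S d \<longleftrightarrow> face_closed S d \<and>
     (\<forall>n. \<forall>c\<in>chains_on (S (Suc n)). bdry d n (bdry d (Suc n) c :: 's \<Rightarrow>\<^sub>0 'k) = 0)"

lemma bounds_subset_cycles:
  "chain_complex TYPE('k::field) S d \<Longrightarrow> (bounds S d n :: ('s \<Rightarrow>\<^sub>0 'k) set) \<subseteq> cycles S d n"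
  unfolding chain_complex_def bounds_def cycles_def using bdry_chains by blast

definition push :: "('s \<Rightarrow> 't) \<Rightarrow> ('s \<Rightarrow>\<^sub>0 'k::field) \<Rightarrow> ('t \<Rightarrow>\<^sub>0 'k)" where
  "push f = lin (\<lambda>s. Poly_Mapping.single (f s) 1)"

lemma plin_push: "plin (push f)" by (simp add: push_def plin_lin)

lemma push_single [simp]: "push f (Poly_Mapping.single s a) = Poly_Mapping.single (f s) a"
  by (cases "a = 0") (simp_all add: push_def lin_def)

lemma push_chains: "(\<And>s. s \<in> A \<Longrightarrow> f s \<in> B) \<Longrightarrow> c \<in> chains_on A \<Longrightarrow> push f c \<in> chains_on B"
  by (rule plin_in_subspace[OF plin_push subspace_chains]) auto

lemma push_bdry:
  assumes "\<And>s j. n > 0 \<Longrightarrow> s \<in> A \<Longrightarrow> j \<le> n \<Longrightarrow> f (d n j s) = d' n j (g s)" and c: "c \<in> chains_on A"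
  shows "push f (bdry d n c) = bdry d' n (push g c)"
proof (cases "n = 0")
  case True
  then show ?thesis by (simp add: bdry_def plin_0[OF plin_push])
next
  case False
  show ?thesis
  proof (rule plin_eqI[OF plin_compose[OF plin_push plin_bdry] plin_compose[OF plin_bdry plin_push]])
    fix s assume "s \<in> Poly_Mapping.keys c"
    then have "s \<in> A" using c by (auto simp: chains_on_def)
    then show "push f (bdry d n (Poly_Mapping.single s 1)) = bdry d' n (push g (Poly_Mapping.single s 1))"
      using False assms(1)
      by (simp add: bdry_def plin_sum[OF plin_push] del: sum.atMost_Suc)
  qed
qed

lemma push_push: "push f (push g c) = push (f \<circ> g) c"
  by (rule plin_eqI[OF plin_compose[OF plin_push plin_push] plin_push]) simp

lemma push_cong:
  assumes "\<And>s. s \<in> A \<Longrightarrow> f s = g s" "c \<in> chains_on A" shows "push f c = push g c"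
proof (rule plin_eqI[OF plin_push plin_push])
  fix s assume "s \<in> Poly_Mapping.keys c"
  then have "s \<in> A" using assms(2) by (auto simp: chains_on_def)
  then show "push f (Poly_Mapping.single s 1) = push g (Poly_Mapping.single s 1)" using assms(1) by simp
qed

lemma push_id: "push (\<lambda>s. s) c = c"
  by (rule plin_eqI[OF plin_push plin_ident]) simp

lemma push_surj:
  assumes "f ` A = B" "c \<in> chains_on B"
  obtains b where "b \<in> chains_on A" "push f b = c"
proof -
  define g where "g = inv_into A f"
  have g: "g t \<in> A" "f (g t) = t" if "t \<in> B" for t
    using that assms(1) by (auto simp: g_def inv_into_into f_inv_into_f)
  have "push f (push g c) = push (\<lambda>s. s) c"
    unfolding push_push by (rule push_cong[OF _ assms(2)]) (simp add: g(2))
  then show thesis using that[of "push g c"] push_chains[OF g(1) assms(2)] by (simp add: push_id)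
qed

text \<open>Surjectivity belongs to the notion so that every chain of the target lifts; the maps in
  question are bijections and orbit projections.\<close>

definition face_map ::
    "(nat \<Rightarrow> 's set) \<Rightarrow> (nat \<Rightarrow> nat \<Rightarrow> 's \<Rightarrow> 's) \<Rightarrow> (nat \<Rightarrow> 't set) \<Rightarrow> (nat \<Rightarrow> nat \<Rightarrow> 't \<Rightarrow> 't) \<Rightarrow> (nat \<Rightarrow> 's \<Rightarrow> 't) \<Rightarrow> bool" where
  "face_map S d S' d' f \<longleftrightarrow> (\<forall>n. f n ` S n = S' n) \<and>
     (\<forall>n j s. s \<in> S (Suc n) \<longrightarrow> j \<le> Suc n \<longrightarrow> f n (d (Suc n) j s) = d' (Suc n) j (f (Suc n) s))"

lemma face_map_image: "face_map S d S' d' f \<Longrightarrow> f n ` S n = S' n"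
  by (simp add: face_map_def)

lemma face_map_in: "face_map S d S' d' f \<Longrightarrow> s \<in> S n \<Longrightarrow> f n s \<in> S' n"
  by (auto simp: face_map_def)

lemma face_map_face: "face_map S d S' d' f \<Longrightarrow> s \<in> S (Suc n) \<Longrightarrow> j \<le> Suc n \<Longrightarrow> f n (d (Suc n) j s) = d' (Suc n) j (f (Suc n) s)"
  by (simp add: face_map_def)

lemma push_face_map:
  assumes "face_map S d S' d' f" "c \<in> chains_on (S n)"
  shows "push (f (n - 1)) (bdry d n c) = bdry d' n (push (f n) c)"
proof (rule push_bdry[OF _ assms(2)])
  fix s j assume "0 < n" "s \<in> S n" "j \<le> n"
  then show "f (n - 1) (d n j s) = d' n j (f n s)"
    using face_map_face[OF assms(1), of s "n - 1" j] by simp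
qed

lemma push_inj:
  assumes "inj_on f A" "c \<in> chains_on A" "c' \<in> chains_on A" "push f c = push f c'"
  shows "c = c'"
proof -
  have "push (inv_into A f) (push f c) = c" if "c \<in> chains_on A" for c :: "'a \<Rightarrow>\<^sub>0 'c"
  proof -
    have "push (inv_into A f) (push f c) = push (\<lambda>s. s) c"
      unfolding push_push by (rule push_cong[OF _ that]) (simp add: assms(1))
    then show ?thesis by (simp add: push_id)
  qed
  then show ?thesis using assms by metis
qed

lemma face_closed_image:
  assumes "face_closed S d" "face_map S d S' d' f" shows "face_closed S' d'"
  unfolding face_closed_def
proof (intro allI impI)
  fix n j s assume s: "s \<in> S' (Suc n)" "j \<le> Suc n"
  then obtain t where t: "t \<in> S (Suc n)" "s = f (Suc n) t" using face_map_image[OF assms(2), of "Suc n"] by blast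
  then have "d (Suc n) j t \<in> S n" using assms(1) s by (auto simp: face_closed_def)
  then show "d' (Suc n) j s \<in> S' n"
    using face_map_face[OF assms(2) t(1) s(2)] face_map_in[OF assms(2)] t(2) by metis
qed

lemma chain_complex_image:
  assumes S: "chain_complex TYPE('k::field) S d" and f: "face_map S d S' d' f"
  shows "chain_complex TYPE('k) S' d'"
  unfolding chain_complex_def
proof (intro conjI allI ballI)
  have fc: "face_closed S d" using S by (simp add: chain_complex_def)
  show "face_closed S' d'" by (rule face_closed_image[OF fc f])
  fix n and c :: "_ \<Rightarrow>\<^sub>0 'k" assume "c \<in> chains_on (S' (Suc n))"
  then obtain b where b: "b \<in> chains_on (S (Suc n))" "push (f (Suc n)) b = c"
    by (rule push_surj[OF face_map_image[OF f]])
  have "bdry d' n (bdry d' (Suc n) c) = push (f (n - 1)) (bdry d n (bdry d (Suc n) b))"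
    using push_face_map[OF f b(1)] push_face_map[OF f bdry_chains[OF fc b(1)]] b(2) by simp
  also have "bdry d n (bdry d (Suc n) b) = 0" using S b(1) by (simp add: chain_complex_def)
  finally show "bdry d' n (bdry d' (Suc n) c) = 0" by (simp add: plin_0[OF plin_push])
qed

lemma hom_le_bij_image:
  assumes fc: "face_closed S d" and f: "face_map S d S' d' f" and inj: "\<And>n. inj_on (f n) (S n)"
    and le: "hom_le TYPE('k::field) S d n m"
  shows "hom_le TYPE('k) S' d' n m"
proof -
  obtain T where T: "finite T" "card T \<le> m" "T \<subseteq> cycles S d n" "(cycles S d n :: (_ \<Rightarrow>\<^sub>0 'k) set) \<subseteq> pm.span (T \<union> bounds S d n)"
    using le by (auto simp: hom_le_def spans_mod_def)
  have bd: "push (f n) ` bounds S d n \<subseteq> (bounds S' d' n :: (_ \<Rightarrow>\<^sub>0 'k) set)"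
  proof
    fix x :: "_ \<Rightarrow>\<^sub>0 'k" assume "x \<in> push (f n) ` bounds S d n"
    then obtain c where c: "c \<in> chains_on (S (Suc n))" "x = push (f n) (bdry d (Suc n) c)" by (auto simp: bounds_def)
    have "x = bdry d' (Suc n) (push (f (Suc n)) c)" using push_face_map[OF f c(1)] c(2) by simp
    then show "x \<in> bounds S' d' n"
      unfolding bounds_def using push_chains[OF face_map_in[OF f] c(1)] by (rule image_eqI)
  qed
  have cyc: "push (f n) c \<in> cycles S' d' n" if c: "c \<in> cycles S d n" for c :: "_ \<Rightarrow>\<^sub>0 'k"
  proof -
    have cc: "c \<in> chains_on (S n)" "bdry d n c = 0" using c by (auto simp: cycles_def)
    show ?thesis using push_face_map[OF f cc(1)] push_chains[OF face_map_in[OF f] cc(1)] cc(2)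
      by (simp add: cycles_def plin_0[OF plin_push])
  qed
  have "(cycles S' d' n :: (_ \<Rightarrow>\<^sub>0 'k) set) \<subseteq> pm.span (push (f n) ` T \<union> bounds S' d' n)"
  proof
    fix c :: "_ \<Rightarrow>\<^sub>0 'k" assume c: "c \<in> cycles S' d' n"
    then have "c \<in> chains_on (S' n)" by (simp add: cycles_def)
    then obtain b where b: "b \<in> chains_on (S n)" "push (f n) b = c"
      by (rule push_surj[OF face_map_image[OF f]])
    have "bdry d n b = 0"
    proof (cases n)
      case 0
      then show ?thesis by (simp add: bdry_def)
    next
      case (Suc k)
      \<comment> \<open>Injectivity enters here: the preimage of a cycle is again a cycle, which
        fails for orbit projections.\<close>
      have "push (f k) (bdry d n b) = push (f k) 0"
        using push_face_map[OF f b(1)] c b(2) Suc by (simp add: cycles_def plin_0[OF plin_push])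
      moreover have "bdry d n b \<in> chains_on (S k)" using bdry_chains[OF fc] b(1) Suc by simp
      moreover have "0 \<in> chains_on (S k)" by (simp add: chains_on_def)
      ultimately show ?thesis using push_inj[OF inj] by blast
    qed
    then have "b \<in> pm.span (T \<union> bounds S d n)" using T(4) b(1) by (auto simp: cycles_def)
    from plin_span[OF plin_push this, of "f n"] have "c \<in> pm.span (push (f n) ` (T \<union> bounds S d n))"
      unfolding b(2) .
    moreover have "push (f n) ` (T \<union> bounds S d n) \<subseteq> push (f n) ` T \<union> bounds S' d' n" using bd by blast
    from pm.span_mono[OF this] have "pm.span (push (f n) ` (T \<union> bounds S d n)) \<subseteq> pm.span (push (f n) ` T \<union> bounds S' d' n)" .
    ultimately show "c \<in> pm.span (push (f n) ` T \<union> bounds S' d' n)" by (rule subsetD[rotated])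
  qed
  moreover have "card (push (f n) ` T) \<le> m" using card_image_le[OF T(1), of "push (f n)"] T(2) by linarith
  moreover have "push (f n) ` T \<subseteq> cycles S' d' n" using cyc T(3) by blast
  ultimately show ?thesis using T(1) unfolding hom_le_def spans_mod_def by blast
qed

lemma face_map_inv_into:
  assumes fc: "face_closed S d" and f: "face_map S d S' d' f" and inj: "\<And>n. inj_on (f n) (S n)"
  shows "face_map S' d' S d (\<lambda>n. inv_into (S n) (f n))"
  unfolding face_map_def
proof (intro conjI allI impI)
  have gf: "inv_into (S n) (f n) (f n s) = s" if "s \<in> S n" for n s using that inj by simp
  show "inv_into (S n) (f n) ` S' n = S n" for n
    unfolding face_map_image[OF f, symmetric] using gf by force
  fix n j s assume s: "s \<in> S' (Suc n)" "j \<le> Suc n"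
  then obtain t where t: "t \<in> S (Suc n)" "s = f (Suc n) t" using face_map_image[OF f, of "Suc n"] by blast
  have "d (Suc n) j t \<in> S n" using fc t s by (auto simp: face_closed_def)
  then show "inv_into (S n) (f n) (d' (Suc n) j s) = d (Suc n) j (inv_into (S (Suc n)) (f (Suc n)) s)"
    using face_map_face[OF f t(1) s(2)] t gf by metis
qed

lemma hom_le_bij_iff:
  assumes fc: "face_closed S d" and f: "face_map S d S' d' f" and inj: "\<And>n. inj_on (f n) (S n)"
  shows "hom_le TYPE('k::field) S d n m \<longleftrightarrow> hom_le TYPE('k) S' d' n m"
proof
  assume le: "hom_le TYPE('k) S' d' n m"
  have "inj_on (inv_into (S n) (f n)) (S' n)" for n
    unfolding face_map_image[OF f, symmetric] by (rule inj_on_inv_into) simp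
  then show "hom_le TYPE('k) S d n m"
    using hom_le_bij_image[OF face_closed_image[OF fc f] face_map_inv_into[OF fc f inj] _ le] by blast
qed (rule hom_le_bij_image[OF fc f inj])

section \<open>Quotients by a free cyclic action of prime order\<close>

text \<open>The quotient is any complex with a projection whose fibres are the orbits of
  \<open>z\<close>, not literally a set of orbits. In the induction over a p-group the upper complex
  already consists of orbits, and the lower one of orbits of a larger group.\<close>

locale cyclic_quotient =
  fixes S :: "nat \<Rightarrow> 's set" and d :: "nat \<Rightarrow> nat \<Rightarrow> 's \<Rightarrow> 's"
    and S' :: "nat \<Rightarrow> 't set" and d' :: "nat \<Rightarrow> nat \<Rightarrow> 't \<Rightarrow> 't"
    and \<pi> :: "nat \<Rightarrow> 's \<Rightarrow> 't" and z :: "'s \<Rightarrow> 's" and p :: nat and K :: "'k::field itself"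
  assumes cc: "chain_complex TYPE('k) S d" and fm: "face_map S d S' d' \<pi>"
    and char: "CHAR('k) = p" and prime: "prime p"
    and z_in: "\<And>n s. s \<in> S n \<Longrightarrow> z s \<in> S n"
    and z_face: "\<And>n j s. s \<in> S (Suc n) \<Longrightarrow> j \<le> Suc n \<Longrightarrow> z (d (Suc n) j s) = d (Suc n) j (z s)"
    and \<pi>_z: "\<And>n s. s \<in> S n \<Longrightarrow> \<pi> n (z s) = \<pi> n s"
    and z_p: "\<And>n s. s \<in> S n \<Longrightarrow> (z ^^ p) s = s"
    and fibre: "\<And>n s s'. s \<in> S n \<Longrightarrow> s' \<in> S n \<Longrightarrow> \<pi> n s = \<pi> n s' \<Longrightarrow> \<exists>i<p. s' = (z ^^ i) s"
    and free: "\<And>n s i. s \<in> S n \<Longrightarrow> 0 < i \<Longrightarrow> i < p \<Longrightarrow> (z ^^ i) s \<noteq> s"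
begin

abbreviation Ch :: "nat \<Rightarrow> ('s \<Rightarrow>\<^sub>0 'k) set" where "Ch n \<equiv> chains_on (S n)"
abbreviation bd :: "nat \<Rightarrow> ('s \<Rightarrow>\<^sub>0 'k) \<Rightarrow> ('s \<Rightarrow>\<^sub>0 'k)" where "bd \<equiv> bdry d"

text \<open>The group ring of the cyclic group acts on chains through polynomials in \<open>push z\<close>; \<open>U\<close> is \<open>z - 1\<close>.\<close>

definition U :: "('s \<Rightarrow>\<^sub>0 'k) \<Rightarrow> ('s \<Rightarrow>\<^sub>0 'k)" where "U c = push z c - c"

lemma p_pos: "p > 0" using prime by (simp add: prime_gt_0_nat)

lemma plin_U: "plin U"
  unfolding U_def[abs_def] by (intro plin_minus plin_push plin_ident)

lemma U_Ch: "c \<in> Ch n \<Longrightarrow> U c \<in> Ch n"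
  unfolding U_def by (intro pm.subspace_diff[OF subspace_chains] push_chains[OF z_in])

lemma Uj_Ch: "c \<in> Ch n \<Longrightarrow> (U ^^ j) c \<in> Ch n"
  by (induction j) (auto intro: U_Ch)

lemma U_bdry:
  assumes "c \<in> Ch n" shows "U (bd n c) = bd n (U c)"
proof -
  have "push z (bd n c) = bd n (push z c)"
  proof (rule push_bdry[OF _ assms])
    fix s j assume "0 < n" "s \<in> S n" "j \<le> n"
    then show "z (d n j s) = d n j (z s)" using z_face[of s "n - 1" j] by simp
  qed
  then show ?thesis by (simp add: U_def plin_diff[OF plin_bdry])
qed

lemma Uj_bdry: "c \<in> Ch n \<Longrightarrow> (U ^^ j) (bd n c) = bd n ((U ^^ j) c)"
  by (induction j) (auto simp: U_bdry Uj_Ch)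

lemma zi_in: "s \<in> S n \<Longrightarrow> (z ^^ i) s \<in> S n"
  by (induction i) (auto intro: z_in)

lemma \<pi>_zi: "s \<in> S n \<Longrightarrow> \<pi> n ((z ^^ i) s) = \<pi> n s"
  by (induction i) (auto simp: \<pi>_z zi_in)

text \<open>Evaluates a polynomial at the operator \<open>push z\<close>. Identities can thus be
  proved in the polynomial ring, an integral domain, and transferred to operators on chains.\<close>

definition act :: "'k poly \<Rightarrow> ('s \<Rightarrow>\<^sub>0 'k) \<Rightarrow> ('s \<Rightarrow>\<^sub>0 'k)" where
  "act f c = (\<Sum>i\<le>degree f. psmul (Polynomial.coeff f i) ((push z ^^ i) c))"

lemma act_bound:
  assumes "degree f \<le> N" shows "act f c = (\<Sum>i\<le>N. psmul (Polynomial.coeff f i) ((push z ^^ i) c))"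
  unfolding act_def using assms by (intro sum.mono_neutral_left) (auto simp: Polynomial.coeff_eq_0)

lemma act_pCons: "act (pCons a f) c = psmul a c + push z (act f c)"
proof -
  have "act (pCons a f) c = (\<Sum>i\<le>Suc (degree f). psmul (Polynomial.coeff (pCons a f) i) ((push z ^^ i) c))"
    by (rule act_bound) (rule degree_pCons_le)
  also have "\<dots> = psmul a c + (\<Sum>i\<le>degree f. psmul (Polynomial.coeff f i) (push z ((push z ^^ i) c)))"
    by (subst sum.atMost_Suc_shift) simp
  finally show ?thesis by (simp add: act_def plin_sum[OF plin_push] plin_smul[OF plin_push])
qed

lemma act_add: "act (f + g) c = act f c + act g c"
proof -
  let ?N = "max (degree f) (degree g)"
  have "degree (f + g) \<le> ?N" by (rule degree_add_le_max)
  then show ?thesis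
    by (simp add: act_bound[of _ ?N] pm.scale_left_distrib sum.distrib)
qed

lemma act_smult: "act (Polynomial.smult a f) c = psmul a (act f c)"
  using act_bound[OF degree_smult_le, of a f c] by (simp add: act_def pm.scale_sum_right)

lemma act_0 [simp]: "act 0 c = 0"
  by (simp add: act_def)

lemma act_mult: "act (f * g) c = act f (act g c)"
proof (induction f)
  case (pCons a f)
  then show ?case by (simp add: mult_pCons_left act_add act_smult act_pCons)
qed simp

lemma act_1: "act 1 c = c"
  by (simp add: one_pCons act_pCons plin_0[OF plin_push])

lemma act_sum: "finite I \<Longrightarrow> act (\<Sum>i\<in>I. f i) c = (\<Sum>i\<in>I. act (f i) c)"
  by (induction I rule: finite_induct) (auto simp: act_add)

lemma act_x: "act [:0, 1:] c = push z c"
  by (simp add: act_pCons plin_0[OF plin_push])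

lemma act_x_power: "act ([:0, 1:] ^ i) c = (push z ^^ i) c"
  by (induction i) (simp_all only: power_Suc act_mult power_0 act_1 act_x funpow.simps o_apply id_apply)

lemma act_U_power: "act ([:-1, 1:] ^ i) c = (U ^^ i) c"
proof -
  have "act [:-1, 1:] c = U c" for c by (simp add: act_pCons U_def plin_0[OF plin_push])
  then show ?thesis by (induction i) (simp_all only: power_Suc act_mult power_0 act_1 funpow.simps o_apply id_apply)
qed

lemma push_z_power: "(push z ^^ i) c = push (z ^^ i) c"
  by (induction i) (auto simp: push_push push_id o_def id_def)

text \<open>In characteristic p the p-th power map is additive. Since \<open>z\<close> has order p,
  it follows that \<open>U ^^ p\<close> vanishes on chains.\<close>

lemma x_minus_1_power_p: "([:-1, 1:] :: 'k poly) ^ p = [:0, 1:] ^ p - 1"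
proof -
  have c: "prime CHAR('k poly)" "p = CHAR('k poly)" using char prime by simp_all
  have "([:-1, 1:] + 1 :: 'k poly) ^ p = [:-1, 1:] ^ p + 1 ^ p"
    by (rule freshmans_dream[OF c])
  moreover have "([:-1, 1:] + 1 :: 'k poly) = [:0, 1:]" by (simp add: one_pCons)
  ultimately have "([:0, 1:] :: 'k poly) ^ p = [:-1, 1:] ^ p + 1" by simp
  then show ?thesis by simp
qed

text \<open>Multiplication by x - 1 turns both sides into x^p - 1. The factor can be cancelled in
  the polynomial ring but not in the group ring, where z - 1 is nilpotent.\<close>

lemma x_minus_1_power_p1: "([:-1, 1:] :: 'k poly) ^ (p - 1) = (\<Sum>i<p. [:0, 1:] ^ i)"
proof -
  let ?x = "[:0, 1:] :: 'k poly"
  have x: "[:-1, 1:] = ?x - 1" by (simp add: one_pCons)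
  have "[:-1, 1:] * (\<Sum>i<p. ?x ^ i) = ?x ^ p - 1"
    unfolding x by (rule power_diff_1_eq[symmetric])
  also have "\<dots> = [:-1, 1:] * [:-1, 1:] ^ (p - 1)"
    using x_minus_1_power_p power_Suc[of "[:-1, 1:] :: 'k poly" "p - 1"] p_pos by simp
  finally have *: "[:-1, 1:] * (\<Sum>i<p. ?x ^ i) = [:-1, 1:] * [:-1, 1:] ^ (p - 1)" .
  have "([:-1, 1:] :: 'k poly) \<noteq> 0" by simp
  from mult_left_cancel[OF this] * show ?thesis by metis
qed

lemma U_p:
  assumes "c \<in> Ch n" shows "(U ^^ p) c = 0"
proof -
  have "(U ^^ p) c = act ([:0, 1:] ^ p - 1) c"
    by (simp only: act_U_power[symmetric] x_minus_1_power_p[symmetric])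
  also have "\<dots> = push (z ^^ p) c - c"
    using act_add[of "[:0, 1:] ^ p - 1" 1 c] by (simp add: act_x_power act_1 push_z_power)
  also have "push (z ^^ p) c = push (\<lambda>s. s) c"
    by (rule push_cong[OF _ assms]) (rule z_p)
  finally show ?thesis by (simp add: push_id)
qed

lemma U_p1: "(U ^^ (p - 1)) c = (\<Sum>i<p. push (z ^^ i) c)"
  by (simp only: act_U_power[symmetric] x_minus_1_power_p1 act_sum[OF finite_lessThan] act_x_power push_z_power)

definition sec :: "nat \<Rightarrow> 't \<Rightarrow> 's" where "sec n = inv_into (S n) (\<pi> n)"

lemma sec: "t \<in> S' n \<Longrightarrow> sec n t \<in> S n" "t \<in> S' n \<Longrightarrow> \<pi> n (sec n t) = t"
  using face_map_image[OF fm, of n] by (auto simp: sec_def inv_into_into f_inv_into_f)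

lemma zi_inj:
  assumes "s \<in> S n" "i < p" "j < p" "(z ^^ i) s = (z ^^ j) s" shows "i = j"
proof -
  have *: "\<not> i < j" if "j < p" "(z ^^ i) s = (z ^^ j) s" for i j
  proof
    assume "i < j"
    then have "(z ^^ (j - i)) ((z ^^ i) s) = (z ^^ i) s"
    proof -
      have "(z ^^ (j - i)) ((z ^^ i) s) = (z ^^ (j - i + i)) s" by (simp only: funpow_add o_apply)
      then show ?thesis using that(2) \<open>i < j\<close> by simp
    qed
    then show False using free[OF zi_in[OF assms(1)], of "j - i" i] \<open>i < j\<close> that(1) by simp
  qed
  show ?thesis using *[of j i] *[of i j] assms by (metis linorder_neqE_nat)
qed

text \<open>\<open>U ^^ (p - 1)\<close> is summation over the group. Each orbit contains exactly one
  chosen representative, so the coefficient of the sum at that representative is the coefficient of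
  the projected chain; \<phi> reads it off.\<close>

lemma kernel_U_p1:
  assumes c: "c \<in> Ch n" and U: "(U ^^ (p - 1)) c = 0"
  shows "push (\<pi> n) c = 0"
proof -
  define \<phi> where "\<phi> s = (if s \<in> sec n ` S' n then Poly_Mapping.single (\<pi> n s) (1::'k) else 0)" for s
  have "lin \<phi> (\<Sum>i<p. push (z ^^ i) c) = push (\<pi> n) c"
  proof (rule plin_eqI[where c = c and F = "\<lambda>c. lin \<phi> (\<Sum>i<p. push (z ^^ i) c)"])
    show "plin (\<lambda>c. lin \<phi> (\<Sum>i<p. push (z ^^ i) c))"
      by (rule plin_compose[OF plin_lin plin_sum_fun[OF plin_push]])
    fix s assume "s \<in> Poly_Mapping.keys c"
    then have s: "s \<in> S n" using c by (auto simp: chains_on_def)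
    let ?r = "sec n (\<pi> n s)"
    have r: "?r \<in> S n" "\<pi> n ?r = \<pi> n s" using sec face_map_in[OF fm s] by auto
    obtain i where i: "i < p" "?r = (z ^^ i) s" using fibre[OF s r(1)] r(2) by auto
    have "\<phi> ((z ^^ j) s) = (if j = i then Poly_Mapping.single (\<pi> n s) 1 else 0)" if "j < p" for j
    proof -
      have "(z ^^ j) s \<in> sec n ` S' n \<longleftrightarrow> (z ^^ j) s = ?r"
      proof
        assume "(z ^^ j) s \<in> sec n ` S' n"
        then obtain t where t: "t \<in> S' n" "(z ^^ j) s = sec n t" by auto
        then have "t = \<pi> n s" using sec(2)[OF t(1)] \<pi>_zi[OF s, of j] by simp
        then show "(z ^^ j) s = ?r" using t(2) by simp
      next
        assume "(z ^^ j) s = ?r"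
        then show "(z ^^ j) s \<in> sec n ` S' n" using face_map_in[OF fm s] by simp
      qed
      also have "\<dots> \<longleftrightarrow> j = i" using zi_inj[OF s that i(1)] i(2) by auto
      finally show ?thesis by (simp add: \<phi>_def \<pi>_zi[OF s])
    qed
    then have "(\<Sum>j<p. \<phi> ((z ^^ j) s)) = (\<Sum>j<p. if j = i then Poly_Mapping.single (\<pi> n s) 1 else 0)"
      by (intro sum.cong) auto
    also have "\<dots> = Poly_Mapping.single (\<pi> n s) 1" using i(1) by simp
    finally show "lin \<phi> (\<Sum>i<p. push (z ^^ i) (Poly_Mapping.single s 1)) = push (\<pi> n) (Poly_Mapping.single s 1)"
      by (simp add: plin_sum[OF plin_lin])
  qed (rule plin_push)
  then show ?thesis using U unfolding U_p1 by (simp add: plin_0[OF plin_lin])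
qed

text \<open>Applying further powers of \<open>U\<close> reduces every exponent below p to p -
  1.\<close>

lemma kernel_Uj:
  assumes c: "c \<in> Ch n" and U: "(U ^^ j) c = 0" and j: "j < p"
  shows "push (\<pi> n) c = 0"
proof -
  have "(U ^^ (p - 1)) c = (U ^^ ((p - 1 - j) + j)) c" using j by simp
  also have "\<dots> = (U ^^ (p - 1 - j)) ((U ^^ j) c)" by (simp only: funpow_add o_apply)
  finally have "(U ^^ (p - 1)) c = (U ^^ (p - 1 - j)) ((U ^^ j) c)" .
  then have "(U ^^ (p - 1)) c = 0" using U plin_0[OF plin_funpow[OF plin_U]] by simp
  then show ?thesis by (rule kernel_U_p1[OF c])
qed

text \<open>A chain that dies in the quotient is a combination of differences between simplices
  \<open>s\<close> and their representatives \<open>r s\<close>. Such a difference is z^i - 1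
  applied to \<open>r s\<close>, and z^i - 1 is z - 1 times 1 + z + ... + z^(i-1); the second factor
  is encoded in \<beta>.\<close>

lemma kernel_push:
  assumes c: "c \<in> Ch n" and "push (\<pi> n) c = 0"
  obtains b where "b \<in> Ch n" "c = U b"
proof -
  define r where "r s = sec n (\<pi> n s)" for s
  define idx where "idx s = (SOME i. s = (z ^^ i) (r s))" for s
  have r: "r s \<in> S n" "s = (z ^^ idx s) (r s)" if s: "s \<in> S n" for s
  proof -
    have r: "r s \<in> S n" "\<pi> n (r s) = \<pi> n s" using sec face_map_in[OF fm s] by (auto simp: r_def)
    then show "r s \<in> S n" by simp
    have "\<exists>i. s = (z ^^ i) (r s)" using fibre[OF r(1) s r(2)] by blast
    then show "s = (z ^^ idx s) (r s)" unfolding idx_def by (rule someI_ex)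
  qed
  define \<beta> where "\<beta> s = (\<Sum>l<idx s. Poly_Mapping.single ((z ^^ l) (r s)) (1::'k))" for s
  have "U (lin \<beta> c) = c - push (sec n) (push (\<pi> n) c)"
  proof (rule plin_eqI[where c = c and F = "\<lambda>c. U (lin \<beta> c)"])
    show "plin (\<lambda>c. U (lin \<beta> c))" by (rule plin_compose[OF plin_U plin_lin])
    show "plin (\<lambda>c. c - push (sec n) (push (\<pi> n) c))"
      by (rule plin_minus[OF plin_ident plin_compose[OF plin_push plin_push]])
    fix s assume "s \<in> Poly_Mapping.keys c"
    then have s: "s \<in> S n" using c by (auto simp: chains_on_def)
    have "U (\<beta> s) = (\<Sum>l<idx s. Poly_Mapping.single ((z ^^ Suc l) (r s)) 1 - Poly_Mapping.single ((z ^^ l) (r s)) 1)"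
      by (simp add: \<beta>_def plin_sum[OF plin_push] U_def sum_subtractf)
    also have "\<dots> = Poly_Mapping.single ((z ^^ idx s) (r s)) 1 - Poly_Mapping.single ((z ^^ 0) (r s)) 1"
      by (rule sum_lessThan_telescope)
    also have "\<dots> = Poly_Mapping.single s 1 - Poly_Mapping.single (r s) 1" using r(2)[OF s] by simp
    finally show "U (lin \<beta> (Poly_Mapping.single s 1)) =
        Poly_Mapping.single s 1 - push (sec n) (push (\<pi> n) (Poly_Mapping.single s 1))"
      by (simp add: r_def)
  qed
  then have "c = U (lin \<beta> c)" using assms(2) by (simp add: plin_0[OF plin_push])
  moreover have "lin \<beta> c \<in> Ch n"
    by (rule plin_in_subspace[OF plin_lin subspace_chains _ c])
      (auto simp: \<beta>_def intro!: pm.subspace_sum[OF subspace_chains] chains_single zi_in r(1))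
  ultimately show thesis using that by blast
qed

text \<open>Multiplication by \<open>(z - 1)\<^sup>j\<close> identifies the \<open>j\<close>-th graded piece of the filtration by powers
  of \<open>z - 1\<close> with the complex of the quotient.\<close>

lemma filtration_step:
  assumes T: "hom_le TYPE('k) S' d' n m" and j: "j < p"
    and IH: "\<exists>A. finite A \<and> card A \<le> a \<and> A \<subseteq> cycles S d n \<inter> (U ^^ Suc j) ` Ch n \<and>
      cycles S d n \<inter> (U ^^ Suc j) ` Ch n \<subseteq> pm.span (A \<union> bd (Suc n) ` (U ^^ Suc j) ` Ch (Suc n))"
  shows "\<exists>A. finite A \<and> card A \<le> a + m \<and> A \<subseteq> cycles S d n \<inter> (U ^^ j) ` Ch n \<and>
      cycles S d n \<inter> (U ^^ j) ` Ch n \<subseteq> pm.span (A \<union> bd (Suc n) ` (U ^^ j) ` Ch (Suc n))"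
proof -
  let ?F = "\<lambda>j n. (U ^^ j) ` Ch n"
  have fc: "face_closed S d" using cc by (simp add: chain_complex_def)
  have bb: "bd n (bd (Suc n) c) = 0" if "c \<in> Ch (Suc n)" for c using cc that by (simp add: chain_complex_def)
  note pU = plin_funpow[OF plin_U, of j]
  note p\<pi> = plin_push[of "\<pi> n", where ?'b = 'k]
  \<comment> \<open>The chains whose multiple by \<open>U ^^ j\<close> is closed. Their images
    \<open>W\<close> lie between the boundaries and the cycles of the quotient but need not exhaust
    the cycles; this is where only an inequality results.\<close>
  define D where "D = {c \<in> Ch n. bd n ((U ^^ j) c) = 0}"
  have D_eq: "D = Ch n \<inter> {c. bd n ((U ^^ j) c) = 0}" by (auto simp: D_def)
  have sub_D: "pm.subspace D" unfolding D_eq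
    by (rule pm.subspace_inter[OF subspace_chains plin_subspace_kernel[OF plin_compose[OF plin_bdry pU]]])
  have \<pi>_bd: "push (\<pi> n) (bd (Suc n) e) = bdry d' (Suc n) (push (\<pi> (Suc n)) e)" if "e \<in> Ch (Suc n)" for e
    using push_face_map[OF fm that] by simp
  have bd_D: "bd (Suc n) e \<in> D" if "e \<in> Ch (Suc n)" for e
  proof -
    have "bd n ((U ^^ j) (bd (Suc n) e)) = (U ^^ j) (bd n (bd (Suc n) e))"
      using Uj_bdry[OF bdry_chains[OF fc that]] by simp
    then show ?thesis using bdry_chains[OF fc that] bb[OF that] plin_0[OF pU] by (simp add: D_def)
  qed
  define W where "W = push (\<pi> n) ` D"
  have sub_W: "pm.subspace W" unfolding W_def by (rule plin_subspace_image[OF p\<pi> sub_D])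
  have B_W: "bounds S' d' n \<subseteq> W"
  proof
    fix y :: "'t \<Rightarrow>\<^sub>0 'k" assume "y \<in> bounds S' d' n"
    then obtain e' where e': "e' \<in> chains_on (S' (Suc n))" "y = bdry d' (Suc n) e'" by (auto simp: bounds_def)
    obtain e where e: "e \<in> Ch (Suc n)" "push (\<pi> (Suc n)) e = e'"
      by (rule push_surj[OF face_map_image[OF fm] e'(1)])
    have "y = push (\<pi> n) (bd (Suc n) e)" using e'(2) e(2) \<pi>_bd[OF e(1)] by simp
    then show "y \<in> W" unfolding W_def using bd_D[OF e(1)] by (rule image_eqI)
  qed
  have W_Z: "W \<subseteq> cycles S' d' n"
  proof
    fix y assume "y \<in> W"
    then obtain c where c: "c \<in> D" "y = push (\<pi> n) c" by (auto simp: W_def)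
    have cn: "c \<in> Ch n" "bd n ((U ^^ j) c) = 0" using c(1) by (auto simp: D_def)
    have "bdry d' n y = push (\<pi> (n - 1)) (bd n c)" using push_face_map[OF fm cn(1)] c(2) by simp
    also have "\<dots> = 0"
    proof (cases n)
      case 0
      then show ?thesis by (simp add: bdry_def plin_0[OF plin_push])
    next
      case (Suc k)
      have "bd n c \<in> Ch k" using bdry_chains[OF fc] cn(1) Suc by simp
      \<comment> \<open>\<open>bd n c\<close> itself need not vanish: it is only killed by
        \<open>U ^^ j\<close>, which suffices, by j < p, for its image in the quotient to be
        zero.\<close>
      moreover have "(U ^^ j) (bd n c) = 0" using Uj_bdry[OF cn(1)] cn(2) by simp
      ultimately show ?thesis using kernel_Uj[OF _ _ j, of "bd n c" k] Suc by simp
    qed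
    finally show "y \<in> cycles S' d' n"
      using push_chains[OF face_map_in[OF fm] cn(1)] c(2) by (simp add: cycles_def)
  qed
  have "spans_mod W (bounds S' d' n) m"
    by (rule spans_mod_subspace[OF T[unfolded hom_le_def] sub_W subspace_bounds B_W W_Z])
  then obtain T'' where T'': "finite T''" "card T'' \<le> m" "T'' \<subseteq> W" "W \<subseteq> pm.span (T'' \<union> bounds S' d' n)"
    by (auto simp: spans_mod_def)
  have "\<forall>w\<in>T''. \<exists>c. c \<in> D \<and> w = push (\<pi> n) c" using T''(3) by (auto simp: W_def)
  then obtain g where g: "\<And>w. w \<in> T'' \<Longrightarrow> g w \<in> D \<and> w = push (\<pi> n) (g w)" by metis
  define L where "L = (\<lambda>w. (U ^^ j) (g w)) ` T''"
  have L: "finite L" "card L \<le> m" "L \<subseteq> cycles S d n \<inter> ?F j n"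
    using T''(1,2) card_image_le[OF T''(1), of "\<lambda>w. (U ^^ j) (g w)"] g
    by (auto simp: L_def D_def cycles_def Uj_Ch)
  obtain A where A: "finite A" "card A \<le> a" "A \<subseteq> cycles S d n \<inter> ?F (Suc j) n"
    "cycles S d n \<inter> ?F (Suc j) n \<subseteq> pm.span (A \<union> bd (Suc n) ` ?F (Suc j) (Suc n))"
    using IH by blast
  have F_mono: "?F (Suc j) k \<subseteq> ?F j k" for k
  proof
    fix x assume "x \<in> ?F (Suc j) k"
    then obtain c where "c \<in> Ch k" "x = (U ^^ j) (U c)" by (auto simp: funpow_swap1)
    then show "x \<in> ?F j k" using U_Ch by blast
  qed
  let ?V = "pm.span (A \<union> L \<union> bd (Suc n) ` ?F j (Suc n))"
  have "cycles S d n \<inter> ?F j n \<subseteq> ?V"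
  proof
    fix x assume x: "x \<in> cycles S d n \<inter> ?F j n"
    then obtain c where c: "c \<in> Ch n" "x = (U ^^ j) c" by auto
    have cD: "c \<in> D" using c x by (simp add: D_def cycles_def)
    \<comment> \<open>The chains of \<open>D\<close> for which the claim holds even without
      \<open>A\<close>. Their images form a subspace that contains \<open>T''\<close> and all
      boundaries, hence all of \<open>W\<close>.\<close>
    define G where "G = {c \<in> D. (U ^^ j) c \<in> pm.span (L \<union> bd (Suc n) ` ?F j (Suc n))}"
    have G_eq: "G = D \<inter> {c. (U ^^ j) c \<in> pm.span (L \<union> bd (Suc n) ` ?F j (Suc n))}" by (auto simp: G_def)
    have sub_G: "pm.subspace (push (\<pi> n) ` G)" unfolding G_eq
      by (rule plin_subspace_image[OF p\<pi> pm.subspace_inter[OF sub_D plin_subspace_vimage[OF pU pm.subspace_span]]])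
    have "T'' \<subseteq> push (\<pi> n) ` G"
    proof
      fix w assume w: "w \<in> T''"
      then have "(U ^^ j) (g w) \<in> L" by (auto simp: L_def)
      then have "g w \<in> G" using g[OF w] by (simp add: G_def pm.span_base)
      then show "w \<in> push (\<pi> n) ` G" using g[OF w] by blast
    qed
    moreover have "bounds S' d' n \<subseteq> push (\<pi> n) ` G"
    proof
      fix y :: "'t \<Rightarrow>\<^sub>0 'k" assume "y \<in> bounds S' d' n"
      then obtain e' where e': "e' \<in> chains_on (S' (Suc n))" "y = bdry d' (Suc n) e'" by (auto simp: bounds_def)
      obtain e where e: "e \<in> Ch (Suc n)" "push (\<pi> (Suc n)) e = e'"
        by (rule push_surj[OF face_map_image[OF fm] e'(1)])
      have y: "y = push (\<pi> n) (bd (Suc n) e)" using e'(2) e(2) \<pi>_bd[OF e(1)] by simp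
      have "(U ^^ j) (bd (Suc n) e) \<in> bd (Suc n) ` ?F j (Suc n)" using Uj_bdry[OF e(1)] e(1) by blast
      then have "bd (Suc n) e \<in> G" using bd_D[OF e(1)] by (simp add: G_def pm.span_base)
      then show "y \<in> push (\<pi> n) ` G" using y by blast
    qed
    ultimately have "pm.span (T'' \<union> bounds S' d' n) \<subseteq> push (\<pi> n) ` G"
      by (intro pm.span_minimal sub_G) blast
    then have "push (\<pi> n) c \<in> push (\<pi> n) ` G" using T''(4) cD by (auto simp: W_def)
    then obtain c1 where c1: "c1 \<in> G" "push (\<pi> n) c = push (\<pi> n) c1" by auto
    have "c - c1 \<in> D" using cD c1(1) by (auto simp: G_def intro: pm.subspace_diff[OF sub_D])
    then have cc1: "c - c1 \<in> Ch n" "bd n ((U ^^ j) (c - c1)) = 0" by (auto simp: D_def)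
    moreover have "push (\<pi> n) (c - c1) = 0" using c1(2) by (simp add: plin_diff[OF p\<pi>])
    \<comment> \<open>The correction vanishes in the quotient, so it is a multiple of
      \<open>U\<close>. After \<open>U ^^ j\<close> it lies one step deeper in the filtration, where
      \<open>A\<close> takes over.\<close>
    ultimately obtain b where b: "b \<in> Ch n" "c - c1 = U b" using kernel_push by blast
    have "(U ^^ j) (c - c1) = (U ^^ Suc j) b" using b(2) by (simp add: funpow_swap1)
    then have "(U ^^ j) (c - c1) \<in> ?F (Suc j) n" using b(1) by (rule image_eqI)
    moreover have "(U ^^ j) (c - c1) \<in> cycles S d n" using cc1 Uj_Ch[OF cc1(1)] by (simp add: cycles_def)
    ultimately have "(U ^^ j) (c - c1) \<in> pm.span (A \<union> bd (Suc n) ` ?F (Suc j) (Suc n))" using A(4) by blast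
    moreover have "pm.span (A \<union> bd (Suc n) ` ?F (Suc j) (Suc n)) \<subseteq> ?V"
      by (rule pm.span_mono) (use F_mono[of "Suc n"] in blast)
    ultimately have 1: "(U ^^ j) (c - c1) \<in> ?V" by blast
    have "(U ^^ j) c1 \<in> pm.span (L \<union> bd (Suc n) ` ?F j (Suc n))" using c1(1) by (simp add: G_def)
    moreover have "pm.span (L \<union> bd (Suc n) ` ?F j (Suc n)) \<subseteq> ?V" by (rule pm.span_mono) blast
    ultimately have 2: "(U ^^ j) c1 \<in> ?V" by blast
    have "x = (U ^^ j) (c - c1) + (U ^^ j) c1" using c(2) by (simp add: plin_diff[OF pU])
    then show "x \<in> ?V" using pm.span_add[OF 1 2] by simp
  qed
  moreover have "A \<union> L \<subseteq> cycles S d n \<inter> ?F j n" using A(3) L(3) F_mono[of n] by blast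
  moreover have "card (A \<union> L) \<le> a + m" using card_Un_le[of A L] A(2) L(2) by linarith
  ultimately show ?thesis using A(1) L(1) by (intro exI[of _ "A \<union> L"]) auto
qed

theorem hom_le_total:
  assumes T: "hom_le TYPE('k) S' d' n m"
  shows "hom_le TYPE('k) S d n (p * m)"
proof -
  let ?F = "\<lambda>j n. (U ^^ j) ` Ch n"
  \<comment> \<open>The induction runs against the filtration: level p is zero, level 0 is the whole
    complex, and each step adds at most \<open>m\<close> cycles.\<close>
  have "\<exists>A. finite A \<and> card A \<le> i * m \<and> A \<subseteq> cycles S d n \<inter> ?F (p - i) n \<and>
      cycles S d n \<inter> ?F (p - i) n \<subseteq> pm.span (A \<union> bd (Suc n) ` ?F (p - i) (Suc n))" if "i \<le> p" for i
    using that
  proof (induction i)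
    case 0
    have "?F p n \<subseteq> {0}" using U_p by auto
    then show ?case by (intro exI[of _ "{}"]) (auto simp: pm.span_zero)
  next
    case (Suc i)
    have e: "Suc (p - Suc i) = p - i" using Suc.prems by simp
    have "p - Suc i < p" using Suc.prems by simp
    from filtration_step[OF T this, of "i * m"] show ?case
      unfolding e using Suc by (simp add: add.commute)
  qed
  from this[of p] obtain A where A: "finite A" "card A \<le> p * m" "A \<subseteq> cycles S d n \<inter> Ch n"
      "cycles S d n \<inter> Ch n \<subseteq> pm.span (A \<union> bd (Suc n) ` Ch (Suc n))"
    by auto
  moreover have "cycles S d n \<inter> Ch n = (cycles S d n :: ('s \<Rightarrow>\<^sub>0 'k) set)" by (auto simp: cycles_def)
  ultimately show ?thesis unfolding hom_le_def spans_mod_def bounds_def by auto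
qed

end

section \<open>Free actions of \<open>p\<close>-groups\<close>

lemma (in group) r_coset_eq_iff:
  assumes H: "subgroup H G" and a: "a \<in> carrier G" and b: "b \<in> carrier G"
  shows "H #> a = H #> b \<longleftrightarrow> a \<otimes> inv b \<in> H"
proof
  have HG: "H \<subseteq> carrier G" using H by (rule subgroup.subset)
  {
    assume "H #> a = H #> b"
    then have "a \<in> H #> b" using rcos_self[OF a H] by simp
    then obtain h where h: "h \<in> H" "a = h \<otimes> b" by (auto simp: r_coset_def)
    then have "a \<otimes> inv b = h" using HG b by (simp add: m_assoc subset_iff)
    then show "a \<otimes> inv b \<in> H" using h by simp
  next
    assume ab: "a \<otimes> inv b \<in> H"
    have "a = (a \<otimes> inv b) \<otimes> b" using a b by (simp add: m_assoc)
    then have "a \<in> H #> b" unfolding r_coset_def using ab by blast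
    then show "H #> a = H #> b" using repr_independence[OF _ b H] by simp
  }
qed

text \<open>\<open>H\<close> acts by right multiplication on its p right cosets. For
  \<open>x\<close> outside \<open>H\<close> the orbit of \<open>H #> x\<close> avoids the coset
  \<open>H\<close>, so it has fewer than p elements; its size being a power of p, it is 1, and
  \<open>x\<close> normalizes \<open>H\<close>. In the proof \<open>f\<close> runs through the orbit
  and \<open>D\<close> is the stabilizer.\<close>

lemma (in group) index_p_subgroup_normal:
  assumes p: "prime p" and fin: "finite (carrier G)" and ord: "order G = p ^ Suc r"
    and H: "subgroup H G" and cH: "card H = p ^ r"
  shows "H \<lhd> G"
  unfolding normal_inv_iff
proof (intro conjI H ballI)
  fix x h assume x: "x \<in> carrier G" and h: "h \<in> H"
  have HG: "H \<subseteq> carrier G" using H by (rule subgroup.subset)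
  have finH: "finite H" using HG fin finite_subset by blast
  show "x \<otimes> h \<otimes> inv x \<in> H"
  proof (cases "x \<in> H")
    case True
    then show ?thesis using h H by (simp add: subgroup.m_closed subgroup.m_inv_closed)
  next
    case False
    define D where "D = {h \<in> H. x \<otimes> h \<otimes> inv x \<in> H}"
    define f where "f h = H #> (x \<otimes> h)" for h
    have f_eq: "f a = f b \<longleftrightarrow> a \<otimes> inv b \<in> D" if "a \<in> H" "b \<in> H" for a b
    proof -
      have ab: "a \<in> carrier G" "b \<in> carrier G" using that HG by auto
      have "x \<otimes> a \<otimes> inv (x \<otimes> b) = x \<otimes> (a \<otimes> inv b) \<otimes> inv x"
        using x ab by (simp add: inv_mult_group m_assoc)
      moreover have "a \<otimes> inv b \<in> H" using that H by (simp add: subgroup.m_closed subgroup.m_inv_closed)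
      ultimately show ?thesis using r_coset_eq_iff[OF H, of "x \<otimes> a" "x \<otimes> b"] x ab by (simp add: f_def D_def)
    qed
    \<comment> \<open>Orbit and stabilizer: the fibres of \<open>f\<close> are translates of
      \<open>D\<close>.\<close>
    have fib: "card {a \<in> H. f a = o'} = card D" if o': "o' \<in> f ` H" for o'
    proof -
      obtain b where b: "b \<in> H" "o' = f b" using o' by auto
      have bG: "b \<in> carrier G" using b HG by auto
      have "bij_betw (\<lambda>a. a \<otimes> b) D {a \<in> H. f a = o'}"
      proof (rule bij_betwI[where g = "\<lambda>a. a \<otimes> inv b"])
        show "(\<lambda>a. a \<otimes> b) \<in> D \<rightarrow> {a \<in> H. f a = o'}"
        proof
          fix a assume a: "a \<in> D"
          then have aH: "a \<in> H" "a \<in> carrier G" using HG by (auto simp: D_def)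
          have "a \<otimes> b \<in> H" using aH b H by (simp add: subgroup.m_closed)
          moreover have "a \<otimes> b \<otimes> inv b = a" using aH bG by (simp add: m_assoc)
          ultimately show "a \<otimes> b \<in> {a \<in> H. f a = o'}" using f_eq[of "a \<otimes> b" b] b a by simp
        qed
        show "(\<lambda>a. a \<otimes> inv b) \<in> {a \<in> H. f a = o'} \<rightarrow> D" using f_eq b by auto
        show "a \<otimes> b \<otimes> inv b = a" if "a \<in> D" for a using that HG bG by (auto simp: D_def m_assoc)
        show "a \<otimes> inv b \<otimes> b = a" if "a \<in> {a \<in> H. f a = o'}" for a using that HG bG by (auto simp: m_assoc)
      qed
      then show ?thesis using bij_betw_same_card by force
    qed
    have "card H = (\<Sum>o'\<in>f ` H. card {a \<in> H. f a = o'})"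
      using sum.image_gen[OF finH, of "\<lambda>_. 1::nat" f] by simp
    then have cc: "p ^ r = card (f ` H) * card D" using fib cH by simp
    then have "card (f ` H) dvd p ^ r" by simp
    then obtain i where i: "card (f ` H) = p ^ i" using divides_primepow_nat[OF p] by blast
    have sub: "f ` H \<subseteq> rcosets H - {H}"
    proof
      fix o' assume "o' \<in> f ` H"
      then obtain b where b: "b \<in> H" "o' = f b" by auto
      have xb: "x \<otimes> b \<in> carrier G" using b x HG by auto
      have "f b \<noteq> H"
      proof
        assume "f b = H"
        then have "x \<otimes> b \<in> H" using rcos_self[OF xb H] by (simp add: f_def)
        then have "x \<otimes> b \<otimes> inv b \<in> H" using b H by (simp add: subgroup.m_closed subgroup.m_inv_closed)
        moreover have "x \<otimes> b \<otimes> inv b = x" using b x HG by (auto simp: m_assoc)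
        ultimately show False using False by simp
      qed
      then show "o' \<in> rcosets H - {H}" using b xb by (auto simp: f_def RCOSETS_def)
    qed
    have "card (rcosets H) * p ^ r = p * p ^ r" using lagrange[OF H] cH ord by simp
    then have cr: "card (rcosets H) = p" using p by (simp add: prime_gt_0_nat)
    then have finr: "finite (rcosets H)" using p by (metis card.infinite not_prime_0)
    have "H \<in> rcosets H" using rcosetsI[OF HG one_closed] coset_mult_one[OF HG] by simp
    then have "card (rcosets H - {H}) < p" using cr finr card_Diff1_less by metis
    then have "p ^ i < p" using card_mono[OF _ sub] finr i by fastforce
    then have "i = 0" using p prime_gt_1_nat[OF p] power_increasing[of 1 i p] by (cases "i = 0") auto
    then have "card D = card H" using cc i cH by simp
    moreover have "D \<subseteq> H" by (auto simp: D_def)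
    ultimately have "D = H" using finH card_subset_eq by blast
    then show ?thesis using h by (auto simp: D_def)
  qed
qed

text \<open>Sylow's theorem provides a subgroup of index p, which is normal. The quotient has prime
  order, so any element outside the subgroup generates it.\<close>

lemma (in group) p_group_cyclic_quotient:
  assumes p: "prime p" and fin: "finite (carrier G)" and ord: "order G = p ^ Suc r"
  obtains H z where "H \<lhd> G" "card H = p ^ r" "z \<in> carrier G"
    "\<And>g. g \<in> carrier G \<Longrightarrow> \<exists>i<p. g \<in> H #> (z [^] i)" "z [^] p \<in> H"
    "\<And>i. 0 < i \<Longrightarrow> i < p \<Longrightarrow> z [^] (i::nat) \<notin> H"
proof -
  have "order G = p ^ r * p" using ord by simp
  then obtain H where H: "subgroup H G" "card H = p ^ r" using sylow_thm[OF p is_group _ fin] by blast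
  have nH: "H \<lhd> G" by (rule index_p_subgroup_normal[OF p fin ord H])
  interpret normal H G by (rule nH)
  let ?Q = "G Mod H"
  interpret Q: group ?Q by (rule factorgroup_is_group)
  have "card (rcosets H) * p ^ r = p * p ^ r" using lagrange[OF H(1)] H(2) ord by simp
  then have cr: "card (rcosets H) = p" using p by (simp add: prime_gt_0_nat)
  have cQ: "carrier ?Q = rcosets H" by (simp add: FactGroup_def)
  then have oQ: "order ?Q = p" using cr by (simp add: order_def)
  have finQ: "finite (carrier ?Q)" using cr cQ p by (metis card.infinite not_prime_0)
  have "\<not> carrier G \<subseteq> H"
  proof
    assume "carrier G \<subseteq> H"
    then have "p ^ Suc r \<le> p ^ r" using H(2) ord card_mono[of H "carrier G"] subgroup.subset[OF H(1)] fin
      by (metis finite_subset order_def)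
    then show False using prime_gt_1_nat[OF p] by simp
  qed
  then obtain z where z: "z \<in> carrier G" "z \<notin> H" by auto
  let ?Z = "H #> z"
  have hom: "(\<lambda>a. H #> a) \<in> hom G ?Q" by (rule r_coset_hom_Mod)
  interpret h: group_hom G ?Q "\<lambda>a. H #> a" by unfold_locales (rule hom)
  have Z: "?Z \<in> carrier ?Q" by (rule h.hom_closed[OF z(1)])
  have pow: "?Z [^]\<^bsub>?Q\<^esub> i = H #> (z [^] i)" for i :: nat using h.hom_nat_pow[OF z(1)] by simp
  have in_H: "H #> a = H \<longleftrightarrow> a \<in> H" if "a \<in> carrier G" for a
    using that H(1) rcos_self[OF that H(1)] coset_join2[OF that H(1)] by metis
  have one: "\<one>\<^bsub>?Q\<^esub> = H" by (simp add: FactGroup_def)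
  have "Q.ord ?Z dvd p" using Q.ord_dvd_group_order[OF Z] oQ by simp
  moreover have "Q.ord ?Z \<noteq> 1" using Q.ord_eq_1[OF Z] in_H[OF z(1)] z(2) one by simp
  ultimately have oZ: "Q.ord ?Z = p" using p prime_nat_iff by blast
  have inj: "inj_on (\<lambda>i. ?Z [^]\<^bsub>?Q\<^esub> i) {0..p - 1}" using Q.ord_inj[OF Z] oZ by simp
  have eqp: "{0..p - 1} = {..<p}" using prime_gt_0_nat[OF p] by auto
  have ci: "card ((\<lambda>i. ?Z [^]\<^bsub>?Q\<^esub> i) ` {..<p}) = p" using card_image[OF inj] unfolding eqp by simp
  have "(\<lambda>i. ?Z [^]\<^bsub>?Q\<^esub> i) ` {..<p} = carrier ?Q"
  proof (rule card_subset_eq[OF finQ])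
    show "(\<lambda>i. ?Z [^]\<^bsub>?Q\<^esub> i) ` {..<p} \<subseteq> carrier ?Q" using Z by auto
    show "card ((\<lambda>i. ?Z [^]\<^bsub>?Q\<^esub> i) ` {..<p}) = card (carrier ?Q)"
      using ci oQ by (simp add: order_def)
  qed
  note im = this
  have gen: "\<exists>i<p. H #> g = H #> (z [^] i)" if "g \<in> carrier G" for g
  proof -
    have "H #> g \<in> (\<lambda>i. ?Z [^]\<^bsub>?Q\<^esub> i) ` {..<p}" unfolding im by (rule h.hom_closed[OF that])
    then show ?thesis unfolding pow by auto
  qed
  show thesis
  proof (rule that[OF nH H(2) z(1)])
    show "\<exists>i<p. g \<in> H #> (z [^] i)" if "g \<in> carrier G" for g
      using gen[OF that] rcos_self[OF that H(1)] by metis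
    show "z [^] p \<in> H" using Q.pow_ord_eq_1[OF Z] oZ pow one in_H[of "z [^] p"] z(1) by simp
    show "z [^] i \<notin> H" if "0 < i" "i < p" for i :: nat
    proof
      assume "z [^] i \<in> H"
      then have "?Z [^]\<^bsub>?Q\<^esub> i = \<one>\<^bsub>?Q\<^esub>" using pow one in_H[of "z [^] i"] z(1) by simp
      then have "p dvd i" using Q.pow_eq_id[OF Z] oZ by simp
      then show False using that by (simp add: nat_dvd_not_less)
    qed
  qed
qed

definition free_face_action ::
    "('g, 'm) monoid_scheme \<Rightarrow> (nat \<Rightarrow> 's set) \<Rightarrow> (nat \<Rightarrow> nat \<Rightarrow> 's \<Rightarrow> 's) \<Rightarrow> ('g \<Rightarrow> 's \<Rightarrow> 's) \<Rightarrow> bool" where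
  "free_face_action G S d a \<longleftrightarrow>
     (\<forall>g\<in>carrier G. \<forall>n. \<forall>s\<in>S n. a g s \<in> S n) \<and>
     (\<forall>g\<in>carrier G. \<forall>h\<in>carrier G. \<forall>n. \<forall>s\<in>S n. a (g \<otimes>\<^bsub>G\<^esub> h) s = a g (a h s)) \<and>
     (\<forall>n. \<forall>s\<in>S n. a \<one>\<^bsub>G\<^esub> s = s) \<and>
     (\<forall>g\<in>carrier G. \<forall>n. \<forall>s\<in>S n. a g s = s \<longrightarrow> g = \<one>\<^bsub>G\<^esub>) \<and>
     (\<forall>g\<in>carrier G. \<forall>n. \<forall>s\<in>S (Suc n). \<forall>j\<le>Suc n. a g (d (Suc n) j s) = d (Suc n) j (a g s))"

definition orb :: "('g, 'm) monoid_scheme \<Rightarrow> ('g \<Rightarrow> 's \<Rightarrow> 's) \<Rightarrow> 's \<Rightarrow> 's set" where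
  "orb G a s = (\<lambda>g. a g s) ` carrier G"

abbreviation "orb_simplices G S a \<equiv> \<lambda>n. orb G a ` S n"
abbreviation "orb_faces d \<equiv> \<lambda>n j B. d n j ` B"

locale face_action = group G for G :: "('g, 'm) monoid_scheme" (structure) +
  fixes S :: "nat \<Rightarrow> 's set" and d and a :: "'g \<Rightarrow> 's \<Rightarrow> 's"
  assumes act: "free_face_action G S d a" and fc: "face_closed S d"
begin

lemmas act_unfolded = act[unfolded free_face_action_def]

lemma act_in: "g \<in> carrier G \<Longrightarrow> s \<in> S n \<Longrightarrow> a g s \<in> S n"
  by (rule act_unfolded[THEN conjunct1, rule_format])

lemma act_mult: "g \<in> carrier G \<Longrightarrow> h \<in> carrier G \<Longrightarrow> s \<in> S n \<Longrightarrow> a (g \<otimes> h) s = a g (a h s)"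
  by (rule act_unfolded[THEN conjunct2, THEN conjunct1, rule_format])

lemma act_one: "s \<in> S n \<Longrightarrow> a \<one> s = s"
  by (rule act_unfolded[THEN conjunct2, THEN conjunct2, THEN conjunct1, rule_format])

lemma act_free: "g \<in> carrier G \<Longrightarrow> s \<in> S n \<Longrightarrow> a g s = s \<Longrightarrow> g = \<one>"
  by (rule act_unfolded[THEN conjunct2, THEN conjunct2, THEN conjunct2, THEN conjunct1, rule_format])

lemma act_face: "g \<in> carrier G \<Longrightarrow> s \<in> S (Suc n) \<Longrightarrow> j \<le> Suc n \<Longrightarrow> a g (d (Suc n) j s) = d (Suc n) j (a g s)"
  by (rule act_unfolded[THEN conjunct2, THEN conjunct2, THEN conjunct2, THEN conjunct2, rule_format])

lemma act_inj: "g \<in> carrier G \<Longrightarrow> h \<in> carrier G \<Longrightarrow> s \<in> S n \<Longrightarrow> a g s = a h s \<Longrightarrow> g = h"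
proof -
  assume g: "g \<in> carrier G" and h: "h \<in> carrier G" and s: "s \<in> S n" and eq: "a g s = a h s"
  have "a (inv h \<otimes> g) s = a (inv h) (a h s)" using act_mult[OF inv_closed[OF h] g s] eq by simp
  also have "\<dots> = a (inv h \<otimes> h) s" by (rule act_mult[OF inv_closed[OF h] h s, symmetric])
  finally have "a (inv h \<otimes> g) s = s" using h act_one[OF s] by simp
  then have "inv h \<otimes> g = \<one>" using act_free[of "inv h \<otimes> g" s n] g h s by simp
  then show "g = h" using g h by (metis inv_equality inv_inv inv_closed)
qed

lemma orb_self: "s \<in> S n \<Longrightarrow> s \<in> orb G a s"
  unfolding orb_def by (rule image_eqI[of _ _ "\<one>"]) (simp_all add: act_one)

lemma orb_eqI:
  assumes s: "s \<in> S n" and g: "g \<in> carrier G"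
  shows "orb G a (a g s) = orb G a s"
proof
  show "orb G a (a g s) \<subseteq> orb G a s"
    using s g by (auto simp: orb_def act_mult[symmetric])
  show "orb G a s \<subseteq> orb G a (a g s)"
  proof
    fix t assume "t \<in> orb G a s"
    then obtain h where h: "h \<in> carrier G" "t = a h s" by (auto simp: orb_def)
    have "a (h \<otimes> inv g) (a g s) = a (h \<otimes> inv g \<otimes> g) s" using h g s by (simp add: act_mult)
    also have "h \<otimes> inv g \<otimes> g = h" using h g by (simp add: m_assoc)
    finally show "t \<in> orb G a (a g s)" using h g unfolding orb_def by (intro image_eqI[of _ _ "h \<otimes> inv g"]) auto
  qed
qed

lemma orb_eq_iff: "s \<in> S n \<Longrightarrow> t \<in> S n \<Longrightarrow> orb G a s = orb G a t \<longleftrightarrow> (\<exists>g\<in>carrier G. t = a g s)"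
proof -
  assume s: "s \<in> S n" and t: "t \<in> S n"
  show ?thesis
  proof
    assume "orb G a s = orb G a t"
    then have "t \<in> orb G a s" using orb_self[OF t] by simp
    then show "\<exists>g\<in>carrier G. t = a g s" by (auto simp: orb_def)
  next
    assume "\<exists>g\<in>carrier G. t = a g s"
    then show "orb G a s = orb G a t" using orb_eqI[OF s] by auto
  qed
qed

lemma orb_face: "s \<in> S (Suc n) \<Longrightarrow> j \<le> Suc n \<Longrightarrow> orb G a (d (Suc n) j s) = d (Suc n) j ` orb G a s"
  unfolding orb_def image_image by (intro image_cong refl) (simp add: act_face)

lemma face_map_orb: "face_map S d (orb_simplices G S a) (orb_faces d) (\<lambda>n. orb G a)"
  unfolding face_map_def by (simp add: orb_face)

end

lemma face_action_subgroup:
  assumes "face_action G S d a" "subgroup H G"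
  shows "face_action (G\<lparr>carrier := H\<rparr>) S d a"
proof -
  interpret face_action G S d a by (rule assms(1))
  have HG: "H \<subseteq> carrier G" using assms(2) by (rule subgroup.subset)
  have "group (G\<lparr>carrier := H\<rparr>)" by (rule subgroup_imp_group[OF assms(2)])
  moreover have "free_face_action (G\<lparr>carrier := H\<rparr>) S d a"
    unfolding free_face_action_def using HG act_in act_mult act_one act_free act_face
    by (simp add: subset_iff)
  ultimately show ?thesis using fc by (simp add: face_action_def face_action_axioms_def)
qed

text \<open>A normal subgroup \<open>H\<close> of index p factors the orbit projection through the
  orbits of \<open>H\<close>. The lower stage is a cyclic quotient and costs a factor p; the upper
  stage is the induction hypothesis for \<open>H\<close>. The complex \<open>S\<close> stays the
  same and only the group shrinks, so the induction remains within one type.\<close>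

theorem p_group_action_hom_le:
  fixes G :: "'g monoid" and S :: "nat \<Rightarrow> 's set"
  assumes p: "prime p" and char: "CHAR('k::field) = p"
    and cc: "chain_complex TYPE('k) S d"
    and fin: "finite (carrier G)" and ord: "order G = p ^ r" and G: "face_action G S d a"
    and le: "hom_le TYPE('k) (orb_simplices G S a) (orb_faces d) n m"
  shows "hom_le TYPE('k) S d n (p ^ r * m)"
  using fin ord G le
proof (induction r arbitrary: G m)
  case 0
  interpret face_action G S d a by (rule 0(3))
  have "card (carrier G) = 1" using 0 by (simp add: order_def)
  then have G1: "carrier G = {\<one>\<^bsub>G\<^esub>}" using one_closed by (metis card_1_singletonE singletonD)
  have "orb G a s = {s}" if "s \<in> S n" for s n using act_one[OF that] by (simp add: orb_def G1)
  then have inj: "inj_on (orb G a) (S n)" for n by (metis inj_onI singleton_inject)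
  have "hom_le TYPE('k) S d n m"
    unfolding hom_le_bij_iff[OF fc face_map_orb inj] by (rule 0(4))
  then show ?case by simp
next
  case (Suc r)
  interpret face_action G S d a by (rule Suc(4))
  obtain H z where Hz: "H \<lhd> G" "card H = p ^ r" "z \<in> carrier G"
    "\<And>g. g \<in> carrier G \<Longrightarrow> \<exists>i<p. g \<in> H #>\<^bsub>G\<^esub> (z [^]\<^bsub>G\<^esub> i)" "z [^]\<^bsub>G\<^esub> p \<in> H"
    "\<And>i. 0 < i \<Longrightarrow> i < p \<Longrightarrow> z [^]\<^bsub>G\<^esub> (i::nat) \<notin> H"
    by (rule p_group_cyclic_quotient[OF p Suc(2,3)]) blast
  have subH: "subgroup H G" using Hz(1) by (simp add: normal_imp_subgroup)
  have HG: "H \<subseteq> carrier G" using subH by (rule subgroup.subset)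
  define G' where "G' = G\<lparr>carrier := H\<rparr>"
  have cG': "carrier G' = H" by (simp add: G'_def)
  interpret H: face_action G' S d a unfolding G'_def by (rule face_action_subgroup[OF Suc(4) subH])
  let ?S1 = "orb_simplices G' S a" and ?S2 = "orb_simplices G S a"
  \<comment> \<open>Sends an orbit of \<open>H\<close> to the orbit of \<open>G\<close> containing
    it; the union avoids the choice of a representative.\<close>
  define \<pi> where "\<pi> B = (\<Union>s\<in>B. orb G a s)" for B
  have \<pi>: "\<pi> (orb G' a s) = orb G a s" if s: "s \<in> S n" for s n
  proof -
    have "orb G a t = orb G a s" if "t \<in> orb G' a s" for t
      using that HG orb_eqI[OF s] by (auto simp: orb_def[of G'] cG')
    then show ?thesis using H.orb_self[OF s] unfolding \<pi>_def by blast
  qed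
  \<comment> \<open>By normality of \<open>H\<close> the element \<open>z\<close> permutes the
    orbits of \<open>H\<close>; its p-th power lies in \<open>H\<close> and fixes each of
    them.\<close>
  define \<zeta> where "\<zeta> B = a z ` B" for B
  have \<zeta>: "\<zeta> (orb G' a s) = orb G' a (a z s)" if s: "s \<in> S n" for s n
  proof
    show "\<zeta> (orb G' a s) \<subseteq> orb G' a (a z s)"
    proof
      fix t assume "t \<in> \<zeta> (orb G' a s)"
      then obtain h where h: "h \<in> H" "t = a z (a h s)" by (auto simp: \<zeta>_def orb_def cG')
      then have hG: "h \<in> carrier G" using HG by auto
      have "t = a (z \<otimes>\<^bsub>G\<^esub> h \<otimes>\<^bsub>G\<^esub> inv\<^bsub>G\<^esub> z) (a z s)"
        using h hG Hz(3) s by (simp flip: act_mult add: m_assoc)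
      moreover have "z \<otimes>\<^bsub>G\<^esub> h \<otimes>\<^bsub>G\<^esub> inv\<^bsub>G\<^esub> z \<in> H" using normal_invE(2)[OF Hz(1,3) h(1)] .
      ultimately show "t \<in> orb G' a (a z s)" by (auto simp: orb_def cG')
    qed
    show "orb G' a (a z s) \<subseteq> \<zeta> (orb G' a s)"
    proof
      fix t assume "t \<in> orb G' a (a z s)"
      then obtain h where h: "h \<in> H" "t = a h (a z s)" by (auto simp: orb_def cG')
      then have hG: "h \<in> carrier G" using HG by auto
      have "t = a z (a (inv\<^bsub>G\<^esub> z \<otimes>\<^bsub>G\<^esub> h \<otimes>\<^bsub>G\<^esub> z) s)"
        using h hG Hz(3) s by (simp flip: act_mult add: m_assoc[symmetric])
      moreover have "inv\<^bsub>G\<^esub> z \<otimes>\<^bsub>G\<^esub> h \<otimes>\<^bsub>G\<^esub> z \<in> H"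
        using normal_invE(2)[OF Hz(1) inv_closed[OF Hz(3)] h(1)] Hz(3) by simp
      ultimately show "t \<in> \<zeta> (orb G' a s)" by (auto simp: \<zeta>_def orb_def cG')
    qed
  qed
  have zi: "z [^]\<^bsub>G\<^esub> (i::nat) \<in> carrier G" for i using Hz(3) by simp
  have \<zeta>i: "(\<zeta> ^^ i) (orb G' a s) = orb G' a (a (z [^]\<^bsub>G\<^esub> i) s)" if s: "s \<in> S n" for s n i
  proof (induction i)
    case 0
    then show ?case using s by (simp add: act_one)
  next
    case (Suc i)
    have "(\<zeta> ^^ Suc i) (orb G' a s) = orb G' a (a z (a (z [^]\<^bsub>G\<^esub> i) s))"
      using Suc \<zeta>[OF act_in[OF zi s]] by simp
    also have "a z (a (z [^]\<^bsub>G\<^esub> i) s) = a (z [^]\<^bsub>G\<^esub> Suc i) s"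
      using s Hz(3) zi by (simp flip: act_mult add: nat_pow_Suc2[symmetric])
    finally show ?case .
  qed
  interpret C: cyclic_quotient ?S1 "orb_faces d" ?S2 "orb_faces d" "\<lambda>n. \<pi>" \<zeta> p "TYPE('k)"
  proof (unfold_locales; (elim imageE)?)
    show "chain_complex TYPE('k) ?S1 (orb_faces d)" by (rule chain_complex_image[OF cc H.face_map_orb])
    show "face_map ?S1 (orb_faces d) ?S2 (orb_faces d) (\<lambda>n. \<pi>)"
      unfolding face_map_def
    proof (intro conjI allI impI)
      fix n
      have "\<pi> ` orb G' a ` S n = (\<lambda>s. \<pi> (orb G' a s)) ` S n" by (simp add: image_image)
      also have "\<dots> = orb G a ` S n" by (intro image_cong refl \<pi>)
      finally show "\<pi> ` orb G' a ` S n = orb G a ` S n" .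
      fix j B assume "B \<in> orb G' a ` S (Suc n)" and j: "j \<le> Suc n"
      then obtain s where s: "s \<in> S (Suc n)" "B = orb G' a s" by auto
      have ds: "d (Suc n) j s \<in> S n" using fc s(1) j by (simp add: face_closed_def)
      show "\<pi> (d (Suc n) j ` B) = d (Suc n) j ` \<pi> B"
        unfolding s(2) H.orb_face[OF s(1) j, symmetric] \<pi>[OF ds] \<pi>[OF s(1)] by (rule orb_face[OF s(1) j])
    qed
    show "CHAR('k) = p" "prime p" by fact+
    fix n B s assume s: "B = orb G' a s" "s \<in> S n"
    show "\<zeta> B \<in> orb G' a ` S n" using s \<zeta>[OF s(2)] act_in[OF Hz(3) s(2)] by simp
    show "\<pi> (\<zeta> B) = \<pi> B" using s \<zeta>[OF s(2)] \<pi>[OF s(2)] \<pi>[OF act_in[OF Hz(3) s(2)]] orb_eqI[OF s(2) Hz(3)] by simp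
    show "(\<zeta> ^^ p) B = B" using s \<zeta>i[OF s(2)] H.orb_eqI[OF s(2)] Hz(5) cG' by simp
    fix i assume i: "0 < i" "i < p"
    show "(\<zeta> ^^ i) B \<noteq> B"
    proof
      assume "(\<zeta> ^^ i) B = B"
      then have "orb G' a s = orb G' a (a (z [^]\<^bsub>G\<^esub> i) s)" using s \<zeta>i[OF s(2)] by simp
      then obtain h where h: "h \<in> H" "a (z [^]\<^bsub>G\<^esub> i) s = a h s"
        using H.orb_eq_iff[OF s(2) act_in[OF zi s(2)]] cG' by auto
      then have "z [^]\<^bsub>G\<^esub> i = h" using act_inj[OF zi _ s(2)] HG by blast
      then show False using h Hz(6)[OF i] by simp
    qed
  next
    fix n j B s assume s: "B = orb G' a s" "s \<in> S (Suc n)" and j: "j \<le> Suc n"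
    have ds: "d (Suc n) j s \<in> S n" using fc s(2) j by (simp add: face_closed_def)
    show "\<zeta> (d (Suc n) j ` B) = d (Suc n) j ` \<zeta> B"
      unfolding s(1) H.orb_face[OF s(2) j, symmetric] \<zeta>[OF ds] \<zeta>[OF s(2)]
        H.orb_face[OF act_in[OF Hz(3) s(2)] j, symmetric] act_face[OF Hz(3) s(2) j] ..
  next
    fix n B B' s s' assume s: "B = orb G' a s" "s \<in> S n" and s': "B' = orb G' a s'" "s' \<in> S n" and eq: "\<pi> B = \<pi> B'"
    have "orb G a s = orb G a s'" using eq s s' \<pi> by simp
    then obtain g where g: "g \<in> carrier G" "s' = a g s" using orb_eq_iff[OF s(2) s'(2)] by auto
    obtain i where i: "i < p" "g \<in> H #>\<^bsub>G\<^esub> (z [^]\<^bsub>G\<^esub> i)" using Hz(4)[OF g(1)] by auto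
    then obtain h where h: "h \<in> H" "g = h \<otimes>\<^bsub>G\<^esub> z [^]\<^bsub>G\<^esub> i" by (auto simp: r_coset_def)
    have "s' = a h (a (z [^]\<^bsub>G\<^esub> i) s)" using g h HG zi s by (simp add: act_mult subset_iff)
    then have "B' = orb G' a (a (z [^]\<^bsub>G\<^esub> i) s)"
      using s'(1) H.orb_eqI[OF act_in[OF zi s(2)]] h(1) cG' by simp
    then show "\<exists>i<p. B' = (\<zeta> ^^ i) B" using i(1) \<zeta>i[OF s(2)] s(1) by auto
  qed
  have "hom_le TYPE('k) ?S1 (orb_faces d) n (p * m)" by (rule C.hom_le_total[OF Suc(5)])
  moreover have "finite (carrier G')" using Suc(2) HG finite_subset cG' by auto
  moreover have "order G' = p ^ r" using Hz(2) cG' by (simp add: order_def)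
  ultimately have "hom_le TYPE('k) S d n (p ^ r * (p * m))"
    using Suc(1)[OF _ _ H.face_action_axioms] by blast
  then show ?case by (simp add: ac_simps)
qed

section \<open>Betti numbers and finite generation of homology\<close>

definition coset_of :: "('s \<Rightarrow>\<^sub>0 'k::field) set \<Rightarrow> ('s \<Rightarrow>\<^sub>0 'k) \<Rightarrow> ('s \<Rightarrow>\<^sub>0 'k) set" where
  "coset_of B c = (\<lambda>b. b + c) ` B"

lemma coset_of_self: "pm.subspace B \<Longrightarrow> c \<in> coset_of B c"
  unfolding coset_of_def by (rule image_eqI[of _ _ 0]) (simp_all add: pm.subspace_0)

lemma coset_of_mem: "x \<in> coset_of B c \<longleftrightarrow> x - c \<in> B"
  unfolding coset_of_def by (auto simp: image_iff intro: bexI[of _ "x - c"])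

lemma coset_of_eq_iff:
  assumes "pm.subspace B" shows "coset_of B a = coset_of B c \<longleftrightarrow> a - c \<in> B"
proof
  assume "coset_of B a = coset_of B c"
  then show "a - c \<in> B" using coset_of_self[OF assms, of a] by (simp add: coset_of_mem)
next
  assume ac: "a - c \<in> B"
  have "x - a \<in> B \<longleftrightarrow> x - c \<in> B" for x
    using pm.subspace_add[OF assms _ ac, of "x - a"] pm.subspace_diff[OF assms _ ac, of "x - c"] by auto
  then show "coset_of B a = coset_of B c" by (intro Set.set_eqI) (simp add: coset_of_mem)
qed

lemma coset_of_zero: "coset_of B 0 = B"
  by (simp add: coset_of_def)

text \<open>Connects the vector space of finitely supported functions with quotients of module
  records. The record is pinned down in those fields that the quotient construction
  consults.\<close>

locale quotient_space =
  fixes M :: "('k::field, 's \<Rightarrow>\<^sub>0 'k) module" and Z B :: "('s \<Rightarrow>\<^sub>0 'k) set"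
  assumes M: "carrier M = Z" "add M = (+)" "smult M = psmul"
    and Z: "pm.subspace Z" and B: "pm.subspace B" and BZ: "B \<subseteq> Z"
begin

abbreviation "Q \<equiv> quotient_module M B"
abbreviation "\<kappa> \<equiv> coset_of B"

lemma a_r_coset: "B +>\<^bsub>M\<^esub> c = \<kappa> c"
  by (auto simp: a_r_coset_def r_coset_def coset_of_def M)

lemma carrier_Q: "carrier Q = \<kappa> ` Z"
  by (auto simp: quotient_module_def A_RCOSETS_def RCOSETS_def M a_r_coset[symmetric] a_r_coset_def)

lemma zero_Q: "\<zero>\<^bsub>Q\<^esub> = \<kappa> 0"
  by (simp add: quotient_module_def coset_of_zero)

lemma add_Q: "\<kappa> a \<oplus>\<^bsub>Q\<^esub> \<kappa> c = \<kappa> (a + c)"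
proof -
  have "\<kappa> a \<oplus>\<^bsub>Q\<^esub> \<kappa> c = {x + y | x y. x \<in> \<kappa> a \<and> y \<in> \<kappa> c}"
    by (auto simp: quotient_module_def set_add_def set_mult_def M)
  also have "\<dots> = \<kappa> (a + c)"
  proof
    show "{x + y | x y. x \<in> \<kappa> a \<and> y \<in> \<kappa> c} \<subseteq> \<kappa> (a + c)"
      using pm.subspace_add[OF B] by (auto simp: coset_of_mem) (metis add_diff_add)
    show "\<kappa> (a + c) \<subseteq> {x + y | x y. x \<in> \<kappa> a \<and> y \<in> \<kappa> c}"
    proof
      fix x assume "x \<in> \<kappa> (a + c)"
      then have "x - c \<in> \<kappa> a" "c \<in> \<kappa> c" "x = (x - c) + c"
        using pm.subspace_0[OF B] by (auto simp: coset_of_mem algebra_simps)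
      then show "x \<in> {x + y | x y. x \<in> \<kappa> a \<and> y \<in> \<kappa> c}" by blast
    qed
  qed
  finally show ?thesis .
qed

lemma smult_Q: "r \<odot>\<^bsub>Q\<^esub> \<kappa> c = \<kappa> (psmul r c)"
proof -
  have "\<kappa> (psmul r x) = \<kappa> (psmul r c)" if "x \<in> \<kappa> c" for x
    using that pm.subspace_scale[OF B, of "x - c" r]
    by (simp add: coset_of_mem coset_of_eq_iff[OF B] pm.scale_right_diff_distrib)
  then have "(\<Union>x\<in>\<kappa> c. \<kappa> (psmul r x)) = (\<Union>x\<in>\<kappa> c. \<kappa> (psmul r c))" by (intro SUP_cong refl)
  also have "\<dots> = \<kappa> (psmul r c)" using coset_of_self[OF B, of c] by auto
  finally show ?thesis by (simp add: quotient_module_def a_r_coset M)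
qed

lemma vectorspace_Q: "vectorspace (class_ring :: 'k ring) Q"
proof -
  have "abelian_group Q"
  proof (rule abelian_groupI)
    show "\<zero>\<^bsub>Q\<^esub> \<in> carrier Q" using pm.subspace_0[OF Z] by (simp add: carrier_Q zero_Q)
    fix x assume "x \<in> carrier Q"
    then obtain a where a: "a \<in> Z" "x = \<kappa> a" by (auto simp: carrier_Q)
    show "\<zero>\<^bsub>Q\<^esub> \<oplus>\<^bsub>Q\<^esub> x = x" by (simp add: a zero_Q add_Q)
    have "- a \<in> Z" using a pm.subspace_neg[OF Z] by blast
    then show "\<exists>y\<in>carrier Q. y \<oplus>\<^bsub>Q\<^esub> x = \<zero>\<^bsub>Q\<^esub>"
      by (intro bexI[of _ "\<kappa> (- a)"]) (auto simp: a add_Q zero_Q carrier_Q)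
    fix y assume "y \<in> carrier Q"
    then obtain b where b: "b \<in> Z" "y = \<kappa> b" by (auto simp: carrier_Q)
    show "x \<oplus>\<^bsub>Q\<^esub> y \<in> carrier Q" using a b pm.subspace_add[OF Z] by (simp add: add_Q carrier_Q)
    show "x \<oplus>\<^bsub>Q\<^esub> y = y \<oplus>\<^bsub>Q\<^esub> x" by (simp add: a b add_Q add.commute)
    fix z assume "z \<in> carrier Q"
    then obtain c where c: "z = \<kappa> c" by (auto simp: carrier_Q)
    show "x \<oplus>\<^bsub>Q\<^esub> y \<oplus>\<^bsub>Q\<^esub> z = x \<oplus>\<^bsub>Q\<^esub> (y \<oplus>\<^bsub>Q\<^esub> z)" by (simp add: a b c add_Q add.assoc)
  qed
  moreover have "cring (class_ring :: 'k ring)" ..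
  ultimately have "module (class_ring :: 'k ring) Q"
  proof (intro moduleI)
    fix r s :: 'k and x assume "x \<in> carrier Q"
    then obtain a where a: "a \<in> Z" "x = \<kappa> a" by (auto simp: carrier_Q)
    show "r \<odot>\<^bsub>Q\<^esub> x \<in> carrier Q" using a pm.subspace_scale[OF Z] by (simp add: smult_Q carrier_Q)
    show "(r \<oplus>\<^bsub>class_ring\<^esub> s) \<odot>\<^bsub>Q\<^esub> x = r \<odot>\<^bsub>Q\<^esub> x \<oplus>\<^bsub>Q\<^esub> s \<odot>\<^bsub>Q\<^esub> x"
      by (simp add: a smult_Q add_Q pm.scale_left_distrib)
    show "(r \<otimes>\<^bsub>class_ring\<^esub> s) \<odot>\<^bsub>Q\<^esub> x = r \<odot>\<^bsub>Q\<^esub> (s \<odot>\<^bsub>Q\<^esub> x)" by (simp add: a smult_Q)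
    show "\<one>\<^bsub>class_ring\<^esub> \<odot>\<^bsub>Q\<^esub> x = x" by (simp add: a smult_Q)
    fix y assume "y \<in> carrier Q"
    then obtain b where b: "y = \<kappa> b" by (auto simp: carrier_Q)
    show "r \<odot>\<^bsub>Q\<^esub> (x \<oplus>\<^bsub>Q\<^esub> y) = r \<odot>\<^bsub>Q\<^esub> x \<oplus>\<^bsub>Q\<^esub> r \<odot>\<^bsub>Q\<^esub> y" by (simp add: a b smult_Q add_Q pm.scale_right_distrib)
  qed
  moreover have "field (class_ring :: 'k ring)" by (rule class_field)
  ultimately show ?thesis by (simp add: vectorspace_def)
qed

sublocale V: vectorspace "class_ring :: 'k ring" Q by (rule vectorspace_Q)

lemma submodule_coset_image:
  assumes "pm.subspace W" "W \<subseteq> Z"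
  shows "LinearCombinations.submodule (class_ring :: 'k ring) (\<kappa> ` W) Q"
  unfolding LinearCombinations.submodule_def
  using assms V.module_axioms pm.subspace_0[OF assms(1)] pm.subspace_add[OF assms(1)] pm.subspace_scale[OF assms(1)]
  by (auto simp: carrier_Q add_Q smult_Q zero_Q)

lemma subspace_coset_vimage:
  assumes "LinearCombinations.submodule (class_ring :: 'k ring) W Q"
  shows "pm.subspace {c \<in> Z. \<kappa> c \<in> W}"
proof -
  interpret W: LinearCombinations.submodule "class_ring :: 'k ring" W Q by (rule assms)
  show ?thesis
    unfolding pm.subspace_def
    using W.zero_closed W.m_closed W.smult_closed pm.subspace_0[OF Z] pm.subspace_add[OF Z] pm.subspace_scale[OF Z]
    by (auto simp: zero_Q add_Q[symmetric] smult_Q[symmetric])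
qed

lemma spans_mod_imp_generating:
  assumes "spans_mod Z B m"
  shows "\<exists>A. finite A \<and> card A \<le> m \<and> A \<subseteq> carrier Q \<and> V.span A = carrier Q"
proof -
  obtain T where T: "finite T" "card T \<le> m" "T \<subseteq> Z" "Z \<subseteq> pm.span (T \<union> B)"
    using assms by (auto simp: spans_mod_def)
  let ?A = "\<kappa> ` T"
  have A: "?A \<subseteq> carrier Q" using T(3) by (auto simp: carrier_Q)
  have sm: "LinearCombinations.submodule (class_ring :: 'k ring) (V.span ?A) Q" by (rule V.span_is_submodule[OF A])
  then interpret W: LinearCombinations.submodule "class_ring :: 'k ring" "V.span ?A" Q .
  have "pm.span (T \<union> B) \<subseteq> {c \<in> Z. \<kappa> c \<in> V.span ?A}"
  proof (rule pm.span_minimal[OF _ subspace_coset_vimage[OF sm]])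
    have "\<kappa> c \<in> V.span ?A" if "c \<in> T" for c
      using that V.in_own_span[OF A] by blast
    moreover have "\<kappa> c \<in> V.span ?A" if "c \<in> B" for c
      using that W.zero_closed coset_of_eq_iff[OF B, of c 0] by (simp add: zero_Q)
    ultimately show "T \<union> B \<subseteq> {c \<in> Z. \<kappa> c \<in> V.span ?A}" using T(3) BZ by blast
  qed
  then have "carrier Q \<subseteq> V.span ?A" using T(4) by (auto simp: carrier_Q)
  moreover have "V.span ?A \<subseteq> carrier Q" by (rule W.subset)
  moreover have "card ?A \<le> m" using card_image_le[OF T(1), of \<kappa>] T(2) by linarith
  ultimately show ?thesis using T(1) A by (intro exI[of _ ?A]) auto
qed

lemma generating_imp_spans_mod:
  assumes "finite A" "A \<subseteq> carrier Q" "V.span A = carrier Q"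
  shows "spans_mod Z B (card A)"
proof -
  have "\<forall>x\<in>A. \<exists>c. c \<in> Z \<and> x = \<kappa> c" using assms(2) by (auto simp: carrier_Q)
  then obtain g where g: "\<And>x. x \<in> A \<Longrightarrow> g x \<in> Z \<and> x = \<kappa> (g x)" by metis
  let ?T = "g ` A"
  let ?W = "pm.span (?T \<union> B)"
  have W: "?W \<subseteq> Z" using g BZ by (intro pm.span_minimal Z) auto
  have "A \<subseteq> \<kappa> ` ?W"
  proof
    fix x assume x: "x \<in> A"
    then have "g x \<in> ?W" by (intro pm.span_base) auto
    then show "x \<in> \<kappa> ` ?W" using g[OF x] by (metis imageI)
  qed
  then have "V.span A \<subseteq> \<kappa> ` ?W"
    by (rule V.span_is_subset[OF _ submodule_coset_image[OF pm.subspace_span W]])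
  then have *: "\<kappa> ` Z \<subseteq> \<kappa> ` ?W" using assms(3) by (simp add: carrier_Q)
  have "Z \<subseteq> ?W"
  proof
    fix c assume "c \<in> Z"
    then obtain w where w: "w \<in> ?W" "\<kappa> c = \<kappa> w" using * by blast
    then have "c - w \<in> B" using coset_of_eq_iff[OF B] by blast
    then have "c - w \<in> ?W" by (intro pm.span_base) auto
    then show "c \<in> ?W" using pm.span_add[OF _ w(1), of "c - w"] by simp
  qed
  moreover have "card ?T \<le> card A" by (rule card_image_le[OF assms(1)])
  ultimately show ?thesis using assms(1) g unfolding spans_mod_def by (intro exI[of _ ?T]) auto
qed

text \<open>\<open>V.dim\<close> is the least size of a finite generating set, and generating sets
  of the quotient correspond to spanning sets modulo \<open>B\<close>; bases do not enter.\<close>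

lemma dim_Q_le:
  assumes "spans_mod Z B m" shows "vectorspace.dim (class_ring :: 'k ring) Q \<le> m"
proof -
  obtain A where A: "finite A" "card A \<le> m" "A \<subseteq> carrier Q" "V.span A = carrier Q"
    using spans_mod_imp_generating[OF assms] by blast
  then have "V.dim \<le> card A" unfolding V.dim_def by (intro Least_le) auto
  then show ?thesis using A(2) by simp
qed

text \<open>Once some finite generating set exists, the least size is attained; otherwise the
  dimension would be an unspecified number.\<close>

lemma spans_mod_dim_Q:
  assumes "spans_mod Z B m" shows "spans_mod Z B (vectorspace.dim (class_ring :: 'k ring) Q)"
proof -
  obtain A where A: "finite A" "card A \<le> m" "A \<subseteq> carrier Q" "V.span A = carrier Q"
    using spans_mod_imp_generating[OF assms] by blast
  then have "\<exists>n. \<exists>A. finite A \<and> card A = n \<and> A \<subseteq> carrier Q \<and> V.span A = carrier Q" by blast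
  from LeastI_ex[OF this] obtain A' where "finite A'" "card A' = V.dim" "A' \<subseteq> carrier Q" "V.span A' = carrier Q"
    unfolding V.dim_def by blast
  then show ?thesis using generating_imp_spans_mod[of A'] by simp
qed

end

section \<open>Betti numbers through spanning sets of singular cycles\<close>

lemma coeff_boundary_eq: "coeff_boundary n = bdry singular_face n"
proof
  fix c :: "('a, 'k::field) coeff_chain"
  show "coeff_boundary n c = bdry singular_face n c"
  proof (cases "n = 0")
    case False
    have "psmul r (\<Sum>j\<le>n. Poly_Mapping.single (singular_face n j f) ((-1) ^ j)) =
        (\<Sum>j\<le>n. Poly_Mapping.single (singular_face n j f) ((-1) ^ j * r))" for r :: 'k and f :: "(nat \<Rightarrow> real) \<Rightarrow> 'a"
      unfolding pm.scale_sum_right by (simp add: mult.commute)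
    then show ?thesis using False by (simp add: coeff_boundary_def bdry_def lin_def del: sum.atMost_Suc)
  qed (simp add: coeff_boundary_def bdry_def)
qed

abbreviation "sing X \<equiv> \<lambda>n. singular_simplex_set n X"

lemma coeff_cycles_eq: "coeff_cycles n X = cycles (sing X) singular_face n"
  by (simp add: coeff_cycles_def cycles_def coeff_boundary_eq coeff_chain_module_def chains_on_def)

lemma coeff_boundaries_eq: "coeff_boundaries n X = bounds (sing X) singular_face n"
  by (simp add: coeff_boundaries_def bounds_def coeff_boundary_eq coeff_chain_module_def chains_on_def)

lemma face_closed_singular: "face_closed (sing X) singular_face"
  unfolding face_closed_def using singular_simplex_singular_face[of "Suc _" X] by auto

lemma betti_quotient_space:
  assumes "chain_complex TYPE('k::field) (sing X) singular_face"
  shows "quotient_space ((coeff_chain_module n X :: ('k, _) module)\<lparr>carrier := coeff_cycles n X\<rparr>)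
    (cycles (sing X) singular_face n) (bounds (sing X) singular_face n)"
  by unfold_locales
    (auto simp: coeff_chain_module_def coeff_cycles_eq intro: subspace_cycles subspace_bounds
      bounds_subset_cycles[OF assms, THEN subsetD])

lemma betti_number_le:
  assumes "chain_complex TYPE('k::field) (sing X) singular_face"
    and "hom_le TYPE('k) (sing X) singular_face n m"
  shows "betti_number TYPE('k) n X \<le> m"
  using quotient_space.dim_Q_le[OF betti_quotient_space[OF assms(1)]] assms(2)
  by (simp add: betti_number_def homology_module_def hom_le_def coeff_boundaries_eq)

lemma hom_le_betti_number:
  assumes "chain_complex TYPE('k::field) (sing X) singular_face"
    and "hom_le TYPE('k) (sing X) singular_face n m"
  shows "hom_le TYPE('k) (sing X) singular_face n (betti_number TYPE('k) n X)"
  using quotient_space.spans_mod_dim_Q[OF betti_quotient_space[OF assms(1)]] assms(2)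
  by (simp add: betti_number_def homology_module_def hom_le_def coeff_boundaries_eq)

section \<open>Passage from integral chains to chains over the field\<close>

definition reduce :: "'a chain \<Rightarrow> ((nat \<Rightarrow> real) \<Rightarrow> 'a) \<Rightarrow>\<^sub>0 'k::field" where
  "reduce c = Poly_Mapping.map of_int c"

lemma lookup_reduce [simp]: "Poly_Mapping.lookup (reduce c) s = of_int (Poly_Mapping.lookup c s)"
  by (simp add: reduce_def Poly_Mapping.map.rep_eq when_def)

lemma reduce_add: "reduce (a + b) = reduce a + reduce b"
  by (rule poly_mapping_eqI) (simp add: lookup_add)

lemma reduce_0 [simp]: "reduce 0 = 0"
  by (rule poly_mapping_eqI) simp

lemma reduce_minus: "reduce (- a) = - reduce a"
  by (rule poly_mapping_eqI) simp

lemma reduce_diff: "reduce (a - b) = reduce a - reduce b"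
  by (rule poly_mapping_eqI) (simp add: lookup_minus)

lemma reduce_sum: "reduce (sum f I) = (\<Sum>i\<in>I. reduce (f i))"
  by (induction I rule: infinite_finite_induct) (auto simp: reduce_add)

lemma reduce_cmul: "reduce (frag_cmul n c) = psmul (of_int n) (reduce c)"
  by (rule poly_mapping_eqI) simp

lemma reduce_frag_of: "reduce (frag_of s) = Poly_Mapping.single s 1"
  by (rule poly_mapping_eqI) (simp add: lookup_single when_def)

lemma reduce_boundary:
  fixes c :: "'a chain"
  shows "(reduce (chain_boundary n c) :: _ \<Rightarrow>\<^sub>0 'k::field) = bdry singular_face n (reduce c)"
proof (cases "n = 0")
  case True
  then show ?thesis by (simp add: chain_boundary_def bdry_def)
next
  case False
  have "reduce (\<Sum>j\<le>n. frag_cmul ((-1) ^ j) (frag_of (singular_face n j f))) = (\<Sum>j\<le>n. Poly_Mapping.single (singular_face n j f) ((-1) ^ j) :: _ \<Rightarrow>\<^sub>0 'k)" for f :: "(nat \<Rightarrow> real) \<Rightarrow> 'a"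
    by (simp add: reduce_sum reduce_cmul reduce_frag_of del: sum.atMost_Suc)
  moreover have "Poly_Mapping.keys (reduce c :: _ \<Rightarrow>\<^sub>0 'k) \<subseteq> Poly_Mapping.keys c" by (auto simp: in_keys_iff)
  ultimately show ?thesis using False
    by (simp add: chain_boundary_def frag_extend_def bdry_def reduce_sum reduce_cmul
        lin_superset[OF finite_keys[of c], of "reduce c"] del: sum.atMost_Suc)
qed

lemma reduce_chain: "singular_chain n X c \<Longrightarrow> reduce c \<in> chains_on (sing X n)"
  by (auto simp: singular_chain_def chains_on_def subset_iff in_keys_iff) (metis of_int_0)

text \<open>On a single simplex the identity is the image under \<open>reduce\<close> of the one for
  integral chains; linearity does the rest.\<close>

lemma chain_complex_singular: "chain_complex TYPE('k::field) (sing X) singular_face"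
  unfolding chain_complex_def
proof (intro conjI face_closed_singular allI ballI)
  fix n and c :: "_ \<Rightarrow>\<^sub>0 'k" assume c: "c \<in> chains_on (sing X (Suc n))"
  have "bdry singular_face n (bdry singular_face (Suc n) c) = (\<lambda>c. 0) c"
  proof (rule plin_eqI[OF plin_compose[OF plin_bdry plin_bdry]])
    show "plin (\<lambda>c. 0)" by (simp add: plin_def)
    fix s assume "s \<in> Poly_Mapping.keys c"
    then have s: "singular_simplex (Suc n) X s" using c by (auto simp: chains_on_def)
    have "bdry singular_face n (bdry singular_face (Suc n) (Poly_Mapping.single s (1::'k))) =
        reduce (chain_boundary n (chain_boundary (Suc n) (frag_of s)))"
      by (simp add: reduce_boundary reduce_frag_of)
    also have "chain_boundary n (chain_boundary (Suc n) (frag_of s)) = 0"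
      using chain_boundary_boundary_alt[of n X "frag_of s"] s by (simp add: singular_chain_of)
    finally show "bdry singular_face n (bdry singular_face (Suc n) (Poly_Mapping.single s (1::'k))) = 0" by simp
  qed
  then show "bdry singular_face n (bdry singular_face (Suc n) c) = 0" .
qed

section \<open>Groups with finitely generated subgroups, and universal coefficients\<close>

text \<open>All subgroups are included because the middle term of an exact sequence meets the outer
  terms only in subgroups, and because certain torsion classes will have to be finitely generated as
  well.\<close>

definition noeth :: "('g, 'm) monoid_scheme \<Rightarrow> bool" where
  "noeth G \<longleftrightarrow> (\<forall>H. subgroup H G \<longrightarrow> (\<exists>S. finite S \<and> S \<subseteq> H \<and> H \<subseteq> generate G S))"

text \<open>A subgroup \<open>H\<close> is generated by lifts of generators of its image in
  \<open>C\<close> together with images of generators of its preimage \<open>K\<close> in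
  \<open>A\<close>: after division by a product of the lifts, an element of \<open>H\<close> lies in
  the kernel of \<open>g\<close> and hence comes from \<open>K\<close>.\<close>

lemma noeth_exact:
  assumes A: "group A" and B: "group B" and C: "group C"
    and f: "f \<in> hom A B" and g: "g \<in> hom B C"
    and ex: "\<And>b. b \<in> carrier B \<Longrightarrow> g b = \<one>\<^bsub>C\<^esub> \<Longrightarrow> b \<in> f ` carrier A"
    and nA: "noeth A" and nC: "noeth C"
  shows "noeth B"
  unfolding noeth_def
proof (intro allI impI)
  interpret B: group B by (rule B)
  interpret f: group_hom A B f using A B f by (simp add: group_hom_def group_hom_axioms_def)
  interpret g: group_hom B C g using B C g by (simp add: group_hom_def group_hom_axioms_def)
  fix H assume H: "subgroup H B"
  have HB: "H \<subseteq> carrier B" using H by (rule subgroup.subset)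
  have "subgroup (g ` H) C" by (rule g.subgroup_img_is_subgroup[OF H])
  then obtain SC where SC: "finite SC" "SC \<subseteq> g ` H" "g ` H \<subseteq> generate C SC"
    using nC by (auto simp: noeth_def)
  obtain S1 where S1: "S1 \<subseteq> H" "finite S1" "SC = g ` S1" using finite_subset_image[OF SC(1,2)] by auto
  have S1B: "S1 \<subseteq> carrier B" using S1 HB by auto
  define K where "K = {a \<in> carrier A. f a \<in> H}"
  have K: "subgroup K A"
  proof (rule f.G.subgroupI)
    have "\<one>\<^bsub>A\<^esub> \<in> K" using subgroup.one_closed[OF H] by (simp add: K_def)
    then show "K \<noteq> {}" by blast
  qed (use H in \<open>auto simp: K_def intro: subgroup.m_closed subgroup.m_inv_closed\<close>)
  then obtain SA where SA: "finite SA" "SA \<subseteq> K" "K \<subseteq> generate A SA" using nA by (auto simp: noeth_def)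
  have SAA: "SA \<subseteq> carrier A" using SA(2) by (auto simp: K_def)
  let ?S = "S1 \<union> f ` SA"
  have SB: "?S \<subseteq> carrier B" using S1B SAA by auto
  have subS: "subgroup (generate B ?S) B" by (rule B.generate_is_subgroup[OF SB])
  have "H \<subseteq> generate B ?S"
  proof
    fix h assume h: "h \<in> H"
    then have hB: "h \<in> carrier B" using HB by auto
    have "g h \<in> g ` generate B S1" using SC(3) h g.generate_img[OF S1B] S1(3) by auto
    then obtain h1 where h1: "h1 \<in> generate B S1" "g h = g h1" by auto
    have h1H: "h1 \<in> H" using h1(1) B.generate_subgroup_incl[OF S1(1) H] by auto
    then have h1B: "h1 \<in> carrier B" using HB by auto
    let ?k = "inv\<^bsub>B\<^esub> h1 \<otimes>\<^bsub>B\<^esub> h"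
    have kH: "?k \<in> H" using h h1H H by (simp add: subgroup.m_closed subgroup.m_inv_closed)
    have "g ?k = \<one>\<^bsub>C\<^esub>" using h1(2) hB h1B by simp
    then obtain a where a: "a \<in> carrier A" "?k = f a" using ex[of ?k] kH HB by auto
    then have "a \<in> generate A SA" using kH SA(3) by (auto simp: K_def)
    then have "?k \<in> generate B (f ` SA)" using f.generate_img[OF SAA] a by auto
    then have "?k \<in> generate B ?S" using B.mono_generate[of "f ` SA" ?S] by auto
    moreover have "h1 \<in> generate B ?S" using h1(1) B.mono_generate[of S1 ?S] by auto
    moreover have "h = h1 \<otimes>\<^bsub>B\<^esub> ?k" using hB h1B by (simp add: B.m_assoc[symmetric])
    ultimately show "h \<in> generate B ?S" using subgroup.m_closed[OF subS] by metis
  qed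
  moreover have "?S \<subseteq> H" using S1(1) SA(2) by (auto simp: K_def)
  ultimately show "\<exists>S. finite S \<and> S \<subseteq> H \<and> H \<subseteq> generate B S"
    using S1(2) SA(1) by (intro exI[of _ ?S]) auto
qed

lemma noeth_trivial_group: "trivial_group G \<Longrightarrow> noeth G"
  unfolding noeth_def
proof (intro allI impI exI[of _ "{}"] conjI subsetI)
  fix H x assume "trivial_group G" "subgroup H G" "x \<in> H"
  then have "x = \<one>\<^bsub>G\<^esub>" using subgroup.subset[of H G] by (auto simp: trivial_group_def)
  then show "x \<in> generate G {}" by (simp add: generate.one)
qed simp_all

lemma noeth_epi:
  assumes "group A" "group B" "f \<in> hom A B" "f ` carrier A = carrier B" "noeth A"
  shows "noeth B"
proof (rule noeth_exact[OF assms(1,2) _ assms(3) _ _ assms(5)])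
  show "(\<lambda>_. 0) \<in> hom B (singleton_group (0::nat))" by (simp add: hom_def singleton_group_def)
  show "noeth (singleton_group (0::nat))" by (rule noeth_trivial_group) simp
qed (use assms(4) in auto)

lemma noeth_iso: "A \<cong> B \<Longrightarrow> group A \<Longrightarrow> group B \<Longrightarrow> noeth A \<Longrightarrow> noeth B"
  unfolding is_iso_def iso_def bij_betw_def using noeth_epi by blast

text \<open>By division with remainder, the least positive element of a nonzero subgroup generates
  it.\<close>

lemma noeth_integer_group: "noeth integer_group"
  unfolding noeth_def
proof (intro allI impI)
  fix H :: "int set" assume H: "subgroup H integer_group"
  have add: "a + b \<in> H" if "a \<in> H" "b \<in> H" for a b using subgroup.m_closed[OF H that] by simp
  have neg: "- a \<in> H" if "a \<in> H" for a using subgroup.m_inv_closed[OF H that] by simp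
  have z: "0 \<in> H" using subgroup.one_closed[OF H] by simp
  have mult: "int k * a \<in> H" if "a \<in> H" for a k
    by (induction k) (auto simp: z algebra_simps intro: add that)
  have imult: "k * a \<in> H" if "a \<in> H" for a k
    using mult[OF that, of "nat k"] mult[OF neg[OF that], of "nat (- k)"] by (cases "k \<ge> 0") auto
  show "\<exists>S. finite S \<and> S \<subseteq> H \<and> H \<subseteq> generate integer_group S"
  proof (cases "H = {0}")
    case True
    then show ?thesis by (intro exI[of _ "{0}"]) (auto intro: generate.incl)
  next
    case False
    then obtain b where "b \<in> H" "b \<noteq> 0" using z by auto
    then have "\<exists>n. n > 0 \<and> int n \<in> H"
      using neg[of b] by (intro exI[of _ "nat \<bar>b\<bar>"]) (auto simp: abs_if)
    then obtain n where n: "n > 0" "int n \<in> H" and least: "\<And>k. k < n \<Longrightarrow> \<not> (k > 0 \<and> int k \<in> H)"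
      using exists_least_iff[of "\<lambda>n. n > 0 \<and> int n \<in> H"] by metis
    have gen: "subgroup (generate integer_group {int n}) integer_group"
      by (rule group.generate_is_subgroup) auto
    have gadd: "a + b \<in> generate integer_group {int n}" if "a \<in> generate integer_group {int n}" "b \<in> generate integer_group {int n}" for a b
      using subgroup.m_closed[OF gen that] by simp
    have gneg: "- a \<in> generate integer_group {int n}" if "a \<in> generate integer_group {int n}" for a
      using subgroup.m_inv_closed[OF gen that] by simp
    have gz: "0 \<in> generate integer_group {int n}" using subgroup.one_closed[OF gen] by simp
    have gm: "int k * int n \<in> generate integer_group {int n}" for k
      by (induction k) (auto simp: gz algebra_simps intro: gadd generate.incl)
    have "x \<in> generate integer_group {int n}" if x: "x \<in> H" for x
    proof -
      have "x mod int n = x + (- (x div int n)) * int n" by (simp add: minus_div_mult_eq_mod[symmetric])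
      then have "x mod int n \<in> H" using add[OF x imult[OF n(2)]] by metis
      then have "x mod int n = 0"
      proof -
        have x0: "0 \<le> x mod int n" "nat (x mod int n) < n" using n(1) by (auto simp: nat_less_iff)
        then have "\<not> (nat (x mod int n) > 0)" using least[OF x0(2)] \<open>x mod int n \<in> H\<close> by auto
        then show ?thesis using x0(1) by simp
      qed
      then have x: "x = (x div int n) * int n" by (metis dvd_div_mult_self mod_0_imp_dvd)
      show ?thesis
      proof (cases "x div int n \<ge> 0")
        case True
        then show ?thesis using gm[of "nat (x div int n)"] x by simp
      next
        case False
        then show ?thesis using gneg[OF gm[of "nat (- (x div int n))"]] x by simp
      qed
    qed
    then show ?thesis using n(2) by (intro exI[of _ "{int n}"]) auto
  qed
qed

definition additive_subgroup_set :: "'c::ab_group_add set \<Rightarrow> bool" where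
  "additive_subgroup_set P \<longleftrightarrow> 0 \<in> P \<and> (\<forall>a\<in>P. \<forall>b\<in>P. a + b \<in> P) \<and> (\<forall>a\<in>P. - a \<in> P)"

text \<open>Finite generation of the classes of \<open>P\<close>, put as a closure principle for
  chains. It is applied with \<open>W\<close> the preimage of a subspace under
  \<open>reduce\<close>, and with \<open>W\<close> a set of divided boundaries.\<close>

lemma noeth_homology_cycles:
  assumes n: "noeth (homology_group (int n) X)"
    and P: "additive_subgroup_set P" "\<And>c. c \<in> P \<Longrightarrow> singular_relcycle n X {} c"
  shows "\<exists>T. finite T \<and> T \<subseteq> P \<and>
    (\<forall>W. additive_subgroup_set W \<longrightarrow> T \<subseteq> W \<longrightarrow> singular_relboundary_set n X {} \<subseteq> W \<longrightarrow> P \<subseteq> W)"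
proof -
  let ?Z = "relcycle_group n X {}" and ?H = "homology_group (int n) X"
  let ?cls = "homologous_rel_set n X {}"
  have hom: "?cls \<in> hom ?Z ?H"
    using normal.r_coset_hom_Mod[OF normal_subgroup_singular_relboundary_relcycle[of n X "{}"]]
    by (simp add: right_coset_singular_relboundary relative_homology_group_def)
  interpret h: group_hom ?Z ?H ?cls
    using hom by (simp add: group_hom_def group_hom_axioms_def)
  have inv: "inv\<^bsub>?Z\<^esub> c = - c" if "singular_relcycle n X {} c" for c
    using that by (intro h.G.inv_equality) (simp_all add: singular_relcycle_minus)
  have sub: "subgroup Q ?Z" if "additive_subgroup_set Q" "Q \<subseteq> P" for Q
    using that P(2) by (intro h.G.subgroupI) (auto simp: additive_subgroup_set_def inv subset_iff)
  have "subgroup (?cls ` P) ?H" by (rule h.subgroup_img_is_subgroup[OF sub[OF P(1) subset_refl]])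
  then obtain S where S: "finite S" "S \<subseteq> ?cls ` P" "?cls ` P \<subseteq> generate ?H S"
    using n by (auto simp: noeth_def)
  obtain T where T: "T \<subseteq> P" "finite T" "S = ?cls ` T" using finite_subset_image[OF S(1,2)] by auto
  show ?thesis
  proof (intro exI[of _ T] conjI T allI impI)
    fix W assume W: "additive_subgroup_set W" "T \<subseteq> W" "singular_relboundary_set n X {} \<subseteq> W"
    \<comment> \<open>\<open>W\<close> may contain chains that are not cycles; its part in
      \<open>P\<close> is a subgroup of the cycle group.\<close>
    have "additive_subgroup_set (P \<inter> W)" using P(1) W(1) by (auto simp: additive_subgroup_set_def)
    from h.subgroup_img_is_subgroup[OF sub[OF this Int_lower1]]
    have "subgroup (?cls ` (P \<inter> W)) ?H" .
    moreover have "S \<subseteq> ?cls ` (P \<inter> W)" using T W(2) by auto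
    ultimately have "generate ?H S \<subseteq> ?cls ` (P \<inter> W)" by (intro h.H.generate_subgroup_incl)
    then have *: "?cls ` P \<subseteq> ?cls ` (P \<inter> W)" using S(3) by auto
    show "P \<subseteq> W"
    proof
      fix z assume "z \<in> P"
      then obtain w where w: "w \<in> P" "w \<in> W" "?cls z = ?cls w" using * by auto
      have "homologous_rel n X {} z w"
      proof -
        have "w \<in> ?cls w" by simp
        then show ?thesis unfolding w(3)[symmetric] by simp
      qed
      then have "z - w \<in> W" using W(3) by (auto simp: homologous_rel_def)
      then have "(z - w) + w \<in> W" using W(1) w(2) unfolding additive_subgroup_set_def by blast
      then show "z \<in> W" by simp
    qed
  qed
qed

lemma additive_subgroup_set_reduce:
  assumes "pm.subspace V" shows "additive_subgroup_set {c. reduce c \<in> V}"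
  using pm.subspace_0[OF assms] pm.subspace_add[OF assms] pm.subspace_neg[OF assms]
  by (simp add: additive_subgroup_set_def reduce_add reduce_minus)

lemma frag_cmul_divide:
  assumes "\<And>s. m dvd Poly_Mapping.lookup (c :: 'a chain) s" "m \<noteq> 0"
  obtains w where "c = frag_cmul m w" "Poly_Mapping.keys w \<subseteq> Poly_Mapping.keys c"
proof
  let ?w = "Poly_Mapping.map (\<lambda>x. x div m) c"
  have l: "Poly_Mapping.lookup ?w s = Poly_Mapping.lookup c s div m" for s
    by (simp add: Poly_Mapping.map.rep_eq when_def)
  show "c = frag_cmul m ?w" using assms by (intro poly_mapping_eqI) (simp add: l)
  show "Poly_Mapping.keys ?w \<subseteq> Poly_Mapping.keys c" by (auto simp: in_keys_iff l)
qed

lemma frag_cmul_cancel: "frag_cmul m a = frag_cmul m b \<Longrightarrow> m \<noteq> 0 \<Longrightarrow> a = b"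
  by (intro poly_mapping_eqI) (metis lookup_frag_cmul mult_left_cancel)

text \<open>The integral chains with boundary divisible by \<open>p\<close> represent the mod \<open>p\<close> cycles; their
  classes are controlled by \<open>H\<^sub>n\<close> and the \<open>p\<close>-torsion of \<open>H\<^sub>n\<^sub>-\<^sub>1\<close>.\<close>

lemma additive_subgroup_set_divided_boundaries:
  assumes "additive_subgroup_set A"
  shows "additive_subgroup_set {w. \<exists>c\<in>A. chain_boundary n c = frag_cmul m w}"
  unfolding additive_subgroup_set_def
proof (intro conjI ballI)
  show "0 \<in> {w. \<exists>c\<in>A. chain_boundary n c = frag_cmul m w}"
    using assms by (auto simp: additive_subgroup_set_def intro!: bexI[of _ 0])
  fix a assume "a \<in> {w. \<exists>c\<in>A. chain_boundary n c = frag_cmul m w}"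
  then obtain c where c: "c \<in> A" "chain_boundary n c = frag_cmul m a" by auto
  show "- a \<in> {w. \<exists>c\<in>A. chain_boundary n c = frag_cmul m w}"
  proof -
    have "- frag_cmul m a = frag_cmul m (- a)" by (rule poly_mapping_eqI) simp
    then have "chain_boundary n (- c) = frag_cmul m (- a)" by (simp only: chain_boundary_minus c(2))
    moreover have "- c \<in> A" using c(1) assms by (simp add: additive_subgroup_set_def)
    ultimately show ?thesis by blast
  qed
  fix b assume "b \<in> {w. \<exists>c\<in>A. chain_boundary n c = frag_cmul m w}"
  then obtain e where e: "e \<in> A" "chain_boundary n e = frag_cmul m b" by auto
  show "a + b \<in> {w. \<exists>c\<in>A. chain_boundary n c = frag_cmul m w}"
    using c e assms
    by (auto simp: additive_subgroup_set_def chain_boundary_add frag_cmul_distrib2 intro!: bexI[of _ "c + e"])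
qed

lemma additive_subgroup_set_Int:
  "additive_subgroup_set A \<Longrightarrow> additive_subgroup_set B \<Longrightarrow> additive_subgroup_set (A \<inter> B)"
  by (auto simp: additive_subgroup_set_def)

lemma additive_subgroup_set_chains: "additive_subgroup_set {c. singular_chain n X c}"
  by (simp add: additive_subgroup_set_def singular_chain_add singular_chain_minus)

lemma additive_subgroup_set_cycles: "additive_subgroup_set {c. singular_relcycle n X {} c}"
  by (simp add: additive_subgroup_set_def singular_relcycle_add singular_relcycle_minus)

text \<open>A chain with boundary p w is determined by w up to an integral cycle. The cycles w that
  occur form the group \<open>P\<close>, generated by finitely many of them together with
  boundaries. Chosen chains over these, and representatives of generators of the homology in degree
  \<open>n\<close>, make up \<open>T\<close> after reduction.\<close>

lemma finitely_many_mod_p_cycles: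
  assumes char: "CHAR('k::field) = p" and p: "p > 0"
    and nn: "noeth (homology_group (int n) X)" "n > 0 \<Longrightarrow> noeth (homology_group (int (n - 1)) X)"
  shows "\<exists>T. finite T \<and> T \<subseteq> cycles (sing X) singular_face n \<and>
    (\<forall>c. singular_chain n X c \<longrightarrow> (\<forall>s. int p dvd Poly_Mapping.lookup (chain_boundary n c) s) \<longrightarrow>
      (reduce c :: _ \<Rightarrow>\<^sub>0 'k) \<in> pm.span (T \<union> bounds (sing X) singular_face n))"
proof -
  let ?B = "bounds (sing X) singular_face n :: (_ \<Rightarrow>\<^sub>0 'k) set"
  have p0: "of_nat p = (0::'k)" using char of_nat_CHAR[where ?'a = 'k] by simp
  have Bd: "reduce c \<in> ?B" if c: "singular_relboundary n X {} c" for c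
  proof -
    obtain e where e: "singular_chain (Suc n) X e" "chain_boundary (Suc n) e = c"
      using c by (auto simp: singular_boundary)
    have "reduce c = bdry singular_face (Suc n) (reduce e :: _ \<Rightarrow>\<^sub>0 'k)" using e(2) reduce_boundary by metis
    then show ?thesis unfolding bounds_def using reduce_chain[OF e(1)] by (rule image_eqI)
  qed
  obtain T1 where T1: "finite T1" "T1 \<subseteq> {c. singular_relcycle n X {} c}"
    "\<forall>W. additive_subgroup_set W \<longrightarrow> T1 \<subseteq> W \<longrightarrow> singular_relboundary_set n X {} \<subseteq> W \<longrightarrow> {c. singular_relcycle n X {} c} \<subseteq> W"
    using noeth_homology_cycles[OF nn(1) additive_subgroup_set_cycles[of n X]] by auto
  have cyc: "reduce c \<in> V" if V: "pm.subspace V" "reduce ` T1 \<subseteq> V" "?B \<subseteq> V" and c: "singular_relcycle n X {} c" for c and V :: "(_ \<Rightarrow>\<^sub>0 'k) set"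
  proof -
    have "{c. singular_relcycle n X {} c} \<subseteq> {c. reduce c \<in> V}"
      by (rule T1(3)[rule_format, OF additive_subgroup_set_reduce[OF V(1)]]) (use V(2,3) Bd in auto)
    then show ?thesis using c by auto
  qed
  have red_cyc: "reduce c \<in> (cycles (sing X) singular_face n :: (_ \<Rightarrow>\<^sub>0 'k) set)"
    if "singular_chain n X c" "chain_boundary n c = frag_cmul (int p) w" for c w
    using reduce_chain[OF that(1)] that(2) p0 by (simp add: cycles_def flip: reduce_boundary) (simp add: reduce_cmul)
  have T1c: "reduce ` T1 \<subseteq> (cycles (sing X) singular_face n :: (_ \<Rightarrow>\<^sub>0 'k) set)"
    using T1(2) by (auto intro!: red_cyc[of _ 0] simp: singular_cycle)
  show ?thesis
  proof (cases "n = 0")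
    case True
    show ?thesis
    proof (intro exI[of _ "reduce ` T1"] conjI allI impI)
      show "reduce c \<in> pm.span (reduce ` T1 \<union> ?B)" if "singular_chain n X c" for c
        by (rule cyc[OF pm.subspace_span])
          (use that True in \<open>auto simp: singular_cycle chain_boundary_def intro: pm.span_base\<close>)
    qed (use T1(1) T1c in auto)
  next
    case False
    then obtain m where m: "n = Suc m" by (cases n) auto
    define P where "P = {w. singular_relcycle m X {} w} \<inter> {w. \<exists>c\<in>{c. singular_chain n X c}. chain_boundary n c = frag_cmul (int p) w}"
    have "additive_subgroup_set P" unfolding P_def
      by (intro additive_subgroup_set_Int additive_subgroup_set_cycles additive_subgroup_set_divided_boundaries additive_subgroup_set_chains)
    note P = this
    have PZ: "singular_relcycle m X {} c" if "c \<in> P" for c using that by (simp add: P_def)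
    have nm: "noeth (homology_group (int m) X)" using nn(2) m by simp
    obtain T2 where T2: "finite T2" "T2 \<subseteq> P"
      "\<forall>W. additive_subgroup_set W \<longrightarrow> T2 \<subseteq> W \<longrightarrow> singular_relboundary_set m X {} \<subseteq> W \<longrightarrow> P \<subseteq> W"
      using noeth_homology_cycles[OF nm P, OF PZ] by auto
    have "\<forall>w\<in>T2. \<exists>c. singular_chain n X c \<and> chain_boundary n c = frag_cmul (int p) w" using T2(2) by (auto simp: P_def)
    then obtain g where g: "\<And>w. w \<in> T2 \<Longrightarrow> singular_chain n X (g w) \<and> chain_boundary n (g w) = frag_cmul (int p) w" by metis
    let ?T = "reduce ` T1 \<union> (\<lambda>w. reduce (g w)) ` T2 :: (_ \<Rightarrow>\<^sub>0 'k) set"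
    let ?V = "pm.span (?T \<union> ?B)"
    have V: "reduce ` T1 \<subseteq> ?V" "?B \<subseteq> ?V" "(\<lambda>w. reduce (g w)) ` T2 \<subseteq> ?V" by (auto intro: pm.span_base)
    note cycV = cyc[OF pm.subspace_span V(1,2)]
    define W where "W = {w. \<exists>c\<in>{c. singular_chain n X c} \<inter> {c. reduce c \<in> ?V}. chain_boundary n c = frag_cmul (int p) w}"
    have W: "additive_subgroup_set W" unfolding W_def
      by (intro additive_subgroup_set_Int additive_subgroup_set_divided_boundaries additive_subgroup_set_chains
          additive_subgroup_set_reduce pm.subspace_span)
    have "P \<subseteq> W"
    proof (rule T2(3)[rule_format, OF W])
      show "T2 \<subseteq> W" using g V(3) by (auto simp: W_def)
      \<comment> \<open>If w is the boundary of e, then p e has boundary p w and reduces to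
        zero.\<close>
      show "singular_relboundary_set m X {} \<subseteq> W"
      proof
      fix w assume "w \<in> singular_relboundary_set m X {}"
      then obtain e where e: "singular_chain n X e" "chain_boundary n e = w" by (auto simp: singular_boundary m)
      have "reduce (frag_cmul (int p) e) \<in> ?V" by (simp add: reduce_cmul p0 pm.span_zero)
      then show "w \<in> W" using e unfolding W_def
        by (intro CollectI bexI[of _ "frag_cmul (int p) e"]) (simp_all add: singular_chain_cmul chain_boundary_cmul)
      qed
    qed
    show ?thesis
    proof (intro exI[of _ ?T] conjI allI impI)
      show "finite ?T" using T1 T2 by simp
      have "reduce (g w) \<in> (cycles (sing X) singular_face n :: (_ \<Rightarrow>\<^sub>0 'k) set)" if "w \<in> T2" for w
        by (rule red_cyc[OF conjunct1[OF g[OF that]] conjunct2[OF g[OF that]]])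
      then show "?T \<subseteq> cycles (sing X) singular_face n" using T1c by auto
      fix c assume c: "singular_chain n X c" and dvd: "\<forall>s. int p dvd Poly_Mapping.lookup (chain_boundary n c) s"
      obtain w where w: "chain_boundary n c = frag_cmul (int p) w" "Poly_Mapping.keys w \<subseteq> Poly_Mapping.keys (chain_boundary n c)"
        using frag_cmul_divide[OF dvd[rule_format]] p by auto
      have "singular_chain m X w" using w(2) singular_chain_boundary[OF c] m by (auto simp: singular_chain_def)
      moreover have "frag_cmul (int p) (chain_boundary m w) = frag_cmul (int p) 0"
        using chain_boundary_boundary_alt[of m X c] c w(1) m by (simp flip: chain_boundary_cmul)
      then have "chain_boundary m w = 0" using frag_cmul_cancel p by force
      ultimately have "w \<in> P" using c w(1) by (auto simp: P_def singular_cycle)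
      then obtain c' where c': "singular_chain n X c'" "chain_boundary n c' = frag_cmul (int p) w" "reduce c' \<in> ?V"
        using \<open>P \<subseteq> W\<close> by (auto simp: W_def)
      have "singular_relcycle n X {} (c - c')"
        using c c' w(1) by (simp add: singular_cycle singular_chain_diff chain_boundary_diff)
      from cycV[OF this] have "reduce (c - c') \<in> ?V" .
      from pm.span_add[OF this c'(3)] show "reduce c \<in> ?V" by (simp add: reduce_diff)
    qed
  qed
qed

text \<open>A cycle over the field combines integral chains whose boundaries need not be divisible
  by p individually. If some boundary has a coefficient prime to p, that coefficient is invertible
  in the field, and closedness of the cycle expresses one scalar as an integral combination of the
  others; eliminating it shortens the sum. This handles fields larger than the prime field.\<close>

lemma hom_le_of_noeth:
  assumes char: "CHAR('k::field) = p" and p: "prime p"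
    and nn: "noeth (homology_group (int n) X)" "n > 0 \<Longrightarrow> noeth (homology_group (int (n - 1)) X)"
  shows "\<exists>m. hom_le TYPE('k) (sing X) singular_face n m"
proof -
  obtain T where T: "finite T" "T \<subseteq> cycles (sing X) singular_face n"
    "\<forall>c. singular_chain n X c \<longrightarrow> (\<forall>s. int p dvd Poly_Mapping.lookup (chain_boundary n c) s) \<longrightarrow>
      (reduce c :: _ \<Rightarrow>\<^sub>0 'k) \<in> pm.span (T \<union> bounds (sing X) singular_face n)"
    using finitely_many_mod_p_cycles[OF char prime_gt_0_nat[OF p] nn] by auto
  let ?V = "pm.span (T \<union> bounds (sing X) singular_face n)"
  have main: "z \<in> ?V"
    if "finite J" "z = (\<Sum>j\<in>J. psmul (a j) (reduce (c j)))" "\<And>j. j \<in> J \<Longrightarrow> singular_chain n X (c j)" "bdry singular_face n z = 0"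
    for J :: "((nat \<Rightarrow> real) \<Rightarrow> 'a) set" and a c and z :: "_ \<Rightarrow>\<^sub>0 'k"
    using that
  proof (induction "card J" arbitrary: J c)
    case 0
    then show ?case by (simp add: pm.span_zero)
  next
    case (Suc r)
    show ?case
    proof (cases "\<forall>j\<in>J. \<forall>s. int p dvd Poly_Mapping.lookup (chain_boundary n (c j)) s")
      case True
      then show ?thesis unfolding Suc(4) using T(3) Suc(5) by (intro pm.span_sum pm.span_scale) blast
    next
      case False
      then obtain i s where i: "i \<in> J" and "\<not> int p dvd Poly_Mapping.lookup (chain_boundary n (c i)) s" by blast
      define \<mu> where "\<mu> j = Poly_Mapping.lookup (chain_boundary n (c j)) s" for j
      have nd: "\<not> int p dvd \<mu> i" using \<open>\<not> int p dvd _\<close> by (simp add: \<mu>_def)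
      then have "coprime (int p) (\<mu> i)" using p by (simp add: prime_imp_coprime)
      \<comment> \<open>The Bezout coefficient \<open>v\<close> inverts \<open>\<mu> i\<close>
        modulo p.\<close>
      then obtain u v where "u * int p + v * \<mu> i = 1" using bezout_int[of "int p" "\<mu> i"] by auto
      then have "of_int (u * int p + v * \<mu> i) = (1::'k)" by simp
      moreover have "of_nat p = (0::'k)" using char of_nat_CHAR[where ?'a = 'k] by simp
      ultimately have v: "of_int (\<mu> i) * of_int v = (1::'k)" by (simp add: mult.commute)
      have "0 = Poly_Mapping.lookup (bdry singular_face n z) s" using Suc(6) by simp
      also have "\<dots> = (\<Sum>j\<in>J. a j * of_int (\<mu> j))"
        unfolding Suc(4) plin_sum[OF plin_bdry] plin_smul[OF plin_bdry]
        by (simp add: lookup_sum \<mu>_def flip: reduce_boundary)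
      also have "\<dots> = a i * of_int (\<mu> i) + (\<Sum>j\<in>J - {i}. a j * of_int (\<mu> j))"
        by (rule sum.remove[OF Suc(3) i])
      finally have "a i * of_int (\<mu> i) = - (\<Sum>j\<in>J - {i}. a j * of_int (\<mu> j))" by (simp add: eq_neg_iff_add_eq_0)
      then have "a i * (of_int (\<mu> i) * of_int v) = - (\<Sum>j\<in>J - {i}. a j * of_int (\<mu> j)) * of_int v"
        by (simp only: mult.assoc[symmetric])
      then have ai: "a i = (\<Sum>j\<in>J - {i}. a j * of_int (- \<mu> j * v))"
        unfolding v by (simp add: sum_distrib_right sum_negf mult.assoc)
      \<comment> \<open>The elimination keeps the scalars \<open>a j\<close> and absorbs a multiple
        of \<open>c i\<close> into each \<open>c j\<close>, so the chains stay integral.\<close>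
      define e where "e j = c j + frag_cmul (- \<mu> j * v) (c i)" for j
      have "z = psmul (a i) (reduce (c i)) + (\<Sum>j\<in>J - {i}. psmul (a j) (reduce (c j)))"
        unfolding Suc(4) by (rule sum.remove[OF Suc(3) i])
      also have "psmul (a i) (reduce (c i)) = (\<Sum>j\<in>J - {i}. psmul (a j * of_int (- \<mu> j * v)) (reduce (c i)))"
        unfolding ai by (rule pm.scale_sum_left)
      also have "(\<Sum>j\<in>J - {i}. psmul (a j * of_int (- \<mu> j * v)) (reduce (c i))) + (\<Sum>j\<in>J - {i}. psmul (a j) (reduce (c j)))
          = (\<Sum>j\<in>J - {i}. psmul (a j) (reduce (e j)))"
        unfolding sum.distrib[symmetric] e_def reduce_add reduce_cmul pm.scale_right_distrib
        by (intro sum.cong refl) (simp add: add.commute)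
      finally have z: "z = (\<Sum>j\<in>J - {i}. psmul (a j) (reduce (e j)))" .
      have ch: "singular_chain n X (e j)" if "j \<in> J - {i}" for j
        using that Suc(5) i by (simp add: e_def singular_chain_add singular_chain_cmul)
      have "r = card (J - {i})" using Suc(2,3) i by simp
      then show ?thesis using Suc(1)[of "J - {i}" e] z ch Suc(3,6) by blast
    qed
  qed
  have "(cycles (sing X) singular_face n :: (_ \<Rightarrow>\<^sub>0 'k) set) \<subseteq> ?V"
  proof
    fix z :: "_ \<Rightarrow>\<^sub>0 'k" assume "z \<in> cycles (sing X) singular_face n"
    then have z: "Poly_Mapping.keys z \<subseteq> sing X n" "bdry singular_face n z = 0" by (auto simp: cycles_def chains_on_def)
    show "z \<in> ?V"
    proof (rule main[OF finite_keys[of z] _ _ z(2), of "Poly_Mapping.lookup z" frag_of])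
      show "z = (\<Sum>j\<in>Poly_Mapping.keys z. psmul (Poly_Mapping.lookup z j) (reduce (frag_of j)))"
        using poly_mapping_expand[of z] by (simp only: reduce_frag_of)
      show "singular_chain n X (frag_of j)" if "j \<in> Poly_Mapping.keys z" for j
        using that z(1) by (auto simp: singular_chain_of)
    qed
  qed
  then show ?thesis using T(1,2) unfolding hom_le_def spans_mod_def by blast
qed

section \<open>Homology of compact CW complexes\<close>

definition noeth_homology :: "'a topology \<Rightarrow> bool" where
  "noeth_homology X \<longleftrightarrow> (\<forall>p. noeth (homology_group p X))"

lemma noeth_homology_homotopy_equivalent:
  "X homotopy_equivalent_space Y \<Longrightarrow> noeth_homology X \<Longrightarrow> noeth_homology Y"
  unfolding noeth_homology_def
  by (meson homotopy_equivalent_space_imp_isomorphic_homology_groups noeth_iso group_relative_homology_group)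

lemma noeth_homology_empty: "topspace X = {} \<Longrightarrow> noeth_homology X"
  unfolding noeth_homology_def
  by (simp add: trivial_homology_group_empty noeth_trivial_group)

text \<open>The reduced group is the kernel of the map to the homology of a point, which is infinite
  cyclic or trivial.\<close>

lemma noeth_homology_of_reduced:
  assumes "\<And>p. noeth (reduced_homology_group p X)"
  shows "noeth_homology X"
  unfolding noeth_homology_def
proof
  fix p
  let ?D = "discrete_topology {()}"
  let ?g = "hom_induced p X {} ?D {} (\<lambda>x. ())"
  have nD: "noeth (homology_group p ?D)"
  proof (cases "p = 0")
    case True
    have "homology_group 0 ?D \<cong> integer_group" by (rule homology_coefficients[of _ "()"]) simp
    then have "integer_group \<cong> homology_group 0 ?D" by (simp add: group.iso_sym)
    then show ?thesis unfolding True by (rule noeth_iso) (simp_all add: noeth_integer_group)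
  next
    case False
    then show ?thesis by (intro noeth_trivial_group homology_dimension_axiom[of _ "()"]) auto
  qed
  have hom: "(\<lambda>x. x) \<in> hom (reduced_homology_group p X) (homology_group p X)"
    using carrier_reduced_homology_group_subset[of p X]
    by (auto simp: hom_def reduced_homology_group_def subgroup_generated_def)
  show "noeth (homology_group p X)"
  proof (rule noeth_exact[OF _ _ _ hom hom_induced_empty_hom _ assms nD])
    show "b \<in> (\<lambda>x. x) ` carrier (reduced_homology_group p X)"
      if "b \<in> carrier (homology_group p X)" "?g b = \<one>\<^bsub>homology_group p ?D\<^esub>" for b
      using that by (simp add: carrier_reduced_homology_group kernel_def)
  qed simp_all
qed

lemma noeth_homology_contractible: "contractible_space X \<Longrightarrow> noeth_homology X"
  by (intro noeth_homology_of_reduced noeth_trivial_group trivial_reduced_homology_group_contractible_space)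

lemma noeth_homology_nsphere: "noeth_homology (nsphere n)"
proof (rule noeth_homology_of_reduced)
  fix p :: int
  show "noeth (reduced_homology_group p (nsphere n))"
  proof (cases "p = int n")
    case True
    have "integer_group \<cong> reduced_homology_group (int n) (nsphere n)"
      using reduced_homology_group_nsphere(1)[of n] by (simp add: group.iso_sym)
    then show ?thesis unfolding True by (rule noeth_iso) (simp_all add: noeth_integer_group)
  next
    case False
    then show ?thesis by (intro noeth_trivial_group reduced_homology_group_nsphere(2))
  qed
qed

section \<open>Discs, punctured discs and spheres\<close>

definition nrm :: "nat \<Rightarrow> (nat \<Rightarrow> real) \<Rightarrow> real" where
  "nrm n x = sqrt (\<Sum>i<n. (x i)\<^sup>2)"

lemma nrm_ge_0 [simp]: "0 \<le> nrm n x"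
  by (simp add: nrm_def sum_nonneg)

lemma nrm_scale: "nrm n (\<lambda>i. c * x i) = \<bar>c\<bar> * nrm n x"
proof -
  have "(\<Sum>i<n. (c * x i)\<^sup>2) = c\<^sup>2 * (\<Sum>i<n. (x i)\<^sup>2)" by (simp add: power_mult_distrib sum_distrib_left)
  then show ?thesis by (simp add: nrm_def real_sqrt_mult)
qed

lemma nrm_eq_0: "(\<forall>i\<ge>n. x i = 0) \<Longrightarrow> nrm n x = 0 \<longleftrightarrow> x = (\<lambda>i. 0)"
proof -
  assume h: "\<forall>i\<ge>n. x i = 0"
  have "nrm n x = 0 \<longleftrightarrow> (\<forall>i<n. x i = 0)" by (simp add: nrm_def sum_nonneg_eq_0_iff Ball_def)
  then show ?thesis using h unfolding fun_eq_iff by (metis linorder_not_less)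
qed

lemma nrm_half [simp]: "nrm n (\<lambda>i. x i / 2) = nrm n x / 2"
  using nrm_scale[of n "1/2" x] by simp

lemma sum_sq_le_1: "(\<Sum>i<n. (x i)\<^sup>2) \<le> 1 \<longleftrightarrow> nrm n x \<le> 1" and sum_sq_less_1: "(\<Sum>i<n. (x i)\<^sup>2) < 1 \<longleftrightarrow> nrm n x < 1"
  and sum_sq_eq_1: "(\<Sum>i<n. (x i)\<^sup>2) = 1 \<longleftrightarrow> nrm n x = 1"
  by (simp_all add: nrm_def)

lemma disc_eq: "disc n = subtopology (powertop_real UNIV) {x. (\<forall>i\<ge>n. x i = 0) \<and> nrm n x \<le> 1}"
  by (simp add: disc_def Euclidean_space_def subtopology_subtopology sum_sq_le_1 Collect_conj_eq)

lemma open_disc_eq: "open_disc n = subtopology (powertop_real UNIV) {x. (\<forall>i\<ge>n. x i = 0) \<and> nrm n x < 1}"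
  by (simp add: open_disc_def Euclidean_space_def subtopology_subtopology sum_sq_less_1 Collect_conj_eq)

lemma topspace_disc: "topspace (disc n) = {x. (\<forall>i\<ge>n. x i = 0) \<and> nrm n x \<le> 1}"
  and topspace_open_disc: "topspace (open_disc n) = {x. (\<forall>i\<ge>n. x i = 0) \<and> nrm n x < 1}"
  by (simp_all add: disc_eq open_disc_eq)

lemma boundary_sphere_eq: "boundary_sphere n = {x. (\<forall>i\<ge>n. x i = 0) \<and> nrm n x = 1}"
  by (auto simp: boundary_sphere_def topspace_disc topspace_open_disc)

lemma continuous_map_nrm: "continuous_map (powertop_real UNIV) euclideanreal (nrm n)"
proof -
  have "continuous_map (powertop_real UNIV) euclideanreal (\<lambda>x :: nat \<Rightarrow> real. \<Sum>i<n. (x i)\<^sup>2)"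
    by (intro continuous_map_sum continuous_map_real_pow continuous_map_product_projection) auto
  moreover have "continuous_map euclideanreal euclideanreal sqrt" by (simp add: continuous_on_real_sqrt)
  ultimately have "continuous_map (powertop_real UNIV) euclideanreal (sqrt \<circ> (\<lambda>x :: nat \<Rightarrow> real. \<Sum>i<n. (x i)\<^sup>2))"
    by (rule continuous_map_compose)
  then show ?thesis by (simp add: nrm_def[abs_def] o_def)
qed

lemma continuous_map_scaled:
  assumes "continuous_map P euclideanreal f" "continuous_map P (powertop_real UNIV) g"
  shows "continuous_map P (powertop_real UNIV) (\<lambda>u i. f u * g u i)"
  using assms by (simp add: continuous_map_componentwise_UNIV continuous_map_real_mult)

lemma contractible_open_disc: "contractible_space (open_disc n)"
proof -
  let ?I = "top_of_set {0..1::real}" and ?h = "\<lambda>(t, x) i. (1 - t) * x i :: real"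
  have f1: "continuous_map (prod_topology ?I (open_disc n)) euclideanreal (\<lambda>u. 1 - fst u)"
    using continuous_map_into_fulltopology[OF continuous_map_fst] by (intro continuous_intros) auto
  have f2: "continuous_map (prod_topology ?I (open_disc n)) (powertop_real UNIV) snd"
    unfolding open_disc_eq by (rule continuous_map_into_fulltopology[OF continuous_map_snd])
  have "continuous_map (prod_topology ?I (open_disc n)) (powertop_real UNIV) ?h"
    using continuous_map_scaled[OF f1 f2] by (simp add: case_prod_unfold)
  moreover have "?h u \<in> {x. (\<forall>i\<ge>n. x i = 0) \<and> nrm n x < 1}" if u0: "u \<in> topspace (prod_topology ?I (open_disc n))" for u
  proof -
    obtain t x where u: "u = (t, x)" "0 \<le> t" "t \<le> 1" "\<forall>i\<ge>n. x i = 0" "nrm n x < 1"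
      using u0 by (cases u) (auto simp: topspace_open_disc)
    have "\<bar>1 - t\<bar> * nrm n x \<le> 1 * nrm n x" using u by (intro mult_right_mono) auto
    then show ?thesis using u by (simp add: nrm_scale)
  qed
  ultimately have "continuous_map (prod_topology ?I (open_disc n)) (open_disc n) ?h"
    by (simp add: open_disc_eq continuous_map_in_subtopology image_subset_iff Pi_iff)
  then have "homotopic_with (\<lambda>x. True) (open_disc n) (open_disc n) id (\<lambda>x i. 0)"
    by (subst homotopic_with) (auto intro!: exI[of _ ?h])
  then show ?thesis unfolding contractible_space_def by blast
qed

definition punctured_disc :: "nat \<Rightarrow> (nat \<Rightarrow> real) topology" where
  "punctured_disc n = subtopology (powertop_real UNIV) {x. (\<forall>i\<ge>n. x i = 0) \<and> nrm n x < 1 \<and> nrm n x \<noteq> 0}"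

lemma nsphere_eq: "nsphere n = subtopology (powertop_real UNIV) {x. (\<forall>i\<ge>Suc n. x i = 0) \<and> nrm (Suc n) x = 1}"
proof -
  have "{x. (\<Sum>i\<le>n. (x i)\<^sup>2) = 1 \<and> (\<forall>i>n. x i = 0)} = {x. (\<forall>i\<ge>Suc n. x i = 0) \<and> nrm (Suc n) x = 1}"
    by (auto simp: sum_sq_eq_1[symmetric] lessThan_Suc_atMost Suc_le_eq)
  then show ?thesis by (simp add: nsphere)
qed

text \<open>The punctured disc contracts radially onto the sphere of radius 1/2, which lies inside
  the open disc. For n = 0 nothing is left after puncturing.\<close>

lemma noeth_homology_punctured_disc: "noeth_homology (punctured_disc n)"
proof (cases n)
  case 0
  then show ?thesis by (intro noeth_homology_empty) (auto simp: punctured_disc_def nrm_def)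
next
  case (Suc m)
  let ?P = "punctured_disc n" and ?S = "nsphere m"
  let ?I = "top_of_set {0..1::real}"
  define f where "f = (\<lambda>x i. inverse (nrm n x) * x i)"
  define g where "g = (\<lambda>(x :: nat \<Rightarrow> real) i. (1/2) * x i)"
  have S: "?S = subtopology (powertop_real UNIV) {x. (\<forall>i\<ge>n. x i = 0) \<and> nrm n x = 1}"
    by (simp add: nsphere_eq Suc)
  have cn: "continuous_map ?P euclideanreal (\<lambda>x. inverse (nrm n x))"
    unfolding punctured_disc_def
    by (intro continuous_map_real_inverse continuous_map_from_subtopology continuous_map_nrm) auto
  have idP: "continuous_map ?P (powertop_real UNIV) (\<lambda>x. x)"
    unfolding punctured_disc_def by (rule continuous_map_from_subtopology) simp
  have idS: "continuous_map ?S (powertop_real UNIV) (\<lambda>x. x)"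
    unfolding S by (rule continuous_map_from_subtopology) simp
  have "continuous_map ?P (powertop_real UNIV) f" unfolding f_def by (rule continuous_map_scaled[OF cn idP])
  then have cf: "continuous_map ?P ?S f"
    by (auto simp: S continuous_map_in_subtopology f_def nrm_scale punctured_disc_def)
  have "continuous_map ?S (powertop_real UNIV) g" unfolding g_def by (rule continuous_map_scaled[OF _ idS]) simp
  then have cg: "continuous_map ?S ?P g"
    by (auto simp: S continuous_map_in_subtopology g_def nrm_scale punctured_disc_def)
  have fg: "f (g x) = x" if "x \<in> topspace ?S" for x
    using that by (simp add: S f_def g_def nrm_scale fun_eq_iff)
  have "homotopic_with (\<lambda>x. True) ?S ?S (f \<circ> g) id"
    by (rule homotopic_with_equal) (use fg continuous_map_compose[OF cg cf] in auto)
  moreover have "homotopic_with (\<lambda>x. True) ?P ?P (g \<circ> f) id"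
  proof -
    \<comment> \<open>Along each ray the radius interpolates linearly between 1/2 and the radius of
      \<open>x\<close>, so it stays strictly between 0 and 1.\<close>
    let ?h = "\<lambda>(t, x) i. ((1 - t) * (inverse (nrm n x) / 2) + t) * x i :: real"
    let ?IP = "prod_topology ?I ?P"
    have s: "continuous_map ?IP ?P snd" by (rule continuous_map_snd)
    have t: "continuous_map ?IP euclideanreal fst"
      using continuous_map_into_fulltopology[OF continuous_map_fst] .
    have i: "continuous_map ?IP euclideanreal (\<lambda>u. inverse (nrm n (snd u)))"
      using continuous_map_compose[OF s cn] by (simp add: o_def)
    have 1: "continuous_map ?IP euclideanreal (\<lambda>u. (1 - fst u) * (inverse (nrm n (snd u)) / 2) + fst u)"
      using t i by (intro continuous_map_add continuous_map_real_mult continuous_map_diff continuous_map_real_divide) auto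
    have 2: "continuous_map ?IP (powertop_real UNIV) snd"
      using continuous_map_compose[OF s idP] by (simp add: o_def)
    have "continuous_map ?IP (powertop_real UNIV) ?h"
      using continuous_map_scaled[OF 1 2] by (simp add: case_prod_unfold)
    moreover have "?h u \<in> {x. (\<forall>i\<ge>n. x i = 0) \<and> nrm n x < 1 \<and> nrm n x \<noteq> 0}" if u0: "u \<in> topspace ?IP" for u
    proof -
      obtain t x where u: "u = (t, x)" "0 \<le> t" "t \<le> 1" "\<forall>i\<ge>n. x i = 0" "nrm n x < 1" "nrm n x \<noteq> 0"
        using u0 by (cases u) (auto simp: punctured_disc_def)
      have pos: "nrm n x > 0" using u(6) nrm_ge_0[of n x] by linarith
      let ?c = "(1 - t) * (inverse (nrm n x) / 2) + t"
      have "?c \<ge> 0" using u pos by simp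
      have e: "nrm n (\<lambda>i. ?c * x i) = (1 - t) * (1/2) + t * nrm n x"
      proof -
        have "nrm n (\<lambda>i. ?c * x i) = ?c * nrm n x" unfolding nrm_scale using \<open>?c \<ge> 0\<close> by simp
        also have "?c * nrm n x = (1 - t) * (1/2) + t * nrm n x" using pos by (simp add: field_simps)
        finally show ?thesis .
      qed
      have "(1 - t) * (1/2) + t * nrm n x < 1 \<and> (1 - t) * (1/2) + t * nrm n x > 0"
      proof (cases "t = 1")
        case True
        then show ?thesis using u pos by simp
      next
        case False
        have "t * nrm n x \<le> t" "0 \<le> t * nrm n x" using u pos by (simp_all add: mult_left_le)
        moreover have "t < 1" using False u(3) by simp
        moreover have "(1 - t) * (1/2) = 1/2 - t/2" by (simp add: field_simps)
        ultimately show ?thesis unfolding \<open>(1 - t) * (1/2) = 1/2 - t/2\<close> by simp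
      qed
      then show ?thesis using u e by auto
    qed
    ultimately have "continuous_map ?IP ?P ?h"
      by (simp add: punctured_disc_def continuous_map_in_subtopology image_subset_iff Pi_iff)
    then show ?thesis
      by (subst homotopic_with) (auto intro!: exI[of _ ?h] simp: f_def g_def fun_eq_iff)
  qed
  ultimately have "?S homotopy_equivalent_space ?P"
    unfolding homotopy_equivalent_space_def using cf cg by blast
  then show ?thesis by (rule noeth_homology_homotopy_equivalent[OF _ noeth_homology_nsphere])
qed

text \<open>The disc is closed in a product of intervals, which is compact by Tychonoff's
  theorem.\<close>

lemma compact_space_disc: "compact_space (disc n)"
proof -
  let ?K = "{x. (\<forall>i\<ge>n. x i = 0) \<and> nrm n x \<le> 1}"
  have K: "?K = (\<Inter>i\<in>{n..}. {x \<in> topspace (powertop_real UNIV). x i \<in> {0}}) \<inter> {x \<in> topspace (powertop_real UNIV). nrm n x \<in> {..1}}"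
    by auto
  have "closedin (powertop_real UNIV) ?K"
    unfolding K
  proof (intro closedin_Int closedin_Inter)
    show "closedin (powertop_real UNIV) {x \<in> topspace (powertop_real UNIV). nrm n x \<in> {..1}}"
      by (rule closedin_continuous_map_preimage[OF continuous_map_nrm]) simp
    fix A assume "A \<in> (\<lambda>i. {x \<in> topspace (powertop_real UNIV). x i \<in> {0::real}}) ` {n..}"
    then obtain i where "A = {x \<in> topspace (powertop_real UNIV). x i \<in> {0::real}}" by blast
    moreover have "closedin (powertop_real UNIV) {x \<in> topspace (powertop_real UNIV). x i \<in> {0::real}}"
      by (rule closedin_continuous_map_preimage[OF continuous_map_product_projection]) auto
    ultimately show "closedin (powertop_real UNIV) A" by simp
  qed simp
  moreover have "compactin (powertop_real UNIV) (UNIV \<rightarrow>\<^sub>E {-1..1})" by (simp add: compactin_PiE)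
  moreover have "?K \<subseteq> (UNIV \<rightarrow>\<^sub>E {-1..1})"
  proof
    fix x assume x: "x \<in> ?K"
    have "x i \<in> {-1..1}" for i
    proof (cases "i < n")
      case True
      have "(x i)\<^sup>2 \<le> (\<Sum>i<n. (x i)\<^sup>2)" using True by (intro member_le_sum) auto
      then have "(x i)\<^sup>2 \<le> 1" using x sum_sq_le_1[where x = x and n = n] by simp
      then show ?thesis by (simp add: abs_square_le_1 abs_le_iff)
    qed (use x in auto)
    then show "x \<in> (UNIV \<rightarrow>\<^sub>E {-1..1})" by auto
  qed
  ultimately have "compactin (powertop_real UNIV) ?K" using closed_compactin by blast
  then show ?thesis unfolding disc_eq by (rule compact_space_subtopology)
qed

lemma noeth_exact_seq:
  assumes "exact_seq ([C, B, A], [g, f])" "noeth A" "noeth C" shows "noeth B"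
proof -
  have h: "group_hom A B f" "group C" "g \<in> hom B C" "kernel B C g = f ` carrier A"
    using assms(1) by auto
  show ?thesis
  proof (rule noeth_exact[of A B C f g])
    show "b \<in> f ` carrier A" if "b \<in> carrier B" "g b = \<one>\<^bsub>C\<^esub>" for b
      using that h(4) by (auto simp: kernel_def)
  qed (use h assms in \<open>auto simp: group_hom_def group_hom_axioms_def\<close>)
qed

lemma noeth_homology_of_pair:
  assumes "noeth_homology (subtopology X S)" "\<And>p. noeth (relative_homology_group p X S)"
  shows "noeth_homology X"
  unfolding noeth_homology_def
proof
  fix p
  show "noeth (homology_group p X)"
    using assms by (intro noeth_exact_seq[OF homology_exactness_axiom_3[of p X S]]) (auto simp: noeth_homology_def)
qed

lemma noeth_relative_homology:
  assumes "noeth_homology (subtopology X S)" "noeth_homology X"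
  shows "noeth (relative_homology_group p X S)"
  using assms by (intro noeth_exact_seq[OF homology_exactness_axiom_1[of p X S]]) (auto simp: noeth_homology_def)

text \<open>\<open>A\<close> is a deformation retract of the complement of the centre of the attached cell: push radially.\<close>

locale attached_cell =
  fixes Z :: "'a topology" and A :: "'a set" and n :: nat and \<Phi> :: "(nat \<Rightarrow> real) \<Rightarrow> 'a"
  assumes Z: "Hausdorff_space Z" and A: "closedin Z A"
    and \<Phi>: "continuous_map (disc n) Z \<Phi>"
    and cell: "homeomorphic_map (open_disc n) (subtopology Z (topspace Z - A)) \<Phi>"
    and bd: "\<Phi> ` boundary_sphere n \<subseteq> A"
begin

abbreviation "e \<equiv> topspace Z - A"
abbreviation "z \<equiv> (\<lambda>i::nat. 0 :: real)"
abbreviation "V \<equiv> topspace Z - {\<Phi> z}"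
abbreviation "I \<equiv> top_of_set {0..1::real}"

lemma z_in: "z \<in> topspace (open_disc n)" "z \<in> topspace (disc n)"
  by (simp_all add: topspace_open_disc topspace_disc nrm_def)

lemma A_sub: "A \<subseteq> topspace Z" using A by (rule closedin_subset)

lemma cell_image: "\<Phi> ` topspace (open_disc n) = e"
  using homeomorphic_imp_surjective_map[OF cell] by (simp add: Int_absorb1)

lemma cell_inj: "inj_on \<Phi> (topspace (open_disc n))"
  by (rule homeomorphic_imp_injective_map[OF cell])

lemma centre: "\<Phi> z \<in> e" using cell_image z_in(1) by blast

lemma disc_cases: "x \<in> topspace (disc n) \<Longrightarrow> x \<in> topspace (open_disc n) \<or> x \<in> boundary_sphere n"
  by (auto simp: topspace_disc topspace_open_disc boundary_sphere_eq)

lemma \<Phi>_in_A: "x \<in> topspace (disc n) \<Longrightarrow> \<Phi> x \<in> A \<longleftrightarrow> x \<in> boundary_sphere n"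
  using disc_cases[of x] cell_image bd by (auto simp: boundary_sphere_eq topspace_open_disc)

lemma \<Phi>_centre: "x \<in> topspace (disc n) \<Longrightarrow> \<Phi> x = \<Phi> z \<longleftrightarrow> x = z"
  using disc_cases[of x] centre bd cell_inj z_in(1) by (auto simp: inj_on_def)

definition \<psi> where "\<psi> = inv_into (topspace (open_disc n)) \<Phi>"

lemma \<psi>: "x \<in> topspace (open_disc n) \<Longrightarrow> \<psi> (\<Phi> x) = x"
  unfolding \<psi>_def by (rule inv_into_f_f[OF cell_inj])

text \<open>The factor is chosen so that the radius |x| becomes (1 - t) |x| + t, which is 1 at time
  1; points of the boundary sphere do not move.\<close>

definition r where "r = (\<lambda>(t, x) i. ((1 - t) + t * inverse (nrm n x)) * x i :: real)"
definition h where "h = (\<lambda>(t, w). if w \<in> A then w else \<Phi> (r (t, \<psi> w)))"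

lemma nrm_pos: "x \<in> topspace (disc n) - {z} \<Longrightarrow> nrm n x > 0"
  using nrm_eq_0[of n x] nrm_ge_0[of n x] by (auto simp: topspace_disc less_le)

lemma nrm_r:
  assumes "x \<in> topspace (disc n) - {z}" "0 \<le> t" "t \<le> 1"
  shows "nrm n (r (t, x)) = (1 - t) * nrm n x + t"
proof -
  have pos: "nrm n x > 0" by (rule nrm_pos[OF assms(1)])
  have "(1 - t) + t * inverse (nrm n x) \<ge> 0" using assms pos by simp
  then have "nrm n (r (t, x)) = ((1 - t) + t * inverse (nrm n x)) * nrm n x"
    unfolding r_def by (simp only: case_prod_conv nrm_scale abs_of_nonneg)
  also have "\<dots> = (1 - t) * nrm n x + t" using pos by (simp add: field_simps)
  finally show ?thesis .
qed

lemma r_in: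
  assumes x: "x \<in> topspace (disc n) - {z}" and t: "0 \<le> t" "t \<le> 1"
  shows "r (t, x) \<in> topspace (disc n) - {z}"
proof -
  have pos: "nrm n x > 0" by (rule nrm_pos[OF x])
  have le: "nrm n x \<le> 1" "\<forall>i\<ge>n. x i = 0" using x by (auto simp: topspace_disc)
  have "(1 - t) * nrm n x \<le> (1 - t) * 1" using t le by (intro mult_left_mono) auto
  then have 1: "nrm n (r (t, x)) \<le> 1" using nrm_r[OF x t] by simp
  have "(1 - t) * nrm n x \<ge> 0" "t < 1 \<longrightarrow> (1 - t) * nrm n x > 0" using t pos by auto
  then have "nrm n (r (t, x)) > 0" using nrm_r[OF x t] t by (cases "t = 1") auto
  then have "r (t, x) \<noteq> z" by (auto simp: nrm_def)
  moreover have "\<forall>i\<ge>n. r (t, x) i = 0" using le(2) by (simp add: r_def)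
  ultimately show ?thesis using 1 by (simp add: topspace_disc)
qed

lemma r_boundary: "x \<in> boundary_sphere n \<Longrightarrow> r (t, x) = x"
  by (simp add: boundary_sphere_eq r_def)

text \<open>The two branches of \<open>h\<close> fit together because \<open>r\<close> is stationary
  on the boundary sphere, the part of the disc that \<Phi> maps into \<open>A\<close>.\<close>

lemma h_\<Phi>:
  assumes x: "x \<in> topspace (disc n) - {z}" shows "h (t, \<Phi> x) = \<Phi> (r (t, x))"
proof (cases "x \<in> boundary_sphere n")
  case True
  then show ?thesis using x \<Phi>_in_A[of x] by (simp add: h_def r_boundary)
next
  case False
  then have "x \<in> topspace (open_disc n)" using x disc_cases by blast
  then show ?thesis using False x \<Phi>_in_A[of x] by (simp add: h_def \<psi>)
qed

lemma V_cases: "w \<in> V \<Longrightarrow> w \<in> A \<or> (\<exists>x\<in>topspace (disc n) - {z}. w = \<Phi> x)"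
proof -
  assume w: "w \<in> V"
  show ?thesis
  proof (cases "w \<in> A")
    case False
    then have "w \<in> \<Phi> ` topspace (open_disc n)" using w cell_image by blast
    then obtain x where x: "x \<in> topspace (open_disc n)" "w = \<Phi> x" by blast
    then have "x \<in> topspace (disc n) - {z}" using w by (auto simp: topspace_disc topspace_open_disc)
    then show ?thesis using x by blast
  qed simp
qed

lemma \<Phi>_V: "x \<in> topspace (disc n) \<Longrightarrow> \<Phi> x \<in> V \<longleftrightarrow> x \<noteq> z"
  using \<Phi>_centre \<Phi> by (auto simp: continuous_map_def Pi_iff)

lemma h_in: "t \<in> {0..1} \<Longrightarrow> w \<in> V \<Longrightarrow> h (t, w) \<in> V"
proof -
  assume t: "t \<in> {0..1}" and w: "w \<in> V"
  from V_cases[OF w] show ?thesis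
  proof
    assume "w \<in> A" then show ?thesis using w by (simp add: h_def)
  next
    assume "\<exists>x\<in>topspace (disc n) - {z}. w = \<Phi> x"
    then obtain x where x: "x \<in> topspace (disc n) - {z}" "w = \<Phi> x" by blast
    have "r (t, x) \<in> topspace (disc n) - {z}" using r_in[OF x(1)] t by simp
    then show ?thesis using h_\<Phi>[OF x(1), of t] x(2) \<Phi>_V by auto
  qed
qed

lemma continuous_r:
  "continuous_map (subtopology (prod_topology I (disc n)) (UNIV \<times> - {z})) (disc n) r"
proof -
  let ?P = "subtopology (prod_topology I (disc n)) (UNIV \<times> - {z})"
  have s: "continuous_map ?P (powertop_real UNIV) snd"
    using continuous_map_into_fulltopology[OF continuous_map_snd[of I "disc n", unfolded disc_eq]]
    unfolding disc_eq by (rule continuous_map_from_subtopology)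
  have t: "continuous_map ?P euclideanreal fst"
    by (intro continuous_map_from_subtopology continuous_map_into_fulltopology[OF continuous_map_fst])
  have ne: "nrm n (snd u) \<noteq> 0" if "u \<in> topspace ?P" for u
    using that nrm_pos[of "snd u"] by (cases u) auto
  have "continuous_map ?P euclideanreal (nrm n \<circ> snd)"
    by (rule continuous_map_compose[OF s continuous_map_nrm])
  then have i: "continuous_map ?P euclideanreal (\<lambda>u. inverse (nrm n (snd u)))"
    using ne by (intro continuous_map_real_inverse) (simp_all add: o_def)
  have "continuous_map ?P euclideanreal (\<lambda>u. (1 - fst u) + fst u * inverse (nrm n (snd u)))"
    using t i by (intro continuous_map_add continuous_map_real_mult continuous_map_diff) auto
  from continuous_map_scaled[OF this s]
  have "continuous_map ?P (powertop_real UNIV) r" by (simp add: r_def case_prod_unfold)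
  moreover have "r u \<in> topspace (disc n)" if "u \<in> topspace ?P" for u
    using that r_in[of "snd u" "fst u"] by (cases u) auto
  ultimately show ?thesis
    unfolding disc_eq continuous_map_in_subtopology by (auto simp: topspace_disc)
qed

text \<open>The source is compact and the target Hausdorff. The time factor is included because the
  homotopy \<open>h\<close> lives on the product.\<close>

lemma closed_map_times: "closed_map (prod_topology I (disc n)) (prod_topology I Z) (\<lambda>(t, x). (t, \<Phi> x))"
proof (rule continuous_imp_closed_map_gen)
  have "compact_space I" by (simp add: compact_space_subtopology)
  then show "compact_space (prod_topology I (disc n))"
    by (simp add: compact_space_prod_topology compact_space_disc)
  have "Hausdorff_space I" by (simp add: Hausdorff_space_subtopology)
  then have "Hausdorff_space (prod_topology I Z)" using Z by (simp add: Hausdorff_space_prod_topology)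
  then show "kc_space (prod_topology I Z)" by (rule Hausdorff_imp_kc_space)
  show "continuous_map (prod_topology I (disc n)) (prod_topology I Z) (\<lambda>(t, x). (t, \<Phi> x))"
    unfolding case_prod_unfold
    by (intro continuous_map_pairedI continuous_map_fst continuous_map_compose[OF continuous_map_snd \<Phi>, unfolded o_def])
qed

text \<open>Tested on closed sets: the preimage of \<open>C\<close> is the union of its part over
  \<open>A\<close> and of the image, under the closed map of \<open>closed_map_times\<close>, of a
  closed set of times and disc points. Thus quotient topologies on products do not enter.\<close>

lemma continuous_h: "continuous_map (prod_topology I (subtopology Z V)) (subtopology Z V) h"
proof -
  let ?IV = "prod_topology I (subtopology Z V)"
  have IV: "?IV = subtopology (prod_topology I Z) ({0..1} \<times> V)"
    using prod_topology_subtopology(2)[of I Z V] by simp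
  have top: "topspace ?IV = {0..1} \<times> V" by auto
  have "continuous_map ?IV Z h"
    unfolding continuous_map_closedin
  proof (intro conjI allI impI)
    show "h \<in> topspace ?IV \<rightarrow> topspace Z"
    proof
      fix u assume "u \<in> topspace ?IV"
      then have "fst u \<in> {0..1}" "snd u \<in> V" unfolding top by (simp_all add: mem_Times_iff)
      from h_in[OF this] show "h u \<in> topspace Z" by simp
    qed
    fix C assume C: "closedin Z C"
    let ?P = "subtopology (prod_topology I (disc n)) (UNIV \<times> - {z})"
    have "closedin ?P {u \<in> topspace ?P. r u \<in> {x \<in> topspace (disc n). \<Phi> x \<in> C}}"
      by (rule closedin_continuous_map_preimage[OF continuous_r closedin_continuous_map_preimage[OF \<Phi> C]])
    \<comment> \<open>Continuity of \<open>r\<close> is known only off the centre, so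
      \<open>S\<close> is controlled only there; intersecting its image with \<open>V\<close>
      removes the rest.\<close>
    then obtain S where S: "closedin (prod_topology I (disc n)) S"
      "{u \<in> topspace ?P. r u \<in> {x \<in> topspace (disc n). \<Phi> x \<in> C}} = S \<inter> UNIV \<times> - {z}"
      by (auto simp: closedin_subtopology)
    have Ssub: "S \<subseteq> {0..1} \<times> topspace (disc n)" using closedin_subset[OF S(1)] by simp
    have Seq: "(t, x) \<in> S \<longleftrightarrow> \<Phi> (r (t, x)) \<in> C" if "t \<in> {0..1}" "x \<in> topspace (disc n) - {z}" for t x
      using that S(2) r_in[of x t] by (auto simp: set_eq_iff)
    let ?G = "\<lambda>(t, x). (t, \<Phi> x)"
    have 1: "closedin ?IV ((?G ` S) \<inter> ({0..1} \<times> V))"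
      unfolding IV using closed_map_times S(1) by (auto simp: closed_map_def closedin_subtopology)
    have "closedin (prod_topology I Z) ({0..1} \<times> (A \<inter> C))"
      using closedin_Int[OF A C] by (simp add: closedin_prod_Times_iff)
    then have 2: "closedin ?IV (({0..1} \<times> (A \<inter> C)) \<inter> ({0..1} \<times> V))"
      unfolding IV closedin_subtopology by blast
    have "{u \<in> topspace ?IV. h u \<in> C} = ((?G ` S) \<inter> ({0..1} \<times> V)) \<union> (({0..1} \<times> (A \<inter> C)) \<inter> ({0..1} \<times> V))"
      (is "?L = ?R1 \<union> ?R2")
    proof
      show "?L \<subseteq> ?R1 \<union> ?R2"
      proof
        fix u assume "u \<in> ?L"
        then have uL: "u \<in> {0..1} \<times> V" "h u \<in> C" unfolding mem_Collect_eq top by blast+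
        obtain t w where tw: "u = (t, w)" by (cases u)
        have u: "u = (t, w)" "t \<in> {0..1}" "w \<in> V" "h (t, w) \<in> C" using uL unfolding tw by blast+
        from V_cases[OF u(3)] show "u \<in> ?R1 \<union> ?R2"
        proof
          assume "w \<in> A" then show ?thesis using u by (auto simp: h_def)
        next
          assume "\<exists>x\<in>topspace (disc n) - {z}. w = \<Phi> x"
          then obtain x where x: "x \<in> topspace (disc n) - {z}" "w = \<Phi> x" by blast
          have "(t, x) \<in> S" using Seq[OF u(2) x(1)] u(4) h_\<Phi>[OF x(1), of t] x(2) by simp
          then have "u \<in> ?G ` S" using u(1) x(2) by force
          then show ?thesis using uL(1) by (intro UnI1 IntI)
        qed
      qed
      show "?R1 \<union> ?R2 \<subseteq> ?L"
      proof
        fix u assume "u \<in> ?R1 \<union> ?R2"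
        then show "u \<in> ?L"
        proof
          assume "u \<in> ?R1"
          then obtain t x where u: "u = (t, \<Phi> x)" "(t, x) \<in> S" "\<Phi> x \<in> V" by auto
          have t: "t \<in> {0..1}" "x \<in> topspace (disc n)" using u(2) Ssub by auto
          then have x: "x \<in> topspace (disc n) - {z}" using u(3) \<Phi>_V by auto
          have "h u \<in> C" using Seq[OF t(1) x] u(1,2) h_\<Phi>[OF x, of t] by simp
          then show ?thesis using u t(1) unfolding top by blast
        next
          assume "u \<in> ?R2"
          then show ?thesis unfolding top by (auto simp: h_def)
        qed
      qed
    qed
    then show "closedin ?IV {u \<in> topspace ?IV. h u \<in> C}" using 1 2 by (simp only: closedin_Un)
  qed
  then show ?thesis
    unfolding continuous_map_in_subtopology using h_in by (auto simp: top)
qed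

lemma complement_equivalent: "subtopology Z A homotopy_equivalent_space subtopology Z V"
proof -
  have AV: "A \<subseteq> V" using A_sub centre by blast
  have h1: "h (1, w) \<in> A" if "w \<in> V" for w
    using V_cases[OF that]
  proof
    assume "w \<in> A" then show ?thesis by (simp add: h_def)
  next
    assume "\<exists>x\<in>topspace (disc n) - {z}. w = \<Phi> x"
    then obtain x where x: "x \<in> topspace (disc n) - {z}" "w = \<Phi> x" by blast
    have "r (1, x) \<in> topspace (disc n)" "nrm n (r (1, x)) = 1" using r_in[OF x(1), of 1] nrm_r[OF x(1), of 1] by auto
    then have "r (1, x) \<in> boundary_sphere n" by (auto simp: boundary_sphere_eq topspace_disc)
    then show ?thesis using h_\<Phi>[OF x(1), of 1] x(2) bd by auto
  qed
  have h0: "h (0, w) = w" if "w \<in> V" for w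
    using V_cases[OF that]
  proof
    assume "w \<in> A" then show ?thesis by (simp add: h_def)
  next
    assume "\<exists>x\<in>topspace (disc n) - {z}. w = \<Phi> x"
    then obtain x where x: "x \<in> topspace (disc n) - {z}" "w = \<Phi> x" by blast
    then show ?thesis using h_\<Phi>[OF x(1), of 0] by (simp add: r_def)
  qed
  let ?\<rho> = "\<lambda>w. h (1, w)"
  have "continuous_map (subtopology Z V) (prod_topology I (subtopology Z V)) (\<lambda>w. (1, w))"
    by (intro continuous_map_pairedI) auto
  from continuous_map_compose[OF this continuous_h]
  have "continuous_map (subtopology Z V) (subtopology Z V) ?\<rho>" by (simp add: o_def)
  then have \<rho>: "continuous_map (subtopology Z V) (subtopology Z A) ?\<rho>"
    using h1 by (auto simp: continuous_map_in_subtopology)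
  have i: "continuous_map (subtopology Z A) (subtopology Z V) (\<lambda>w. w)"
    using AV by (auto simp: continuous_map_in_subtopology continuous_map_from_subtopology)
  have "homotopic_with (\<lambda>x. True) (subtopology Z A) (subtopology Z A) (?\<rho> \<circ> (\<lambda>w. w)) id"
    using continuous_map_compose[OF i \<rho>] by (intro homotopic_with_equal) (auto simp: h_def)
  moreover have "homotopic_with (\<lambda>x. True) (subtopology Z V) (subtopology Z V) id ((\<lambda>w. w) \<circ> ?\<rho>)"
    using continuous_h h0 by (subst homotopic_with) (auto intro!: exI[of _ h])
  ultimately show ?thesis
    unfolding homotopy_equivalent_space_def using \<rho> i homotopic_with_symD by blast
qed

text \<open>In the sequence of the pair (Z, V) the subspace \<open>V\<close> has the homology of
  \<open>A\<close>. Excising \<open>A\<close> turns the relative groups into those of the open disc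
  modulo the punctured disc, which are controlled by a contractible space and a sphere.\<close>

lemma noeth_homology_attach:
  assumes "noeth_homology (subtopology Z A)"
  shows "noeth_homology Z"
proof (rule noeth_homology_of_pair)
  show "noeth_homology (subtopology Z V)"
    by (rule noeth_homology_homotopy_equivalent[OF complement_equivalent assms])
  fix p
  have opV: "openin Z V"
    using closedin_Hausdorff_singleton[OF Z, of "\<Phi> z"] centre by (simp add: openin_diff)
  have AV: "A \<subseteq> V" using A_sub centre by blast
  have "Z closure_of A \<subseteq> Z interior_of V"
    using AV by (simp add: closure_of_closedin[OF A] interior_of_openin[OF opV])
  from homology_excision_axiom[OF this, of "topspace Z" p]
  have iso: "relative_homology_group p (subtopology Z e) (V - A) \<cong> relative_homology_group p Z V"
    unfolding is_iso_def by auto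
  have "open_disc n homeomorphic_space subtopology Z e"
    using cell by (rule homeomorphic_map_imp_homeomorphic_space)
  then have ne: "noeth_homology (subtopology Z e)"
    using noeth_homology_homotopy_equivalent[OF homeomorphic_imp_homotopy_equivalent_space]
      noeth_homology_contractible[OF contractible_open_disc] by blast
  have "homeomorphic_map (subtopology (open_disc n) (topspace (open_disc n) - {z}))
      (subtopology (subtopology Z e) (V - A)) \<Phi>"
  proof (rule homeomorphic_map_subtopologies[OF cell])
    show "\<Phi> ` (topspace (open_disc n) \<inter> (topspace (open_disc n) - {z})) = topspace (subtopology Z e) \<inter> (V - A)"
      using cell_image cell_inj z_in(1) by (auto simp: inj_on_def)
  qed
  moreover have "subtopology (open_disc n) (topspace (open_disc n) - {z}) = punctured_disc n"
  proof -
    have "{x. (\<forall>i\<ge>n. x i = 0) \<and> nrm n x < 1} \<inter> (topspace (open_disc n) - {z}) = {x. (\<forall>i\<ge>n. x i = 0) \<and> nrm n x < 1 \<and> nrm n x \<noteq> 0}"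
      using nrm_eq_0[of n] by (auto simp: topspace_open_disc)
    then show ?thesis by (simp add: punctured_disc_def open_disc_eq subtopology_subtopology)
  qed
  ultimately have "punctured_disc n homeomorphic_space subtopology (subtopology Z e) (V - A)"
    using homeomorphic_map_imp_homeomorphic_space by metis
  then have "noeth_homology (subtopology (subtopology Z e) (V - A))"
    using noeth_homology_homotopy_equivalent[OF homeomorphic_imp_homotopy_equivalent_space]
      noeth_homology_punctured_disc by blast
  then have "noeth (relative_homology_group p (subtopology Z e) (V - A))"
    using ne by (rule noeth_relative_homology)
  then show "noeth (relative_homology_group p Z V)"
    by (rule noeth_iso[OF iso, rotated -1]) simp_all
qed

end

lemma segment_convex_disc: "segment_convex {x. (\<forall>i\<ge>n. x i = 0) \<and> nrm n x \<le> 1}"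
  unfolding segment_convex_def
proof (intro ballI allI impI)
  fix x y :: "nat \<Rightarrow> real" and u :: real
  assume x: "x \<in> {x. (\<forall>i\<ge>n. x i = 0) \<and> nrm n x \<le> 1}" and y: "y \<in> {x. (\<forall>i\<ge>n. x i = 0) \<and> nrm n x \<le> 1}"
    and u: "0 \<le> u \<and> u \<le> 1"
  have "nrm n (\<lambda>i. (1 - u) * x i + u * y i) \<le> nrm n (\<lambda>i. (1 - u) * x i) + nrm n (\<lambda>i. u * y i)"
    using L2_set_triangle_ineq[of "\<lambda>i. (1 - u) * x i" "\<lambda>i. u * y i" "{..<n}"] by (simp add: nrm_def L2_set_def)
  also have "\<dots> = (1 - u) * nrm n x + u * nrm n y" using u by (simp add: nrm_scale)
  also have "\<dots> \<le> 1" using x y u by (intro convex_bound_le) auto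
  finally show "(\<lambda>i. (1 - u) * x i + u * y i) \<in> {x. (\<forall>i\<ge>n. x i = 0) \<and> nrm n x \<le> 1}" using x y by simp
qed

text \<open>Box neighbourhoods meet the disc in convex sets.\<close>

lemma locally_path_connected_space_disc: "locally_path_connected_space (disc n)"
  unfolding locally_path_connected_space
proof (intro allI impI)
  let ?K = "{x. (\<forall>i\<ge>n. x i = 0) \<and> nrm n x \<le> 1}"
  fix V x assume V: "openin (disc n) V \<and> x \<in> V"
  then obtain W where W: "openin (powertop_real UNIV) W" "V = W \<inter> ?K" by (auto simp: disc_eq openin_subtopology)
  have "x \<in> W" using V W by blast
  with W(1) obtain F e where F: "finite F" "e > 0" "\<And>y. (\<forall>i\<in>F. \<bar>y i - x i\<bar> < e) \<Longrightarrow> y \<in> W"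
    by (rule powertop_real_basic_neighbourhood) blast
  define B where "B = {y :: nat \<Rightarrow> real. \<forall>i\<in>F. y i \<in> {x i - e<..<x i + e}}"
  have "openin (powertop_real UNIV) (Pi\<^sub>E UNIV (\<lambda>i. if i \<in> F then {x i - e<..<x i + e} else UNIV))"
    using F(1) by (intro product_topology_basis) auto
  moreover have "Pi\<^sub>E UNIV (\<lambda>i. if i \<in> F then {x i - e<..<x i + e} else UNIV) = B"
    by (auto simp: B_def PiE_iff split: if_splits)
  ultimately have "openin (powertop_real UNIV) B" by simp
  then have 1: "openin (disc n) (B \<inter> ?K)" unfolding disc_eq openin_subtopology by blast
  have "segment_convex B"
    unfolding segment_convex_def
  proof (intro ballI allI impI)
    fix y w u assume y: "y \<in> B" and w: "w \<in> B" and u: "0 \<le> u \<and> u \<le> (1::real)"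
    have "(1 - u) * y i + u * w i \<in> {x i - e<..<x i + e}" if "i \<in> F" for i
    proof -
      have "convex {x i - e<..<x i + e}" by (rule convex_real_interval)
      from convexD_alt[OF this, of "y i" "w i" u] show ?thesis using y w u that by (simp add: B_def)
    qed
    then show "(\<lambda>i. (1 - u) * y i + u * w i) \<in> B" by (simp add: B_def)
  qed
  then have "path_connectedin (powertop_real UNIV) (B \<inter> ?K)"
    by (intro path_connectedin_segment_convex segment_convex_Int segment_convex_disc)
  then have 2: "path_connectedin (disc n) (B \<inter> ?K)" by (simp add: disc_eq path_connectedin_subtopology)
  have 3: "x \<in> B \<inter> ?K" using V W F(2) by (auto simp: B_def)
  have "y \<in> W" if "y \<in> B" for y using F(3)[of y] that by (force simp: B_def abs_less_iff)
  then have "B \<inter> ?K \<subseteq> V" using W(2) by blast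
  then show "\<exists>U. openin (disc n) U \<and> path_connectedin (disc n) U \<and> x \<in> U \<and> U \<subseteq> V" using 1 2 3 by blast
qed

section \<open>Compact CW complexes as finitely many attachments\<close>

locale compact_CW =
  fixes X :: "'a topology" and E d \<Phi>
  assumes X: "Hausdorff_space X" "compact_space X" and CW: "CW_structure X E d \<Phi>"
begin

lemma cells: "\<Union>E = topspace X" "pairwise disjnt E"
  using CW by (auto simp: CW_structure_def)

lemma \<Phi>_cont: "e \<in> E \<Longrightarrow> continuous_map (disc (d e)) X (\<Phi> e)"
  and \<Phi>_homeo: "e \<in> E \<Longrightarrow> homeomorphic_map (open_disc (d e)) (subtopology X e) (\<Phi> e)"
proof -
  note c = CW[unfolded CW_structure_def, THEN conjunct2, THEN conjunct2, THEN conjunct1, THEN bspec]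
  show "e \<in> E \<Longrightarrow> continuous_map (disc (d e)) X (\<Phi> e)" by (rule conjunct1[OF c])
  show "e \<in> E \<Longrightarrow> homeomorphic_map (open_disc (d e)) (subtopology X e) (\<Phi> e)" by (rule conjunct2[OF c])
qed

lemma closure_finite: "e \<in> E \<Longrightarrow> \<exists>F\<subseteq>E. finite F \<and> (\<forall>c\<in>F. d c < d e) \<and> \<Phi> e ` boundary_sphere (d e) \<subseteq> \<Union>F"
  by (rule CW[unfolded CW_structure_def, THEN conjunct2, THEN conjunct2, THEN conjunct2, THEN conjunct1, THEN bspec])

lemma weak:
  assumes "A \<subseteq> topspace X" "\<And>e. e \<in> E \<Longrightarrow> closedin X (A \<inter> (X closure_of e))"
  shows "closedin X A"
  using CW[unfolded CW_structure_def, THEN conjunct2, THEN conjunct2, THEN conjunct2, THEN conjunct2, rule_format, of A]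
    assms by simp

lemma cell_sub: "e \<in> E \<Longrightarrow> e \<subseteq> topspace X" using cells(1) by blast

lemma cell_image: "e \<in> E \<Longrightarrow> \<Phi> e ` topspace (open_disc (d e)) = e"
  using homeomorphic_imp_surjective_map[OF \<Phi>_homeo] cell_sub by (simp add: Int_absorb1)

lemma cell_nonempty: "e \<in> E \<Longrightarrow> e \<noteq> {}"
proof -
  assume e: "e \<in> E"
  have "(\<lambda>i. 0) \<in> topspace (open_disc (d e))" by (simp add: topspace_open_disc nrm_def)
  then show "e \<noteq> {}" using cell_image[OF e] by blast
qed

lemma disc_split: "topspace (disc n) = topspace (open_disc n) \<union> boundary_sphere n"
  by (auto simp: topspace_disc topspace_open_disc boundary_sphere_eq)

lemma closed_image: "e \<in> E \<Longrightarrow> closedin (disc (d e)) C \<Longrightarrow> closedin X (\<Phi> e ` C)"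
  using continuous_imp_closed_map_gen[OF compact_space_disc Hausdorff_imp_kc_space[OF X(1)] \<Phi>_cont]
  by (auto simp: closed_map_def)

lemma closed_cell: "e \<in> E \<Longrightarrow> closedin X (\<Phi> e ` topspace (disc (d e)))"
  by (rule closed_image) auto

lemma cell_disjoint: "e \<in> E \<Longrightarrow> c \<in> E \<Longrightarrow> x \<in> e \<Longrightarrow> x \<in> c \<Longrightarrow> e = c"
  using cells(2) by (metis disjnt_iff pairwiseD)

lemma finite_E: "finite E"
proof -
  \<comment> \<open>a choice of one point in each cell is closed and discrete\<close>
  have "\<forall>e. \<exists>x. e \<in> E \<longrightarrow> x \<in> e" using cell_nonempty by blast
  then obtain pt where pt: "\<And>e. e \<in> E \<Longrightarrow> pt e \<in> e" by metis
  define D where "D = pt ` E"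
  have DX: "D \<subseteq> topspace X" using pt cell_sub by (auto simp: D_def)
  have inj: "inj_on pt E" using pt cell_disjoint by (metis inj_onI)
  have closed: "closedin X B" if B: "B \<subseteq> D" for B
  proof (rule weak)
    show "B \<subseteq> topspace X" using B DX by blast
    fix e assume e: "e \<in> E"
    \<comment> \<open>By closure-finiteness the closure of a cell meets finitely many cells, each
      holding one chosen point. So every subset \<open>B\<close> of \<open>D\<close> meets it in a
      finite set, and the weak topology makes \<open>B\<close> closed.\<close>
    obtain F where F: "F \<subseteq> E" "finite F" "\<Phi> e ` boundary_sphere (d e) \<subseteq> \<Union>F" using closure_finite[OF e] by (elim exE conjE)
    have im: "\<Phi> e ` topspace (disc (d e)) = e \<union> \<Phi> e ` boundary_sphere (d e)"
      by (simp only: disc_split image_Un cell_image[OF e])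
    then have "e \<subseteq> \<Phi> e ` topspace (disc (d e))" by simp
    then have "X closure_of e \<subseteq> \<Phi> e ` topspace (disc (d e))" by (rule closure_of_minimal[OF _ closed_cell[OF e]])
    also have "\<dots> \<subseteq> \<Union>(insert e F)" using F(3) unfolding im by auto
    finally have "B \<inter> (X closure_of e) \<subseteq> pt ` (insert e F)"
    proof -
      assume c: "X closure_of e \<subseteq> \<Union>(insert e F)"
      show ?thesis
      proof
        fix x assume x: "x \<in> B \<inter> (X closure_of e)"
        then obtain c' where c': "c' \<in> E" "x = pt c'" using B by (auto simp: D_def)
        obtain f where f: "f \<in> insert e F" "x \<in> f" using x c by blast
        moreover have "f \<in> E" using f(1) e F(1) by (elim insertE) auto
        moreover have "x \<in> c'" using pt[OF c'(1)] c'(2) by simp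
        ultimately have "c' = f" using cell_disjoint[OF c'(1), of f x] by simp
        then show "x \<in> pt ` (insert e F)" unfolding c'(2) using f(1) by (simp only: imageI)
      qed
    qed
    then have "finite (B \<inter> (X closure_of e))" using finite_surj[of "insert e F"] F(2) by simp
    then show "closedin X (B \<inter> (X closure_of e))"
      using B DX by (intro closedin_Hausdorff_finite[OF X(1)]) auto
  qed
  have "subtopology X D = discrete_topology D"
  proof -
    have "openin (subtopology X D) {x}" if "x \<in> D" for x
    proof -
      have "closedin (subtopology X D) (D - {x})"
        by (rule closedin_subset_topspace[OF closed]) auto
      then have "openin (subtopology X D) (D - (D - {x}))"
        using DX by (simp add: closedin_def Int_absorb1)
      moreover have "D - (D - {x}) = {x}" using that by blast
      ultimately show ?thesis by simp
    qed
    then show ?thesis using DX discrete_topology_unique[of D "subtopology X D"] by auto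
  qed
  moreover have "compact_space (subtopology X D)"
    using closedin_compact_space[OF X(2) closed[OF subset_refl]] by (rule compact_space_subtopology)
  ultimately have "finite D" by (simp add: compact_space_discrete_topology)
  then show ?thesis using inj by (simp add: D_def finite_image_iff)
qed

text \<open>A cell of maximal dimension is removed: boundaries lie in cells of lower dimension and
  avoid it, so the rest is again a subcomplex. Closedness is carried through the induction because
  attaching the cell back requires it.\<close>

lemma subcomplex:
  assumes "finite F" "F \<subseteq> E" "\<forall>e\<in>F. \<Phi> e ` boundary_sphere (d e) \<subseteq> \<Union>F"
  shows "closedin X (\<Union>F) \<and> noeth_homology (subtopology X (\<Union>F))"
  using assms
proof (induction "card F" arbitrary: F)
  case 0
  then show ?case by (simp add: noeth_homology_empty)
next
  case (Suc k)
  have "F \<noteq> {}" using Suc(2) by auto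
  then obtain e where e: "e \<in> F" "\<And>c. c \<in> F \<Longrightarrow> d c \<le> d e"
  proof -
    have "Max (d ` F) \<in> d ` F" using Suc(3) \<open>F \<noteq> {}\<close> by simp
    then obtain e where "e \<in> F" "d e = Max (d ` F)" by force
    then show ?thesis using that[of e] Suc(3) by simp
  qed
  have eE: "e \<in> E" using e Suc by blast
  let ?F = "F - {e}"
  have IH: "closedin X (\<Union>?F) \<and> noeth_homology (subtopology X (\<Union>?F))"
  proof (rule Suc(1))
    show "k = card ?F" using Suc(2,3) e(1) by simp
    show "\<forall>c\<in>?F. \<Phi> c ` boundary_sphere (d c) \<subseteq> \<Union>?F"
    proof (intro ballI subsetI)
      fix c x assume c: "c \<in> ?F" and x: "x \<in> \<Phi> c ` boundary_sphere (d c)"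
      obtain f where f: "f \<in> F" "x \<in> f" using Suc(5) c x by blast
      obtain f' where f': "f' \<in> E" "d f' < d c" "x \<in> f'" using closure_finite[of c] c Suc(4) x by blast
      have "f = f'" using cell_disjoint[of f f' x] f f' Suc(4) by blast
      then have "f \<noteq> e" using f'(2) e(2)[of c] c by auto
      then show "x \<in> \<Union>?F" using f by blast
    qed
  qed (use Suc in auto)
  have eq: "\<Union>F = (\<Union>?F) \<union> \<Phi> e ` topspace (disc (d e))"
    using e(1) cell_image[OF eE] Suc(5) unfolding disc_split by blast
  have cl: "closedin X (\<Union>F)" unfolding eq by (rule closedin_Un[OF conjunct1[OF IH] closed_cell[OF eE]])
  have diff: "\<Union>F - \<Union>?F = e" using e(1) cell_disjoint Suc(4) by blast
  have FX: "\<Union>F \<subseteq> topspace X" using closedin_subset[OF cl] .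
  have topF: "topspace (subtopology X (\<Union>F)) = \<Union>F" using FX by auto
  interpret attached_cell "subtopology X (\<Union>F)" "\<Union>?F" "d e" "\<Phi> e"
  proof
    show "Hausdorff_space (subtopology X (\<Union>F))" by (rule Hausdorff_space_subtopology[OF X(1)])
    show "closedin (subtopology X (\<Union>F)) (\<Union>?F)" using IH by (intro closedin_subset_topspace) auto
    show "continuous_map (disc (d e)) (subtopology X (\<Union>F)) (\<Phi> e)"
      using \<Phi>_cont[OF eE] eq by (auto simp: continuous_map_in_subtopology)
    have "\<Union>F \<inter> e = e" using e(1) by blast
    then show "homeomorphic_map (open_disc (d e)) (subtopology (subtopology X (\<Union>F)) (topspace (subtopology X (\<Union>F)) - \<Union>?F)) (\<Phi> e)"
      using \<Phi>_homeo[OF eE] unfolding topF diff subtopology_subtopology by simp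
    show "\<Phi> e ` boundary_sphere (d e) \<subseteq> \<Union>?F"
    proof
      fix x assume x: "x \<in> \<Phi> e ` boundary_sphere (d e)"
      obtain f where f: "f \<in> F" "x \<in> f" using Suc(5) e(1) x by blast
      obtain f' where f': "f' \<in> E" "d f' < d e" "x \<in> f'" using closure_finite[OF eE] x by blast
      have "f = f'" using cell_disjoint[of f f' x] f f' Suc(4) by blast
      then have "f \<noteq> e" using f'(2) by auto
      then show "x \<in> \<Union>?F" using f by blast
    qed
  qed
  have "\<Union>F \<inter> \<Union>?F = \<Union>?F" by blast
  then have "noeth_homology (subtopology (subtopology X (\<Union>F)) (\<Union>?F))"
    using IH unfolding subtopology_subtopology by simp
  from noeth_homology_attach[OF this] show ?case using cl by simp
qed

lemma noeth_homology_CW: "noeth_homology X"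
proof -
  have "\<forall>e\<in>E. \<Phi> e ` boundary_sphere (d e) \<subseteq> \<Union>E" using closure_finite by blast
  from subcomplex[OF finite_E subset_refl this] show ?thesis by (simp add: cells(1))
qed

text \<open>The complex is a quotient of the disjoint union of its discs, by a map that is closed
  because there are finitely many cells. This later upgrades connectedness of the space and of its
  covers to path-connectedness.\<close>

lemma locally_path_connected_CW: "locally_path_connected_space X"
proof (rule locally_path_connected_space_quotient_map_image)
  let ?S = "sum_topology (\<lambda>e. disc (d e)) E" and ?f = "\<lambda>(e, x). \<Phi> e x"
  show "locally_path_connected_space ?S"
    by (simp add: locally_path_connected_space_sum_topology locally_path_connected_space_disc)
  show "quotient_map ?S X ?f"
  proof (rule continuous_closed_imp_quotient_map)
    show "continuous_map ?S X ?f"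
      unfolding continuous_map_def
    proof (intro conjI allI impI)
      show "?f \<in> topspace ?S \<rightarrow> topspace X"
        using \<Phi>_cont by (auto simp: continuous_map_def Pi_iff)
      fix U assume U: "openin X U"
      show "openin ?S {u \<in> topspace ?S. ?f u \<in> U}"
        unfolding openin_sum_topology
      proof (intro conjI ballI)
        fix e assume e: "e \<in> E"
        have "{x. (e, x) \<in> {u \<in> topspace ?S. ?f u \<in> U}} = {x \<in> topspace (disc (d e)). \<Phi> e x \<in> U}"
          using e by auto
        then show "openin (disc (d e)) {x. (e, x) \<in> {u \<in> topspace ?S. ?f u \<in> U}}"
          using openin_continuous_map_preimage[OF \<Phi>_cont[OF e] U] by simp
      qed auto
    qed
    show "closed_map ?S X ?f"
      unfolding closed_map_def
    proof (intro allI impI)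
      fix C assume C: "closedin ?S C"
      have "?f ` C = (\<Union>e\<in>E. \<Phi> e ` {x. (e, x) \<in> C})"
        using closedin_subset[OF C] by force
      moreover have "closedin X (\<Union>e\<in>E. \<Phi> e ` {x. (e, x) \<in> C})"
        using C by (intro closedin_Union finite_imageI finite_E) (auto simp: closedin_sum_topology intro: closed_image)
      ultimately show "closedin X (?f ` C)" by simp
    qed
    show "?f ` topspace ?S = topspace X"
    proof
      show "?f ` topspace ?S \<subseteq> topspace X" using \<Phi>_cont by (auto simp: continuous_map_def Pi_iff)
      show "topspace X \<subseteq> ?f ` topspace ?S"
      proof
        fix y assume "y \<in> topspace X"
        then obtain e where e: "e \<in> E" "y \<in> e" using cells(1) by blast
        then obtain x where x: "x \<in> topspace (open_disc (d e))" "y = \<Phi> e x" using cell_image by blast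
        then have "(e, x) \<in> topspace ?S" using e disc_split by auto
        then show "y \<in> ?f ` topspace ?S" using x(2) by (intro image_eqI[of _ _ "(e, x)"]) auto
      qed
    qed
  qed
qed

end

section \<open>Towers of regular covers\<close>

text \<open>A combinatorial model of all regular covers at once: one complex with a group element
  for each face. The covers differ only in the normal subgroup whose cosets serve as sheets.\<close>

locale labelled_complex = group \<Gamma> for \<Gamma> :: "('g, 'm) monoid_scheme" (structure) +
  fixes S :: "nat \<Rightarrow> 's set" and d :: "nat \<Rightarrow> nat \<Rightarrow> 's \<Rightarrow> 's" and l :: "nat \<Rightarrow> 's \<Rightarrow> 'g"
  assumes fc: "face_closed S d"
    and label: "s \<in> S (Suc n) \<Longrightarrow> j \<le> Suc n \<Longrightarrow> l j s \<in> carrier \<Gamma>"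
begin

definition cover_simplices :: "'g set \<Rightarrow> nat \<Rightarrow> ('s \<times> 'g set) set" where
  "cover_simplices N n = S n \<times> rcosets N"

text \<open>Labels multiply on the right, through the product of cosets of a normal subgroup. Deck
  transformations multiply on the left and therefore commute with the faces.\<close>

definition cover_faces :: "'g set \<Rightarrow> nat \<Rightarrow> nat \<Rightarrow> 's \<times> 'g set \<Rightarrow> 's \<times> 'g set" where
  "cover_faces N n j = (\<lambda>(s, R). (d n j s, R <#> (N #> l j s)))"

lemma cover_simplicesE:
  assumes "u \<in> cover_simplices N n"
  obtains s x where "s \<in> S n" "x \<in> carrier \<Gamma>" "u = (s, N #> x)"
  using assms by (auto simp: cover_simplices_def RCOSETS_def)

lemma cover_simplicesI: "s \<in> S n \<Longrightarrow> x \<in> carrier \<Gamma> \<Longrightarrow> (s, N #> x) \<in> cover_simplices N n"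
  by (auto simp: cover_simplices_def RCOSETS_def)

lemma cover_faces:
  assumes "N \<lhd> \<Gamma>" "s \<in> S (Suc n)" "x \<in> carrier \<Gamma>" "j \<le> Suc n"
  shows "cover_faces N (Suc n) j (s, N #> x) = (d (Suc n) j s, N #> (x \<otimes> l j s))"
  using normal.rcos_sum[OF assms(1,3) label[OF assms(2,4)]] by (simp add: cover_faces_def)

lemma face_closed_cover:
  assumes "N \<lhd> \<Gamma>" shows "face_closed (cover_simplices N) (cover_faces N)"
  unfolding face_closed_def
proof (intro allI impI)
  fix n j u assume u: "u \<in> cover_simplices N (Suc n)" and j: "j \<le> Suc n"
  obtain s x where s: "s \<in> S (Suc n)" "x \<in> carrier \<Gamma>" "u = (s, N #> x)" using u by (rule cover_simplicesE)
  have "d (Suc n) j s \<in> S n" using fc s(1) j by (auto simp: face_closed_def)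
  then show "cover_faces N (Suc n) j u \<in> cover_simplices N n"
    unfolding s(3) cover_faces[OF assms s(1,2) j] using s(2) label[OF s(1) j] by (intro cover_simplicesI m_closed)
qed

section \<open>The deck group between two covers\<close>

context
  fixes N M :: "'g set"
  assumes N: "N \<lhd> \<Gamma>" and M: "M \<lhd> \<Gamma>" and NM: "N \<subseteq> M"
begin

interpretation Q: group "\<Gamma> Mod N" by (rule normal.factorgroup_is_group[OF N])

text \<open>The quotient M/N inside \<open>\<Gamma> Mod N\<close>; its size is the relative index of
  the two subgroups.\<close>

definition P :: "'g set set" where "P = (\<lambda>x. N #> x) ` M"
definition deck :: "'g set monoid" where "deck = \<lparr>carrier = P, mult = (<#>), one = N\<rparr>"
definition act :: "'g set \<Rightarrow> 's \<times> 'g set \<Rightarrow> 's \<times> 'g set" where "act R = (\<lambda>(s, T). (s, R <#> T))"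

lemma M_sub: "x \<in> M \<Longrightarrow> x \<in> carrier \<Gamma>"
  using normal_imp_subgroup[OF M] by (meson subgroup.mem_carrier)

lemma rmult: "x \<in> carrier \<Gamma> \<Longrightarrow> y \<in> carrier \<Gamma> \<Longrightarrow> (N #> x) <#> (N #> y) = N #> (x \<otimes> y)"
  by (rule normal.rcos_sum[OF N])

lemma deck_eq: "deck = (\<Gamma> Mod N)\<lparr>carrier := P\<rparr>"
  by (simp add: deck_def FactGroup_def)

lemma P_subgroup: "subgroup P (\<Gamma> Mod N)"
proof -
  interpret h: group_hom \<Gamma> "\<Gamma> Mod N" "\<lambda>x. N #> x"
    by unfold_locales (rule normal.r_coset_hom_Mod[OF N])
  show ?thesis unfolding P_def by (rule h.subgroup_img_is_subgroup[OF normal_imp_subgroup[OF M]])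
qed

lemma group_deck: "group deck"
  unfolding deck_eq by (rule Q.subgroup_imp_group[OF P_subgroup])

lemma act_eq: "x \<in> carrier \<Gamma> \<Longrightarrow> m \<in> M \<Longrightarrow> act (N #> m) (s, N #> x) = (s, N #> (m \<otimes> x))"
  using rmult M_sub by (simp add: act_def)

lemma face_action_deck: "face_action deck (cover_simplices N) (cover_faces N) act"
proof (intro face_action.intro face_action_axioms.intro group_deck face_closed_cover[OF N])
  have N1: "N = N #> \<one>" using normal_imp_subgroup[OF N] by (simp add: subgroup.subset)
  have M1: "\<one> \<in> M" using normal_imp_subgroup[OF M] by (rule subgroup.one_closed)
  show "free_face_action deck (cover_simplices N) (cover_faces N) act"
    unfolding free_face_action_def
  proof (intro conjI ballI allI impI)
    fix g n u assume "g \<in> carrier deck" and u: "u \<in> cover_simplices N n"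
    then obtain m where m: "m \<in> M" "g = N #> m" by (auto simp: deck_def P_def)
    obtain s x where s: "s \<in> S n" "x \<in> carrier \<Gamma>" "u = (s, N #> x)" using u by (rule cover_simplicesE)
    show "act g u \<in> cover_simplices N n"
      using m s M_sub by (simp add: act_eq cover_simplicesI)
    show "g = \<one>\<^bsub>deck\<^esub>" if "act g u = u"
    proof -
      have "g \<otimes>\<^bsub>\<Gamma> Mod N\<^esub> (N #> x) = N #> x" using that s by (simp add: act_def FactGroup_def)
      then have "g = \<one>\<^bsub>\<Gamma> Mod N\<^esub>"
        using Q.r_cancel_one[of "N #> x" g] m s M_sub by (simp add: carrier_FactGroup)
      then show ?thesis by (simp add: deck_def FactGroup_def)
    qed
    fix h assume "h \<in> carrier deck"
    then obtain k where k: "k \<in> M" "h = N #> k" by (auto simp: deck_def P_def)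
    have "m \<otimes> k \<in> M" using normal_imp_subgroup[OF M] m k by (simp add: subgroup.m_closed)
    then show "act (g \<otimes>\<^bsub>deck\<^esub> h) u = act g (act h u)"
      using m k s M_sub by (simp add: deck_def act_eq rmult m_assoc)
  next
    fix n u assume u: "u \<in> cover_simplices N n"
    obtain s x where s: "s \<in> S n" "x \<in> carrier \<Gamma>" "u = (s, N #> x)" using u by (rule cover_simplicesE)
    have "act (N #> \<one>) u = u" using s M1 by (simp add: act_eq)
    then show "act \<one>\<^bsub>deck\<^esub> u = u" using N1 by (simp add: deck_def)
  next
    fix g n u j assume "g \<in> carrier deck" and u: "u \<in> cover_simplices N (Suc n)" and j: "j \<le> Suc n"
    then obtain m where m: "m \<in> M" "g = N #> m" by (auto simp: deck_def P_def)
    obtain s x where s: "s \<in> S (Suc n)" "x \<in> carrier \<Gamma>" "u = (s, N #> x)" using u by (rule cover_simplicesE)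
    show "act g (cover_faces N (Suc n) j u) = cover_faces N (Suc n) j (act g u)"
      using m s M_sub label[OF s(1) j] by (simp add: act_eq cover_faces[OF N s(1) _ j] m_assoc)
  qed
qed

text \<open>Links the two descriptions of the quotient by M/N: a coset of \<open>M\<close> is
  replaced by the set of cosets of \<open>N\<close> inside it, which is the second component of a
  deck orbit.\<close>

definition fibre :: "'s \<times> 'g set \<Rightarrow> ('s \<times> 'g set) set" where
  "fibre = (\<lambda>(s, T). {s} \<times> {R \<in> rcosets N. R \<subseteq> T})"

lemma cosets_below:
  assumes x: "x \<in> carrier \<Gamma>"
  shows "{R \<in> rcosets N. R \<subseteq> M #> x} = (\<lambda>R. R <#> (N #> x)) ` P"
proof (intro Set.equalityI subsetI)
  fix R assume "R \<in> {R \<in> rcosets N. R \<subseteq> M #> x}"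
  then obtain y where y: "y \<in> carrier \<Gamma>" "R = N #> y" "R \<subseteq> M #> x" by (auto simp: RCOSETS_def)
  have "y \<in> M #> x" using y rcos_self[OF y(1) normal_imp_subgroup[OF N]] by blast
  then obtain m where m: "m \<in> M" "y = m \<otimes> x" by (auto simp: r_coset_def)
  then have "R = (N #> m) <#> (N #> x)" using y(2) rmult x M_sub by simp
  then show "R \<in> (\<lambda>R. R <#> (N #> x)) ` P" using m(1) by (auto simp: P_def)
next
  fix R assume "R \<in> (\<lambda>R. R <#> (N #> x)) ` P"
  then obtain m where m: "m \<in> M" "R = N #> (m \<otimes> x)" using rmult x M_sub by (auto simp: P_def)
  have "N #> (m \<otimes> x) \<subseteq> M #> x"
  proof
    fix z assume "z \<in> N #> (m \<otimes> x)"
    then obtain k where k: "k \<in> N" "z = k \<otimes> (m \<otimes> x)" by (auto simp: r_coset_def)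
    then have "z = (k \<otimes> m) \<otimes> x" using m(1) x NM M_sub by (simp add: m_assoc subset_iff)
    moreover have "k \<otimes> m \<in> M" using normal_imp_subgroup[OF M] m(1) k(1) NM by (auto intro: subgroup.m_closed)
    ultimately show "z \<in> M #> x" by (auto simp: r_coset_def)
  qed
  then show "R \<in> {R \<in> rcosets N. R \<subseteq> M #> x}" using m x M_sub by (auto simp: RCOSETS_def)
qed

lemma fibre_orb: "x \<in> carrier \<Gamma> \<Longrightarrow> fibre (s, M #> x) = orb deck act (s, N #> x)"
  by (auto simp: fibre_def cosets_below orb_def deck_def act_def)

lemma face_map_fibre:
  "face_map (cover_simplices M) (cover_faces M) (orb_simplices deck (cover_simplices N) act) (orb_faces (cover_faces N)) (\<lambda>n. fibre)"
  unfolding face_map_def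
proof (intro conjI allI impI)
  interpret A: face_action deck "cover_simplices N" "cover_faces N" act by (rule face_action_deck)
  show "fibre ` cover_simplices M n = orb deck act ` cover_simplices N n" for n
  proof (intro Set.equalityI subsetI)
    fix B assume "B \<in> fibre ` cover_simplices M n"
    then obtain s x where "s \<in> S n" "x \<in> carrier \<Gamma>" "B = fibre (s, M #> x)" by (auto elim: cover_simplicesE)
    then show "B \<in> orb deck act ` cover_simplices N n" by (simp add: fibre_orb cover_simplicesI)
  next
    fix B assume "B \<in> orb deck act ` cover_simplices N n"
    then obtain s x where "s \<in> S n" "x \<in> carrier \<Gamma>" "B = orb deck act (s, N #> x)" by (auto elim: cover_simplicesE)
    then show "B \<in> fibre ` cover_simplices M n" by (simp add: fibre_orb[symmetric] cover_simplicesI)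
  qed
  fix n j u assume u: "u \<in> cover_simplices M (Suc n)" and j: "j \<le> Suc n"
  obtain s x where s: "s \<in> S (Suc n)" "x \<in> carrier \<Gamma>" "u = (s, M #> x)" using u by (rule cover_simplicesE)
  have xl: "x \<otimes> l j s \<in> carrier \<Gamma>" using s label[OF s(1) j] by simp
  have "fibre (cover_faces M (Suc n) j u) = orb deck act (cover_faces N (Suc n) j (s, N #> x))"
    unfolding s(3) cover_faces[OF M s(1,2) j] cover_faces[OF N s(1,2) j] fibre_orb[OF xl] ..
  also have "\<dots> = cover_faces N (Suc n) j ` orb deck act (s, N #> x)"
    by (rule A.orb_face[OF cover_simplicesI[OF s(1,2)] j])
  finally show "fibre (cover_faces M (Suc n) j u) = cover_faces N (Suc n) j ` fibre u"
    unfolding s(3) fibre_orb[OF s(2)] .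
qed

lemma Union_cosets_below: "T \<in> rcosets M \<Longrightarrow> \<Union>{R \<in> rcosets N. R \<subseteq> T} = T"
proof (intro Set.equalityI subsetI)
  fix z assume T: "T \<in> rcosets M" "z \<in> T"
  then have z: "z \<in> carrier \<Gamma>" using rcosets_part_G[OF normal_imp_subgroup[OF M]] by blast
  have "T = M #> z" using T repr_independence[OF _ _ normal_imp_subgroup[OF M]] by (auto simp: RCOSETS_def)
  then have "N #> z \<subseteq> T" using NM by (auto simp: r_coset_def)
  then show "z \<in> \<Union>{R \<in> rcosets N. R \<subseteq> T}"
    using z rcos_self[OF z normal_imp_subgroup[OF N]] by (auto simp: RCOSETS_def)
qed blast

text \<open>A coset of \<open>M\<close> is recovered as the union of the cosets of \<open>N\<close>
  in it. These sets are nonempty, which is what allows both factors of the product to be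
  recovered.\<close>

lemma inj_fibre: "inj_on fibre (cover_simplices M n)"
proof (rule inj_onI)
  fix u v assume u: "u \<in> cover_simplices M n" and v: "v \<in> cover_simplices M n" and eq: "fibre u = fibre v"
  obtain s T where uT: "u = (s, T)" "T \<in> rcosets M" using u by (auto simp: cover_simplices_def)
  obtain s' T' where vT: "v = (s', T')" "T' \<in> rcosets M" using v by (auto simp: cover_simplices_def)
  have ne: "{R \<in> rcosets N. R \<subseteq> T} \<noteq> {}"
  proof -
    obtain x where x: "x \<in> carrier \<Gamma>" "T = M #> x" using uT(2) by (auto simp: RCOSETS_def)
    have "P \<noteq> {}" using subgroup.one_closed[OF P_subgroup] by blast
    then show ?thesis unfolding x(2) cosets_below[OF x(1)] by simp
  qed
  have p: "{s} \<times> {R \<in> rcosets N. R \<subseteq> T} = {s'} \<times> {R \<in> rcosets N. R \<subseteq> T'}" using eq by (simp add: fibre_def uT vT)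
  have *: "s = s' \<and> {R \<in> rcosets N. R \<subseteq> T} = {R \<in> rcosets N. R \<subseteq> T'}"
  proof -
    have "a = a' \<and> A = A'" if "{a} \<times> A = {a'} \<times> A'" "A \<noteq> {}" for a a' :: 's and A A' :: "'g set set"
      using that by (auto simp: times_eq_iff)
    from this[OF p ne] show ?thesis .
  qed
  then have "\<Union>{R \<in> rcosets N. R \<subseteq> T} = \<Union>{R \<in> rcosets N. R \<subseteq> T'}" by (rule arg_cong[OF conjunct2])
  then have "T = T'" unfolding Union_cosets_below[OF uT(2)] Union_cosets_below[OF vT(2)] .
  then show "u = v" unfolding uT(1) vT(1) conjunct1[OF *] by simp
qed

text \<open>Translation identifies the cosets of \<open>N\<close> inside any coset of
  \<open>M\<close> with \<open>P\<close>, so the count is multiplicativity of the index.\<close>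

lemma card_rcosets_mult:
  assumes "finite (rcosets N)"
  shows "card (rcosets N) = card P * card (rcosets M)"
proof -
  have sub: "\<Union>((\<lambda>T. {R \<in> rcosets N. R \<subseteq> T}) ` (rcosets M)) = rcosets N"
  proof (intro Set.equalityI subsetI)
    fix R assume "R \<in> rcosets N"
    then obtain y where y: "y \<in> carrier \<Gamma>" "R = N #> y" by (auto simp: RCOSETS_def)
    then have "R \<subseteq> M #> y" using NM by (auto simp: r_coset_def)
    then show "R \<in> \<Union>((\<lambda>T. {R \<in> rcosets N. R \<subseteq> T}) ` (rcosets M))" using y by (auto simp: RCOSETS_def)
  qed auto
  have inj: "inj_on (\<lambda>T. {R \<in> rcosets N. R \<subseteq> T}) (rcosets M)"
    using Union_cosets_below by (metis (no_types, lifting) inj_onI)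
  have disj: "{R \<in> rcosets N. R \<subseteq> T} \<inter> {R \<in> rcosets N. R \<subseteq> T'} = {}"
    if "T \<in> rcosets M" "T' \<in> rcosets M" "T \<noteq> T'" for T T'
  proof -
    have "T \<inter> T' = {}" using rcos_disjoint[OF normal_imp_subgroup[OF M]] that by (auto simp: pairwise_def disjnt_def)
    moreover have "R \<noteq> {}" if "R \<in> rcosets N" for R
      using that rcos_self[OF _ normal_imp_subgroup[OF N]] by (auto simp: RCOSETS_def)
    ultimately show ?thesis by blast
  qed
  have card: "card {R \<in> rcosets N. R \<subseteq> T} = card P" if "T \<in> rcosets M" for T
  proof -
    obtain x where x: "x \<in> carrier \<Gamma>" "T = M #> x" using \<open>T \<in> rcosets M\<close> by (auto simp: RCOSETS_def)
    have "inj_on (\<lambda>R. R <#> (N #> x)) P"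
    proof (rule inj_onI)
      fix R R' assume R: "R \<in> P" "R' \<in> P" "R <#> (N #> x) = R' <#> (N #> x)"
      have "P \<subseteq> carrier (\<Gamma> Mod N)" by (rule subgroup.subset[OF P_subgroup])
      moreover have "N #> x \<in> carrier (\<Gamma> Mod N)" using x(1) by (simp add: carrier_FactGroup)
      moreover have "R \<otimes>\<^bsub>\<Gamma> Mod N\<^esub> (N #> x) = R' \<otimes>\<^bsub>\<Gamma> Mod N\<^esub> (N #> x)" using R(3) by (simp add: FactGroup_def)
      ultimately show "R = R'" using R Q.right_cancel[of "N #> x" R R'] by blast
    qed
    then show ?thesis unfolding x(2) cosets_below[OF x(1)] by (rule card_image)
  qed
  have finM: "finite (rcosets M)"
  proof (rule finite_imageD[OF _ inj])
    show "finite ((\<lambda>T. {R \<in> rcosets N. R \<subseteq> T}) ` (rcosets M))"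
      by (rule finite_subset[OF _ finite_Pow_iff[THEN iffD2, OF assms]]) auto
  qed
  have "card (\<Union>((\<lambda>T. {R \<in> rcosets N. R \<subseteq> T}) ` (rcosets M))) = (\<Sum>T\<in>rcosets M. card {R \<in> rcosets N. R \<subseteq> T})"
    using finM assms disj by (intro card_UN_disjoint) auto
  then show ?thesis unfolding sub using card by simp
qed

text \<open>\<open>card P\<close> divides a power of p, so M/N is a p-group; it acts freely on the
  cover of \<open>N\<close> with the cover of \<open>M\<close> as orbit complex. That the boundary
  squares to zero is a hypothesis because no cocycle identity is imposed on the labels.\<close>

theorem hom_le_cover_tower:
  assumes p: "prime p" and char: "CHAR('k::field) = p" and idx: "card (rcosets N) = p ^ m"
    and cc: "chain_complex TYPE('k) (cover_simplices N) (cover_faces N)"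
    and le: "hom_le TYPE('k) (cover_simplices M) (cover_faces M) n b"
  shows "hom_le TYPE('k) (cover_simplices N) (cover_faces N) n (card P * b)"
proof -
  have fin: "finite (rcosets N)" using idx p by (metis card.infinite power_eq_0_iff not_prime_0)
  have "card P dvd p ^ m" using card_rcosets_mult[OF fin] idx by (metis dvd_triv_left)
  then obtain r where r: "card P = p ^ r" using p by (auto simp: divides_primepow_nat)
  have finP: "finite P" using r p by (metis card.infinite power_eq_0_iff not_prime_0)
  have "hom_le TYPE('k) (orb_simplices deck (cover_simplices N) act) (orb_faces (cover_faces N)) n b"
    by (rule hom_le_bij_image[OF face_closed_cover[OF M] face_map_fibre inj_fibre le])
  from p_group_action_hom_le[OF p char cc _ _ face_action_deck this] show ?thesis
    using finP r by (simp add: deck_def order_def)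
qed

end

text \<open>The start of the tower: the whole group is its only coset, so the labels have no
  effect.\<close>

lemma hom_le_trivial_cover:
  assumes "hom_le TYPE('k::field) S d n b"
  shows "hom_le TYPE('k) (cover_simplices (carrier \<Gamma>)) (cover_faces (carrier \<Gamma>)) n b"
proof (rule hom_le_bij_image[OF fc _ _ assms, where f = "\<lambda>n s. (s, carrier \<Gamma>)"])
  have n: "carrier \<Gamma> \<lhd> \<Gamma>" by (simp add: normal_inv_iff subgroup_self)
  have c: "carrier \<Gamma> #> x = carrier \<Gamma>" if "x \<in> carrier \<Gamma>" for x
    using that by (simp add: coset_join2 subgroup_self)
  show "face_map S d (cover_simplices (carrier \<Gamma>)) (cover_faces (carrier \<Gamma>)) (\<lambda>n s. (s, carrier \<Gamma>))"
    unfolding face_map_def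
  proof (intro conjI allI impI)
    show "(\<lambda>s. (s, carrier \<Gamma>)) ` S n = cover_simplices (carrier \<Gamma>) n" for n
      using c by (auto simp: cover_simplices_def RCOSETS_def)
    fix n j s assume s: "s \<in> S (Suc n)" "j \<le> Suc n"
    show "(d (Suc n) j s, carrier \<Gamma>) = cover_faces (carrier \<Gamma>) (Suc n) j (s, carrier \<Gamma>)"
      using label[OF s] cover_faces[OF n s(1) one_closed s(2)] c[OF one_closed] c[of "\<one> \<otimes> l j s"] by simp
  qed
qed (auto simp: inj_on_def)

end

text \<open>The sheets are open and homeomorphic to open subsets of the base.\<close>

lemma (in covering) locally_path_connected_cover:
  assumes X: "locally_path_connected_space X"
  shows "locally_path_connected_space Y"
  unfolding locally_path_connected_space
proof (intro allI impI, elim conjE)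
  fix V y assume V: "openin Y V" and y: "y \<in> V"
  have yY: "y \<in> topspace Y" using openin_subset[OF V] y by blast
  have "q y \<in> topspace X" using covering_map_continuous[OF cov] yY by (auto simp: continuous_map_def)
  then obtain T \<V> where T: "q y \<in> T" "openin X T" "\<Union>\<V> = {y \<in> topspace Y. q y \<in> T}" "\<forall>U\<in>\<V>. openin Y U"
      "\<forall>U\<in>\<V>. homeomorphic_map (subtopology Y U) (subtopology X T) q"
    using cov unfolding covering_map_def by (elim conjE) (drule (1) bspec, elim exE conjE, rule that)
  have "y \<in> \<Union>\<V>" unfolding T(3) using yY T(1) by simp
  then obtain U where U: "U \<in> \<V>" "y \<in> U" by blast
  have "subtopology Y U homeomorphic_space subtopology X T"
    using T(5) U(1) homeomorphic_map_imp_homeomorphic_space by blast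
  then have lpc: "locally_path_connected_space (subtopology Y U)"
    using homeomorphic_locally_path_connected_space locally_path_connected_space_open_subset[OF X T(2)] by blast
  have UY: "openin Y U" using T(4) U(1) by blast
  have "openin (subtopology Y U) (U \<inter> V)" using V by (simp add: openin_subtopology_Int2)
  then obtain W where W: "openin (subtopology Y U) W" "path_connectedin (subtopology Y U) W" "y \<in> W" "W \<subseteq> U \<inter> V"
    using lpc U(2) y unfolding locally_path_connected_space by (meson IntI)
  show "\<exists>W. openin Y W \<and> path_connectedin Y W \<and> y \<in> W \<and> W \<subseteq> V"
    using W openin_trans_full[OF W(1) UY] by (intro exI[of _ W]) (auto simp: path_connectedin_subtopology)
qed

lemma base_paths_exist:
  assumes "path_connected_space X" "x\<^sub>0 \<in> topspace X"
  shows "\<exists>\<alpha>. base_paths X x\<^sub>0 \<alpha>"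
  using assms unfolding base_paths_def path_connected_space_def by (intro bchoice) blast

lemma labelled_complex_singular:
  assumes "group (fundamental_group X x\<^sub>0)" "base_paths X x\<^sub>0 \<alpha>"
  shows "labelled_complex (fundamental_group X x\<^sub>0) (sing X) singular_face (face_label X x\<^sub>0 \<alpha>)"
proof (intro labelled_complex.intro labelled_complex_axioms.intro assms(1) face_closed_singular)
  fix \<sigma> n j assume "\<sigma> \<in> singular_simplex_set (Suc n) X"
  then show "face_label X x\<^sub>0 \<alpha> j \<sigma> \<in> carrier (fundamental_group X x\<^sub>0)"
    using edge_loop_in_loops_at[OF assms(2), of "Suc n" \<sigma>] group.is_monoid[OF assms(1)]
    by (simp add: face_label_def loop_class_in_carrier monoid.one_closed)
qed

section \<open>Comparison of the combinatorial model with actual covers\<close>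

context based_cover
begin

interpretation L: labelled_complex \<Gamma> "sing X" singular_face "face_label X x\<^sub>0 \<alpha>"
  by (rule labelled_complex_singular[OF group_N(2) \<alpha>])

text \<open>\<open>simplex_of\<close> takes a loop class but depends only on its coset, so it
  descends to the simplices of the model.\<close>

definition lift_simplex :: "nat \<Rightarrow> ((nat \<Rightarrow> real) \<Rightarrow> 'a) \<times> (real \<Rightarrow> 'a) set set \<Rightarrow> (nat \<Rightarrow> real) \<Rightarrow> 'b" where
  "lift_simplex n = (\<lambda>(\<sigma>, R). simplex_of n (\<sigma>, SOME \<gamma>. \<gamma> \<in> carrier \<Gamma> \<and> N #>\<^bsub>\<Gamma>\<^esub> \<gamma> = R))"

lemma lift_simplex:
  assumes "singular_simplex n X \<sigma>" "\<gamma> \<in> carrier \<Gamma>"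
  shows "lift_simplex n (\<sigma>, N #>\<^bsub>\<Gamma>\<^esub> \<gamma>) = simplex_of n (\<sigma>, \<gamma>)"
proof -
  let ?\<gamma> = "SOME \<gamma>'. \<gamma>' \<in> carrier \<Gamma> \<and> N #>\<^bsub>\<Gamma>\<^esub> \<gamma>' = N #>\<^bsub>\<Gamma>\<^esub> \<gamma>"
  have "?\<gamma> \<in> carrier \<Gamma> \<and> N #>\<^bsub>\<Gamma>\<^esub> ?\<gamma> = N #>\<^bsub>\<Gamma>\<^esub> \<gamma>" by (rule someI[of _ \<gamma>]) (simp add: assms(2))
  then have "simplex_of n (\<sigma>, ?\<gamma>) = simplex_of n (\<sigma>, \<gamma>)"
    using simplex_of_eq_iff[OF assms(1) _ assms, of ?\<gamma>] by simp
  then show ?thesis by (simp add: lift_simplex_def)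
qed

lemma face_map_lift_simplex:
  assumes N: "N \<lhd> \<Gamma>"
  shows "face_map (L.cover_simplices N) (L.cover_faces N) (sing Y) singular_face lift_simplex"
  unfolding face_map_def
proof (intro conjI allI impI)
  show "lift_simplex n ` L.cover_simplices N n = singular_simplex_set n Y" for n
  proof (intro Set.equalityI subsetI)
    fix \<tau> assume "\<tau> \<in> lift_simplex n ` L.cover_simplices N n"
    then obtain u where u: "u \<in> L.cover_simplices N n" "\<tau> = lift_simplex n u" by blast
    obtain \<sigma> \<gamma> where s: "\<sigma> \<in> singular_simplex_set n X" "\<gamma> \<in> carrier \<Gamma>" "u = (\<sigma>, N #>\<^bsub>\<Gamma>\<^esub> \<gamma>)"
      using u(1) by (rule L.cover_simplicesE)
    have s': "singular_simplex n X \<sigma>" using s(1) by simp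
    show "\<tau> \<in> singular_simplex_set n Y"
      unfolding u(2) s(3) lift_simplex[OF s' s(2)] using simplex_of(1)[OF s' s(2)] by simp
  next
    fix \<tau> assume "\<tau> \<in> singular_simplex_set n Y"
    then have "singular_simplex n Y \<tau>" by simp
    from simplex_of_surj[OF this] obtain \<sigma> \<gamma> where s: "singular_simplex n X \<sigma>" "\<gamma> \<in> carrier \<Gamma>" "simplex_of n (\<sigma>, \<gamma>) = \<tau>"
      by (elim exE conjE)
    have "(\<sigma>, N #>\<^bsub>\<Gamma>\<^esub> \<gamma>) \<in> L.cover_simplices N n" using s by (intro L.cover_simplicesI) simp_all
    then show "\<tau> \<in> lift_simplex n ` L.cover_simplices N n"
      by (rule rev_image_eqI) (simp add: lift_simplex[OF s(1,2)] s(3))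
  qed
  fix n j u assume u: "u \<in> L.cover_simplices N (Suc n)" and j: "j \<le> Suc n"
  obtain \<sigma> \<gamma> where s: "\<sigma> \<in> singular_simplex_set (Suc n) X" "\<gamma> \<in> carrier \<Gamma>" "u = (\<sigma>, N #>\<^bsub>\<Gamma>\<^esub> \<gamma>)"
    using u by (rule L.cover_simplicesE)
  have s': "singular_simplex (Suc n) X \<sigma>" using s(1) by simp
  have f: "singular_simplex n X (singular_face (Suc n) j \<sigma>)"
    using singular_simplex_singular_face[OF s' _ j] by simp
  have c: "\<gamma> \<otimes>\<^bsub>\<Gamma>\<^esub> face_label X x\<^sub>0 \<alpha> j \<sigma> \<in> carrier \<Gamma>"
    by (rule L.m_closed[OF s(2) L.label[OF s(1) j]])
  show "lift_simplex n (L.cover_faces N (Suc n) j u) = singular_face (Suc n) j (lift_simplex (Suc n) u)"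
    unfolding s(3) L.cover_faces[OF N s(1,2) j] lift_simplex[OF s' s(2)] lift_simplex[OF f c]
    using singular_face_simplex_of[OF s' s(2) _ j] by simp
qed

lemma inj_lift_simplex: "inj_on (lift_simplex n) (L.cover_simplices N n)"
proof (rule inj_onI)
  fix u v assume u: "u \<in> L.cover_simplices N n" and v: "v \<in> L.cover_simplices N n" and eq: "lift_simplex n u = lift_simplex n v"
  obtain \<sigma> \<gamma> where s: "\<sigma> \<in> singular_simplex_set n X" "\<gamma> \<in> carrier \<Gamma>" "u = (\<sigma>, N #>\<^bsub>\<Gamma>\<^esub> \<gamma>)"
    using u by (rule L.cover_simplicesE)
  obtain \<sigma>' \<gamma>' where t: "\<sigma>' \<in> singular_simplex_set n X" "\<gamma>' \<in> carrier \<Gamma>" "v = (\<sigma>', N #>\<^bsub>\<Gamma>\<^esub> \<gamma>')"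
    using v by (rule L.cover_simplicesE)
  have s': "singular_simplex n X \<sigma>" and t': "singular_simplex n X \<sigma>'" using s(1) t(1) by simp_all
  have "simplex_of n (\<sigma>, \<gamma>) = simplex_of n (\<sigma>', \<gamma>')"
    using eq unfolding s(3) t(3) lift_simplex[OF s' s(2)] lift_simplex[OF t' t(2)] .
  then show "u = v" unfolding s(3) t(3) simplex_of_eq_iff[OF s' s(2) t' t(2)] by simp
qed

lemma hom_le_cover_iff:
  assumes "N \<lhd> \<Gamma>"
  shows "hom_le TYPE('k::field) (L.cover_simplices N) (L.cover_faces N) n m \<longleftrightarrow> hom_le TYPE('k) (sing Y) singular_face n m"
  by (rule hom_le_bij_iff[OF L.face_closed_cover[OF assms] face_map_lift_simplex[OF assms] inj_lift_simplex])

text \<open>The model is isomorphic to the singular complex of \<open>Y\<close>, where the boundary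
  squares to zero; this takes the place of a cocycle identity for the labels.\<close>

lemma chain_complex_cover:
  assumes "N \<lhd> \<Gamma>"
  shows "chain_complex TYPE('k::field) (L.cover_simplices N) (L.cover_faces N)"
  by (rule chain_complex_image[OF chain_complex_singular
        face_map_inv_into[OF L.face_closed_cover[OF assms] face_map_lift_simplex[OF assms] inj_lift_simplex]])

end

theorem theorem1p6:
  fixes X :: "'a topology" and x\<^sub>0 :: 'a and p n :: nat
    and \<Gamma> :: "(real \<Rightarrow> 'a) set monoid" and N :: "nat \<Rightarrow> (real \<Rightarrow> 'a) set set"
    and Y :: "nat \<Rightarrow> 'b topology" and q :: "nat \<Rightarrow> 'b \<Rightarrow> 'a"
  assumes "CHAR('k::field) = p" and "p > 0"
    and "CW_complex X" and "compact_space X" and "connected_space X"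
    and "x\<^sub>0 \<in> topspace X" and "\<Gamma> = fundamental_group X x\<^sub>0"
    and "residual_p_chain p \<Gamma> N"
    and "\<And>i. cover_associated_to X x\<^sub>0 (N i) (Y i) (q i)"
  shows "decseq (\<lambda>i. real (betti_number TYPE('k) n (Y i)) / real (group_index \<Gamma> (N i))) \<and>
    convergent (\<lambda>i. real (betti_number TYPE('k) n (Y i)) / real (group_index \<Gamma> (N i)))"
proof -
  have p: "prime p" using prime_CHAR_semidom[where 'a = 'k] assms(1,2) by simp
  have normal: "N i \<lhd> \<Gamma>" for i using assms(8) by (auto simp: residual_p_chain_def)
  have N_Suc: "N (Suc i) \<subseteq> N i" for i using assms(8) by (auto simp: residual_p_chain_def)
  have N_0: "N 0 = carrier \<Gamma>" using assms(8) by (simp add: residual_p_chain_def)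
  have index: "\<exists>m. group_index \<Gamma> (N i) = p ^ m" for i using assms(8) by (auto simp: residual_p_chain_def)
  \<comment> \<open>Normality contains the statement that the ambient structure is a group, so the
    group axioms for loop classes come with the chain.\<close>
  have grp: "group \<Gamma>" using normal[of 0] by (simp add: normal_def)
  obtain E d \<Phi> where CW: "Hausdorff_space X" "CW_structure X E d \<Phi>"
    using assms(3) unfolding CW_complex_def by (elim exE conjE)
  interpret CW: compact_CW X E d \<Phi> by unfold_locales (rule CW(1) assms(4) CW(2))+
  have lpc: "locally_path_connected_space X" by (rule CW.locally_path_connected_CW)
  then have "path_connected_space X" using assms(5) by (simp add: path_connected_eq_connected_space)
  from base_paths_exist[OF this assms(6)] obtain \<alpha> where \<alpha>: "base_paths X x\<^sub>0 \<alpha>" ..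
  have cover: "\<exists>y. based_cover (Y i) X (q i) x\<^sub>0 y (N i) \<alpha>" for i
  proof -
    obtain y where y: "covering_map (Y i) X (q i)" "connected_space (Y i)" "y \<in> topspace (Y i)" "q i y = x\<^sub>0"
        "induced_hom X x\<^sub>0 (q i) ` carrier (fundamental_group (Y i) y) = N i"
      using assms(9)[of i] unfolding cover_associated_to_def by (elim bexE conjE)
    have "locally_path_connected_space (Y i)"
      by (rule covering.locally_path_connected_cover[OF covering.intro[OF y(1)] lpc])
    then have "path_connected_space (Y i)" using y(2) by (simp add: path_connected_eq_connected_space)
    moreover have "subgroup (N i) (fundamental_group X x\<^sub>0)" "group (fundamental_group X x\<^sub>0)"
      using normal_imp_subgroup[OF normal] grp unfolding assms(7) by blast+
    ultimately have "based_cover (Y i) X (q i) x\<^sub>0 y (N i) \<alpha>"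
      by (intro based_cover.intro covering.intro based_cover_axioms.intro y \<alpha>)
    then show ?thesis ..
  qed
  interpret L: labelled_complex \<Gamma> "sing X" singular_face "face_label X x\<^sub>0 \<alpha>"
    unfolding assms(7) by (rule labelled_complex_singular[OF grp[unfolded assms(7)] \<alpha>])
  let ?b = "\<lambda>i. betti_number TYPE('k) n (Y i)"
  let ?hom_le = "\<lambda>i. hom_le TYPE('k) (L.cover_simplices (N i)) (L.cover_faces (N i)) n"
  have cc: "chain_complex TYPE('k) (L.cover_simplices (N i)) (L.cover_faces (N i))" for i
  proof -
    obtain y where "based_cover (Y i) X (q i) x\<^sub>0 y (N i) \<alpha>" using cover by blast
    from based_cover.chain_complex_cover[OF this normal[unfolded assms(7)]] show ?thesis unfolding assms(7) .
  qed
  have hom_le_iff: "?hom_le i m \<longleftrightarrow> hom_le TYPE('k) (sing (Y i)) singular_face n m" for i m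
  proof -
    obtain y where "based_cover (Y i) X (q i) x\<^sub>0 y (N i) \<alpha>" using cover by blast
    from based_cover.hom_le_cover_iff[OF this normal[unfolded assms(7)]] show ?thesis unfolding assms(7) .
  qed
  have betti_le: "?b i \<le> m" if "?hom_le i m" for i m
    using betti_number_le[OF chain_complex_singular] that hom_le_iff by blast
  \<comment> \<open>The factor \<open>r\<close> is the relative index of consecutive subgroups; it
    is positive because the index of \<open>N (Suc i)\<close> is a power of a prime.\<close>
  have step: "\<exists>r>0. group_index \<Gamma> (N (Suc i)) = r * group_index \<Gamma> (N i) \<and> (\<forall>b. ?hom_le i b \<longrightarrow> ?hom_le (Suc i) (r * b))" for i
  proof (intro exI conjI allI impI)
    let ?r = "card (L.P (N (Suc i)) (N i))"
    obtain m where m: "card (rcosets\<^bsub>\<Gamma>\<^esub> N (Suc i)) = p ^ m" using index by (auto simp: group_index_def)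
    then have fin: "finite (rcosets\<^bsub>\<Gamma>\<^esub> N (Suc i))" using p by (metis card.infinite power_eq_0_iff not_prime_0)
    have eq: "card (rcosets\<^bsub>\<Gamma>\<^esub> N (Suc i)) = ?r * card (rcosets\<^bsub>\<Gamma>\<^esub> N i)"
      by (rule L.card_rcosets_mult[OF normal normal N_Suc fin])
    show "group_index \<Gamma> (N (Suc i)) = ?r * group_index \<Gamma> (N i)" using eq by (simp add: group_index_def)
    show "?r > 0" using eq m p by (cases "?r = 0") auto
    fix b assume "?hom_le i b"
    from L.hom_le_cover_tower[OF normal normal N_Suc p assms(1) m cc this]
    show "?hom_le (Suc i) (?r * b)" .
  qed
  \<comment> \<open>A finite bound is established for \<open>X\<close> alone; the tower carries it
    to every cover, without cell structures on the covers.\<close>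
  have "\<exists>m. hom_le TYPE('k) (sing X) singular_face n m"
    using CW.noeth_homology_CW by (intro hom_le_of_noeth[OF assms(1) p]) (simp_all add: noeth_homology_def)
  then have hom0: "\<exists>m. ?hom_le 0 m" unfolding N_0 using L.hom_le_trivial_cover by blast
  have ex: "\<exists>m. ?hom_le i m" for i
  proof (induction i)
    case (Suc i)
    then obtain m where "?hom_le i m" ..
    then show ?case using step[of i] by blast
  qed (rule hom0)
  \<comment> \<open>The Betti number can itself serve as a bound only after some finite bound is
    known.\<close>
  have hom_betti: "?hom_le i (?b i)" for i
    unfolding hom_le_iff using ex[of i] hom_le_betti_number[OF chain_complex_singular] unfolding hom_le_iff by blast
  let ?s = "\<lambda>i. real (?b i) / real (group_index \<Gamma> (N i))"
  have "?s (Suc i) \<le> ?s i" for i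
  proof -
    obtain r where r: "r > 0" "group_index \<Gamma> (N (Suc i)) = r * group_index \<Gamma> (N i)" "?hom_le (Suc i) (r * ?b i)"
      using step[of i] hom_betti[of i] by blast
    have "?s (Suc i) \<le> real (r * ?b i) / real (group_index \<Gamma> (N (Suc i)))"
      using betti_le[OF r(3)] by (intro divide_right_mono of_nat_mono) simp_all
    also have "\<dots> = ?s i" using r(1,2) by simp
    finally show ?thesis .
  qed
  then have dec: "decseq ?s" by (simp add: decseq_Suc_iff)
  have "\<forall>i. 0 \<le> ?s i" by simp
  from decseq_convergent[OF dec this] obtain L where "?s \<longlonglongrightarrow> L" by blast
  then have "convergent ?s" by (rule convergentI)
  with dec show ?thesis by blast
qed

end
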